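(* Let $n,k,p\ge1$ be integers and let $\varpi_{n,k,p}$ be the unique vexillary permutation of shape $\lambda_{n,p}=(np,(n-1)p,\dots,2p,p)$ and flag $\phi_{n,k}=(k+1,k+2,\dots,k+n)$. Then $$\mathfrak{G}^{(\beta-1)}_{\varpi_{n,1,p}}(x_i=1\ \forall i)=\sum_{j=1}^{n+1}\frac1{n+1}\binom{n+1}{j}\binom{(n+1)p}{j-1}\beta^{j-1}.$$ If $k\ge2$, then $G_{n,k,p}(\beta):=\mathfrak{G}^{(\beta-1)}_{\varpi_{n,k,p}}(x_i=1\ \forall i)$ is a polynomial of degree $nk$ in $\beta$, and the coefficient of $\beta^{nk}$ in $G_{n,k,p}(\beta)$ is $$\det\left(\binom{(n-i+1)(p-1)+j+k-1}{k+i-1}\right)_{1\le i,j\le n+1}.$$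
   Context: $\varpi_{n,k,p}$ is explicitly the permutation $1^k\times w_\lambda$ whose code $c_i=\#\{j>i:\varpi(j)<\varpi(i)\}$ is $(0^k,np,(n-1)p,\dots,p,0,0,\dots)$. $\beta$-Grothendieck polynomials: let $\mathrm{IdC}_m(\beta)$ be the associative $\mathbb{Z}[\beta]$-algebra with generators $e_1,\dots,e_{m-1}$ and relations $e_ie_j=e_je_i$ if $|i-j|\ge2$, $e_ie_je_i=e_je_ie_j$ if $|i-j|=1$, $e_i^2=\beta e_i$. For $w\in\mathbb{S}_m$ put $e_w=e_{i_1}\cdots e_{i_\ell}$ for any reduced word $w=s_{i_1}\cdots s_{i_\ell}$ ($s_i=(i,i+1)$, permutations composed from right to left). With $h_i(x)=1+xe_i$, $A_i(x)=h_{m-1}(x)\cdots h_i(x)$, the polynomials $\mathfrak{G}_w^{(\beta)}$ are defined by $A_1(x_1)\cdots A_{m-1}(x_{m-1})=\sum_{w\in\mathbb{S}_m}\mathfrak{G}_w^{(\beta)}(x_1,\dots,x_{m-1})e_w$; $\mathfrak{G}_w^{(\beta-1)}$ means $\beta$ is replaced by $\beta-1$. Binomial coefficients $\binom ac$ with $0\le a<c$ are zero. *)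

theory Defs
  imports
    "HOL-Library.Poly_Mapping"
    "HOL-Library.Multiset"
    "HOL-Algebra.Ideal"
    "HOL-Combinatorics.Permutations"
    "HOL-Computational_Algebra.Polynomial"
    "Jordan_Normal_Form.Determinant"
begin

section \<open>Vexillary permutations, shape and flag\<close>

text \<open>A permutation in \<open>S\<^sub>m\<close> is a function \<open>w :: nat \<Rightarrow> nat\<close> with \<open>w permutes {1..m}\<close>; thus
  \<open>S\<^sub>m \<subseteq> S\<^bsub>m+1\<^esub>\<close> holds literally, and the product is function composition (right to left).\<close>

definition finitary_perm :: "(nat \<Rightarrow> nat) \<Rightarrow> bool" where
  "finitary_perm w \<longleftrightarrow> (\<exists>m. w permutes {1..m})"

definition code :: "(nat \<Rightarrow> nat) \<Rightarrow> nat \<Rightarrow> nat" where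
  "code w i = card {j. i < j \<and> w j < w i}"

definition vexillary :: "(nat \<Rightarrow> nat) \<Rightarrow> bool" where
  "vexillary w \<longleftrightarrow>
     \<not> (\<exists>a b c d. a < b \<and> b < c \<and> c < d \<and> w b < w a \<and> w a < w d \<and> w d < w c)"

text \<open>The shape is the list of nonzero code entries in decreasing order.\<close>

definition shape :: "(nat \<Rightarrow> nat) \<Rightarrow> nat list" where
  "shape w = rev (sorted_list_of_multiset (image_mset (code w) (mset_set {i. code w i > 0})))"

text \<open>The flag (Macdonald) lists in increasing order the numbers
  \<open>max {j \<ge> i. c\<^sub>j \<ge> c\<^sub>i}\<close>, one for each \<open>i\<close> with \<open>c\<^sub>i \<noteq> 0\<close>.\<close>

definition flag :: "(nat \<Rightarrow> nat) \<Rightarrow> nat list" where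
  "flag w = sorted_list_of_multiset
     (image_mset (\<lambda>i. Max {j. i \<le> j \<and> code w i \<le> code w j}) (mset_set {i. code w i > 0}))"

text \<open>The code of \<open>varpi n k p\<close> is \<open>(0\<^sup>k, np, (n-1)p, \<dots>, p, 0, 0, \<dots>)\<close>: the entries of the
  shape are distinct, so the \<open>i\<close>-th flag entry is a running maximum of their positions, and this
  is \<open>k + i\<close> for all \<open>i\<close> only if the \<open>i\<close>-th largest entry stands at position \<open>k + i\<close>.\<close>

definition varpi :: "nat \<Rightarrow> nat \<Rightarrow> nat \<Rightarrow> nat \<Rightarrow> nat" where
  "varpi n k p = (THE w. finitary_perm w \<and> vexillary w
     \<and> shape w = map (\<lambda>i. (n + 1 - i) * p) [1..<n+1]
     \<and> flag w = map (\<lambda>i. k + i) [1..<n+1])"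


section \<open>The algebra \<open>IdC\<^sub>m\<close>\<close>

text \<open>Words in the letters \<open>1, 2, \<dots>\<close> form the free monoid under concatenation, written
  additively so that \<^typ>\<open>'k \<Rightarrow>\<^sub>0 'a\<close> carries the convolution product; the free associative
  algebra over \<open>'a\<close> is then \<open>fword \<Rightarrow>\<^sub>0 'a\<close>.\<close>

datatype fword = Fword (letters: "nat list")

instantiation fword :: monoid_add
begin

definition zero_fword :: fword where
  "0 = Fword []"

definition plus_fword :: "fword \<Rightarrow> fword \<Rightarrow> fword" where
  "u + v = Fword (letters u @ letters v)"

instance
  by standard (simp_all add: zero_fword_def plus_fword_def)

end

definition scalar :: "'a::comm_ring_1 \<Rightarrow> (fword \<Rightarrow>\<^sub>0 'a)" where
  "scalar r = Poly_Mapping.single 0 r"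

definition gen :: "nat \<Rightarrow> (fword \<Rightarrow>\<^sub>0 'a::comm_ring_1)" where
  "gen i = Poly_Mapping.single (Fword [i]) 1"

text \<open>The free associative algebra on the generators \<open>e\<^sub>1, \<dots>, e\<^bsub>m-1\<^esub>\<close>.\<close>

definition free_algebra :: "nat \<Rightarrow> (fword \<Rightarrow>\<^sub>0 'a::comm_ring_1) ring" where
  "free_algebra m =
     \<lparr>carrier = {u. \<forall>v\<in>Poly_Mapping.keys u. set (letters v) \<subseteq> {1..<m}},
      monoid.mult = (*), one = 1, zero = 0, add = (+)\<rparr>"

definition idc_relators :: "nat \<Rightarrow> 'a::comm_ring_1 \<Rightarrow> (fword \<Rightarrow>\<^sub>0 'a) set" where
  "idc_relators m b =
     {gen i * gen j - gen j * gen i | i j. i \<in> {1..<m} \<and> j \<in> {1..<m} \<and> i + 2 \<le> j}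
   \<union> {gen i * gen (i+1) * gen i - gen (i+1) * gen i * gen (i+1) | i. i \<in> {1..<m} \<and> i + 1 \<in> {1..<m}}
   \<union> {gen i * gen i - scalar b * gen i | i. i \<in> {1..<m}}"

text \<open>\<open>genideal\<close> is the generated two-sided ideal. It is closed under multiplication by scalars,
  since these lie in the carrier, so the quotient ring \<open>free_algebra m Quot idc_ideal m b\<close> is the
  \<open>'a\<close>-algebra \<open>IdC\<^sub>m(b)\<close>, and \<open>idc_class m b u\<close> is the image of \<open>u\<close> in it.\<close>

definition idc_ideal :: "nat \<Rightarrow> 'a::comm_ring_1 \<Rightarrow> (fword \<Rightarrow>\<^sub>0 'a) set" where
  "idc_ideal m b = genideal (free_algebra m) (idc_relators m b)"

definition idc_class :: "nat \<Rightarrow> 'a::comm_ring_1 \<Rightarrow> (fword \<Rightarrow>\<^sub>0 'a) \<Rightarrow> (fword \<Rightarrow>\<^sub>0 'a) set" where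
  "idc_class m b u = a_r_coset (free_algebra m) (idc_ideal m b) u"

definition perm_of_letters :: "nat list \<Rightarrow> nat \<Rightarrow> nat" where
  "perm_of_letters is = foldr (\<lambda>i w. transpose i (i + 1) \<circ> w) is id"

definition reduced_word :: "nat \<Rightarrow> (nat \<Rightarrow> nat) \<Rightarrow> nat list \<Rightarrow> bool" where
  "reduced_word m w is \<longleftrightarrow> set is \<subseteq> {1..<m} \<and> perm_of_letters is = w
     \<and> (\<forall>js. set js \<subseteq> {1..<m} \<and> perm_of_letters js = w \<longrightarrow> length is \<le> length js)"

text \<open>A representative of \<open>e\<^sub>w\<close>; its class in \<open>IdC\<^sub>m\<close> does not depend on the reduced word chosen,
  because reduced words of \<open>w\<close> are connected by the first two kinds of relations.\<close>

definition e_perm :: "nat \<Rightarrow> (nat \<Rightarrow> nat) \<Rightarrow> (fword \<Rightarrow>\<^sub>0 'a::comm_ring_1)" where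
  "e_perm m w = prod_list (map gen (SOME is. reduced_word m w is))"


section \<open>\<open>\<beta>\<close>-Grothendieck polynomials\<close>

text \<open>\<open>\<int>[\<beta>][x\<^sub>1, x\<^sub>2, \<dots>]\<close>. The product \<open>A\<^sub>1(x\<^sub>1) \<cdots> A\<^bsub>m-1\<^esub>(x\<^bsub>m-1\<^esub>)\<close> lives in
  \<open>IdC\<^sub>m(\<beta>)\<close> with scalars extended from \<open>\<int>[\<beta>]\<close> to this ring, which is the algebra with the same
  presentation over this ring.\<close>

type_synonym xpoly = "(nat \<Rightarrow>\<^sub>0 nat) \<Rightarrow>\<^sub>0 int poly"

definition xvar :: "nat \<Rightarrow> xpoly" where
  "xvar i = Poly_Mapping.single (Poly_Mapping.single i 1) 1"

definition beta :: xpoly where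
  "beta = Poly_Mapping.single 0 [:0, 1:]"

definition h_factor :: "nat \<Rightarrow> xpoly \<Rightarrow> (fword \<Rightarrow>\<^sub>0 xpoly)" where
  "h_factor i x = 1 + scalar x * gen i"

definition A_factor :: "nat \<Rightarrow> nat \<Rightarrow> xpoly \<Rightarrow> (fword \<Rightarrow>\<^sub>0 xpoly)" where
  "A_factor m i x = prod_list (map (\<lambda>j. h_factor j x) (rev [i..<m]))"

definition grothendieck_family :: "nat \<Rightarrow> ((nat \<Rightarrow> nat) \<Rightarrow> xpoly) \<Rightarrow> bool" where
  "grothendieck_family m G \<longleftrightarrow>
     (\<forall>w. \<not> w permutes {1..m} \<longrightarrow> G w = 0)
     \<and> idc_class m beta (prod_list (map (\<lambda>i. A_factor m i (xvar i)) [1..<m]))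
       = idc_class m beta (\<Sum>w | w permutes {1..m}. scalar (G w) * e_perm m w)"

definition grothendieck :: "nat \<Rightarrow> (nat \<Rightarrow> nat) \<Rightarrow> xpoly" where
  "grothendieck m = (THE G. grothendieck_family m G)"

definition subst_beta :: "int poly \<Rightarrow> xpoly \<Rightarrow> xpoly" where
  "subst_beta q P = Poly_Mapping.map (\<lambda>c. pcompose c q) P"

definition eval_x :: "(nat \<Rightarrow> int poly) \<Rightarrow> xpoly \<Rightarrow> int poly" where
  "eval_x f P = (\<Sum>a\<in>Poly_Mapping.keys P. Poly_Mapping.lookup P a
     * (\<Prod>i\<in>Poly_Mapping.keys a. f i ^ Poly_Mapping.lookup a i))"

text \<open>\<open>\<GG>\<^sub>w\<close> with \<open>\<beta>\<close> replaced by \<open>\<beta> - 1\<close>, at \<open>x\<^sub>i = 1\<close> for all \<open>i\<close>, computed in \<open>S\<^sub>m\<close>.\<close>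

definition groth_at_ones :: "nat \<Rightarrow> (nat \<Rightarrow> nat) \<Rightarrow> int poly" where
  "groth_at_ones m w = eval_x (\<lambda>i. 1) (subst_beta [:-1, 1:] (grothendieck m w))"

end

theory Submission
  imports Defs "HOL-Computational_Algebra.Polynomial_FPS"
begin

text \<open>Write \<open>b = \<beta> - 1\<close> and \<open>\<lambda> = (n p, \<dots>, 2 p, p)\<close>. The heart of the proof is the determinantal formula
\<open>Gr_ones_flag_perm\<close>: for a strictly decreasing \<open>\<lambda>\<close> of length \<open>n\<close> and the vexillary permutation
with code \<open>(0\<^sup>k, \<lambda>\<^sub>1, \<dots>, \<lambda>\<^sub>n)\<close>, the value of its Grothendieck polynomial at \<open>x\<^sub>i = 1\<close> is the determinant
of the \<open>n \<times> n\<close> matrix whose entry \<open>(i, j)\<close> is the coefficient of \<open>s\<^bsup>k+i-j\<^esup>\<close> in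
\<open>(1 - \<beta> s)\<close> to the power \<open>-\<lambda>\<^sub>i\<close> times \<open>(1 - s)\<close> to the power \<open>-(n - i + 1)\<close>.

The algebra \<open>IdC\<^sub>m(b)\<close> acts from the right on functions on permutations, by the formula for the
right regular representation. Any two reduced words of a permutation are congruent (\<open>matsumoto\<close>), so
the \<open>e\<^sub>w\<close> span, and the action on the indicator function of the identity shows that they are
independent (\<open>eqv_span_iff\<close>). Hence the Grothendieck polynomials exist, are unique, and are the
values \<open>Gr b m x w\<close> of a function obtained by applying the factors \<open>1 + x\<^sub>i e\<^sub>j\<close> one after the
other (\<open>grothendieck_eq\<close>). This makes sense over every commutative ring and is compatible with ring
homomorphisms, so real values of \<open>\<beta>\<close> and \<open>x\<close> suffice (\<open>poly_groth_at_ones\<close>).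

Two facts about \<open>Gr\<close> are used. By the Yang-Baxter relation the factors \<open>A\<^sub>i(x)\<close> and \<open>A\<^sub>i(y)\<close>
commute, which yields the isobaric divided difference relating \<open>Gr\<close> at \<open>w s\<^sub>i\<close> and at \<open>w\<close>
(\<open>Gr_descent\<close>). And if \<open>w\<close> has code \<open>(c, code u)\<close>, where \<open>u\<close> fixes all numbers above \<open>c\<close>, then \<open>Gr\<close> at \<open>w\<close>
is \<open>x\<^sub>1\<^sup>c\<close> times \<open>Gr\<close> at \<open>u\<close> in the remaining variables (\<open>Gr_ins\<close>). The permutation with code
\<open>(0\<^sup>k, \<lambda>)\<close> arises from the one with code \<open>(\<lambda>\<^sub>1 + k, 0\<^sup>k, \<lambda>\<^sub>2, \<dots>)\<close> by \<open>k\<close> such divided differences, which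
gives a recursion on the rows of \<open>\<lambda>\<close>. With the substitution \<open>x\<^sub>i = 1 / (1 - \<beta> s\<^sub>i)\<close> a divided
difference turns into an ordinary one: it takes a Newton divided difference of a function \<open>g\<close> on
\<open>s\<^sub>1, \<dots>, s\<^sub>t\<close> to that of \<open>(1 - \<beta> z) g\<close> on \<open>s\<^sub>1, \<dots>, s\<^bsub>t+1\<^esub>\<close> (\<open>GX_row\<close>). Expanding along the first row, the recursion is
solved by a determinant of divided differences (\<open>GX_flag_perm\<close>). Letting the nodes \<open>s\<^sub>i\<close> tend to \<open>0\<close>
turns divided differences into Taylor coefficients.

For \<open>k = 1\<close> the matrix is of Hessenberg type with rows \<open>\<psi>\<^sup>n, \<dots>, \<psi>\<close>, where
\<open>1 / \<psi> = (1 - \<beta> s)\<^sup>p (1 - s)\<close>. Its determinant is, up to sign, a coefficient of the compositional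
inverse of \<open>s \<psi>\<close>, and Lagrange inversion evaluates it (\<open>hessenberg_det\<close>). For general \<open>k\<close> the entry
\<open>(i, j)\<close> has degree at most \<open>k + i - j\<close> in \<open>\<beta>\<close>. So the determinant has degree at most \<open>n k\<close>, and its
coefficient there is the determinant of the leading coefficients (\<open>groth_degree\<close>). That one is positive, by the
recursion of nonintersecting lattice paths (\<open>path_det_nonneg\<close>, \<open>path_det_pos\<close>), and a unimodular
change of basis of the polynomials of degree less than \<open>n\<close> brings it to the asserted form
(\<open>path_det_eq_choose\<close>).

Finally the shape and the flag determine the code, and the code determines the permutation (\<open>varpi_eq\<close>).\<close>

section \<open>The right regular representation\<close>

text \<open>The right action of \<open>e\<^sub>i\<close> on a function \<open>f\<close> on permutations, seen as the formal sum of the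
  \<open>f w\<close> times \<open>w\<close>: \<open>w e\<^sub>i\<close> is \<open>w s\<^sub>i\<close> if \<open>w i < w (i + 1)\<close>, and \<open>b w\<close> otherwise. The value is set to \<open>0\<close> where
  \<open>w\<close> is not injective; then the relations of the algebra hold for all functions, not only for those
  supported on permutations.\<close>

definition act :: "'a::comm_ring_1 \<Rightarrow> nat \<Rightarrow> ((nat \<Rightarrow> nat) \<Rightarrow> 'a) \<Rightarrow> (nat \<Rightarrow> nat) \<Rightarrow> 'a" where
  "act b i f = (\<lambda>w. if inj w \<and> w (Suc i) < w i
     then f (w \<circ> transpose i (Suc i)) + b * f w else 0)"

lemma inj_comp_transpose [simp]: "inj (w \<circ> transpose i j) \<longleftrightarrow> inj w"
proof
  assume "inj (w \<circ> transpose i j)"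
  then have "inj ((w \<circ> transpose i j) \<circ> transpose i j)"
    by (rule inj_compose) auto
  also have "(w \<circ> transpose i j) \<circ> transpose i j = w"
    by (simp add: fun_eq_iff)
  finally show "inj w" .
qed (rule inj_compose, auto)

lemma act_add: "act b i (\<lambda>w. f w + g w) = (\<lambda>w. act b i f w + act b i g w)"
  by (auto simp: act_def algebra_simps)

lemma act_cmult: "act b i (\<lambda>w. c * f w) = (\<lambda>w. c * act b i f w)"
  by (auto simp: act_def algebra_simps)

lemma act_quadratic: "act b i (act b i f) = (\<lambda>w. b * act b i f w)"
  by (rule ext) (auto simp: act_def comp_assoc)

lemma act_commute:
  assumes "i + 2 \<le> j"
  shows "act b i (act b j f) = act b j (act b i f)"
proof -
  have c: "transpose i (Suc i) \<circ> transpose j (Suc j) = transpose j (Suc j) \<circ> transpose i (Suc i)"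
    using assms by (auto simp: fun_eq_iff transpose_def)
  show ?thesis
    using assms by (auto simp: act_def fun_eq_iff comp_assoc c transpose_def algebra_simps)
qed

lemma act_braid:
  "act b i (act b (Suc i) (act b i f)) = act b (Suc i) (act b i (act b (Suc i) f))"
proof
  fix w :: "nat \<Rightarrow> nat"
  define s where "s = transpose i (Suc i)"
  define t where "t = transpose (Suc i) (Suc (Suc i))"
  have br: "s \<circ> (t \<circ> s) = t \<circ> (s \<circ> t)"
    by (auto simp: s_def t_def fun_eq_iff transpose_def)
  have inv: "s \<circ> s = id" "t \<circ> t = id" by (auto simp: s_def t_def)
  have v: "s i = Suc i" "s (Suc i) = i" "s (Suc (Suc i)) = Suc (Suc i)"
    "t i = i" "t (Suc i) = Suc (Suc i)" "t (Suc (Suc i)) = Suc i"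
    by (auto simp: s_def t_def)
  have as: "act b i g = (\<lambda>w. if inj w \<and> w (Suc i) < w i then g (w \<circ> s) + b * g w else 0)" for g
    unfolding act_def s_def ..
  have at: "act b (Suc i) g = (\<lambda>w. if inj w \<and> w (Suc (Suc i)) < w (Suc i)
      then g (w \<circ> t) + b * g w else 0)" for g
    unfolding act_def t_def ..
  have ij: "inj (w \<circ> s) = inj w" "inj (w \<circ> t) = inj w"
    "inj (w \<circ> (s \<circ> t)) = inj w" "inj (w \<circ> (t \<circ> s)) = inj w" for w :: "nat \<Rightarrow> nat"
    by (simp_all add: s_def t_def flip: comp_assoc)
  show "act b i (act b (Suc i) (act b i f)) w = act b (Suc i) (act b i (act b (Suc i) f)) w"
  proof (cases "inj w")
    case True
    then have "w i \<noteq> w (Suc i)" "w i \<noteq> w (Suc (Suc i))" "w (Suc i) \<noteq> w (Suc (Suc i))"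
      by (auto simp: inj_eq)
    then show ?thesis
      by (simp add: as at ij v comp_assoc br inv algebra_simps not_less)
  qed (simp add: as at)
qed

lemma fold_act_sum:
  "fold (act b) us (\<lambda>w. \<Sum>a\<in>A. c a * F a w) = (\<lambda>w. \<Sum>a\<in>A. c a * fold (act b) us (F a) w)"
proof (induction us arbitrary: F)
  case (Cons i us)
  have "act b i (\<lambda>w. \<Sum>a\<in>A. c a * F a w) = (\<lambda>w. \<Sum>a\<in>A. c a * act b i (F a) w)"
    by (auto simp: act_def fun_eq_iff algebra_simps sum.distrib sum_distrib_left)
  then show ?case by (simp add: Cons)
qed simp

text \<open>The action extended to the free algebra. It is a right action: a product acts by its left factor
  first (\<open>rep_mult\<close>).\<close>

definition rep :: "'a::comm_ring_1 \<Rightarrow> (fword \<Rightarrow>\<^sub>0 'a) \<Rightarrow> ((nat \<Rightarrow> nat) \<Rightarrow> 'a) \<Rightarrow> (nat \<Rightarrow> nat) \<Rightarrow> 'a" where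
  "rep b u f = (\<lambda>w. \<Sum>v\<in>Poly_Mapping.keys u. Poly_Mapping.lookup u v * fold (act b) (letters v) f w)"

lemma rep_superset:
  assumes "finite A" "Poly_Mapping.keys u \<subseteq> A"
  shows "rep b u f w = (\<Sum>v\<in>A. Poly_Mapping.lookup u v * fold (act b) (letters v) f w)"
  unfolding rep_def using assms
  by (intro sum.mono_neutral_left) (auto simp: in_keys_iff)

lemma rep_add: "rep b (u + v) f w = rep b u f w + rep b v f w"
proof -
  let ?A = "Poly_Mapping.keys u \<union> Poly_Mapping.keys v"
  have "rep b x f w = (\<Sum>v\<in>?A. Poly_Mapping.lookup x v * fold (act b) (letters v) f w)"
    if "x \<in> {u, v, u + v}" for x
    using that keys_add[of u v] by (intro rep_superset) auto
  then show ?thesis by (simp add: lookup_add algebra_simps sum.distrib)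
qed

lemma rep_zero [simp]: "rep b 0 f = (\<lambda>w. 0)"
  by (simp add: rep_def)

lemma rep_uminus: "rep b (- u) f w = - rep b u f w"
  by (simp add: rep_def sum_negf)

lemma rep_diff: "rep b (u - v) f w = rep b u f w - rep b v f w"
  using rep_add[of b u "- v" f w] by (simp add: rep_uminus)

lemma rep_sum: "rep b (sum F A) f w = (\<Sum>a\<in>A. rep b (F a) f w)"
  by (induction A rule: infinite_finite_induct) (auto simp: rep_add)

lemma rep_single: "rep b (Poly_Mapping.single v c) f w = c * fold (act b) (letters v) f w"
  by (simp add: rep_def)

lemma rep_linear: "rep b u (\<lambda>w. \<Sum>a\<in>A. c a * F a w) w = (\<Sum>a\<in>A. c a * rep b u (F a) w)"
  by (simp add: rep_def fold_act_sum sum_distrib_left sum_distrib_right algebra_simps)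
    (subst sum.swap, simp add: algebra_simps)

lemma letters_plus [simp]: "letters (u + v) = letters u @ letters v"
  by (simp add: plus_fword_def)

lemma letters_zero [simp]: "letters 0 = []"
  by (simp add: zero_fword_def)

lemma poly_mapping_eq_sum:
  "u = (\<Sum>a\<in>Poly_Mapping.keys u. Poly_Mapping.single a (Poly_Mapping.lookup u a))"
  by (rule poly_mapping_eqI) (auto simp: lookup_sum lookup_single when_def in_keys_iff)

lemma rep_mult: "rep b (u * v) f = rep b v (rep b u f)"
proof
  fix w
  have "u * v = (\<Sum>x\<in>Poly_Mapping.keys u. \<Sum>y\<in>Poly_Mapping.keys v.
      Poly_Mapping.single (x + y) (Poly_Mapping.lookup u x * Poly_Mapping.lookup v y))"
    by (subst poly_mapping_eq_sum[of u], subst poly_mapping_eq_sum[of v])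
      (simp add: sum_product mult_single)
  then have "rep b (u * v) f w = (\<Sum>x\<in>Poly_Mapping.keys u. \<Sum>y\<in>Poly_Mapping.keys v.
      Poly_Mapping.lookup u x * Poly_Mapping.lookup v y
        * fold (act b) (letters y) (fold (act b) (letters x) f) w)"
    by (simp add: rep_sum rep_single)
  also have "\<dots> = (\<Sum>x\<in>Poly_Mapping.keys u. Poly_Mapping.lookup u x
        * rep b v (fold (act b) (letters x) f) w)"
    by (simp add: rep_def[of b v] sum_distrib_left algebra_simps)
  also have "\<dots> = rep b v (rep b u f) w"
    by (subst rep_def[of b u]) (simp add: rep_linear)
  finally show "rep b (u * v) f w = rep b v (rep b u f) w" .
qed

lemma rep_one [simp]: "rep b 1 f = f"
  using rep_single[of b 0 1 f] by (simp add: fun_eq_iff)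

lemma rep_scalar [simp]: "rep b (scalar c) f w = c * f w"
  by (simp add: scalar_def rep_single)

lemma rep_gen [simp]: "rep b (gen i) f = act b i f"
  by (simp add: gen_def rep_single fun_eq_iff)

lemma rep_relator:
  assumes "u \<in> idc_relators m b"
  shows "rep b u f w = 0"
proof -
  consider (comm) i j where "u = gen i * gen j - gen j * gen i" "i + 2 \<le> j"
    | (braid) i where "u = gen i * gen (i+1) * gen i - gen (i+1) * gen i * gen (i+1)"
    | (quad) i where "u = gen i * gen i - scalar b * gen i"
    using assms unfolding idc_relators_def by blast
  then show ?thesis
  proof cases
    case comm
    then show ?thesis using act_commute[of i j b f] by (simp add: rep_diff rep_mult)
  next
    case braid
    then show ?thesis using act_braid[of b i f] by (simp add: rep_diff rep_mult)
  next
    case (quad i)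
    have "rep b (scalar b) f = (\<lambda>w. b * f w)" by (rule ext) simp
    then show ?thesis using quad by (simp add: rep_diff rep_mult act_quadratic act_cmult)
  qed
qed


section \<open>The ideal of relations\<close>

lemma free_algebra_simps [simp]:
  "monoid.mult (free_algebra m) = (*)" "one (free_algebra m) = 1"
  "zero (free_algebra m) = 0" "add (free_algebra m) = (+)"
  by (simp_all add: free_algebra_def)

text \<open>The elements of the free algebra on \<open>e\<^sub>1, \<dots>, e\<^bsub>m-1\<^esub>\<close>, as a set.\<close>

abbreviation FA :: "nat \<Rightarrow> (fword \<Rightarrow>\<^sub>0 'a::comm_ring_1) set" where
  "FA m \<equiv> carrier (free_algebra m)"

lemma in_FA: "u \<in> FA m \<longleftrightarrow> (\<forall>v\<in>Poly_Mapping.keys u. set (letters v) \<subseteq> {1..<m})"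
  by (simp add: free_algebra_def)

lemma FA_zero [simp]: "0 \<in> FA m" by (simp add: in_FA)
lemma FA_one [simp]: "1 \<in> FA m" by (simp add: in_FA)
lemma FA_scalar [simp]: "scalar c \<in> FA m" by (simp add: in_FA scalar_def)
lemma FA_gen: "i \<in> {1..<m} \<Longrightarrow> gen i \<in> FA m" by (simp add: in_FA gen_def)
lemma FA_add: "u \<in> FA m \<Longrightarrow> v \<in> FA m \<Longrightarrow> u + v \<in> FA m"
  using keys_add[of u v] by (fastforce simp: in_FA)
lemma FA_uminus: "u \<in> FA m \<Longrightarrow> - u \<in> FA m"
  by (simp add: in_FA)
lemma FA_diff: "u \<in> FA m \<Longrightarrow> v \<in> FA m \<Longrightarrow> u - v \<in> FA m"
  using FA_add[of u m "- v"] by (simp add: FA_uminus)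
lemma FA_mult: "u \<in> FA m \<Longrightarrow> v \<in> FA m \<Longrightarrow> u * v \<in> FA m"
  using keys_mult[of u v] by (fastforce simp: in_FA)
lemma FA_sum: "(\<And>a. a \<in> A \<Longrightarrow> F a \<in> FA m) \<Longrightarrow> sum F A \<in> FA m"
  by (induction A rule: infinite_finite_induct) (auto simp: FA_add)
lemma FA_prod_list: "(\<And>u. u \<in> set us \<Longrightarrow> u \<in> FA m) \<Longrightarrow> prod_list us \<in> FA m"
  by (induction us) (auto simp: FA_mult)

lemma ring_free_algebra: "ring (free_algebra m :: (fword \<Rightarrow>\<^sub>0 'a::comm_ring_1) ring)"
proof (rule ringI)
  show "abelian_group (free_algebra m :: (fword \<Rightarrow>\<^sub>0 'a) ring)"
  proof (rule abelian_groupI)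
    fix u :: "fword \<Rightarrow>\<^sub>0 'a" assume "u \<in> FA m"
    then show "\<exists>v\<in>FA m. v \<oplus>\<^bsub>free_algebra m\<^esub> u = \<zero>\<^bsub>free_algebra m\<^esub>"
      by (intro bexI[of _ "- u"]) (auto simp: FA_uminus)
  qed (auto simp: FA_add algebra_simps)
  show "monoid (free_algebra m :: (fword \<Rightarrow>\<^sub>0 'a) ring)"
    by (rule monoidI) (auto simp: FA_mult algebra_simps)
qed (auto simp: algebra_simps)

lemma a_minus_free_algebra:
  assumes "u \<in> FA m" "v \<in> FA m"
  shows "u \<ominus>\<^bsub>free_algebra m\<^esub> v = u - v"
proof -
  interpret ring "free_algebra m :: (fword \<Rightarrow>\<^sub>0 'a) ring" by (rule ring_free_algebra)
  have "\<ominus>\<^bsub>free_algebra m\<^esub> v = - v"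
    by (rule minus_equality) (use assms in \<open>auto simp: FA_uminus\<close>)
  then show ?thesis by (simp add: a_minus_def)
qed

lemma idc_relators_subset: "idc_relators m b \<subseteq> FA m"
  unfolding idc_relators_def by (auto intro!: FA_diff FA_mult FA_gen)

lemma idc_ideal_ideal: "ideal (idc_ideal m b) (free_algebra m)"
  unfolding idc_ideal_def
  by (rule ring.genideal_ideal[OF ring_free_algebra idc_relators_subset])

lemma idc_ideal_closed:
  "u \<in> idc_ideal m b \<Longrightarrow> u \<in> FA m"
  "0 \<in> idc_ideal m b"
  "u \<in> idc_ideal m b \<Longrightarrow> v \<in> idc_ideal m b \<Longrightarrow> u + v \<in> idc_ideal m b"
  "u \<in> idc_ideal m b \<Longrightarrow> x \<in> FA m \<Longrightarrow> x * u \<in> idc_ideal m b"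
  "u \<in> idc_ideal m b \<Longrightarrow> x \<in> FA m \<Longrightarrow> u * x \<in> idc_ideal m b"
  "u \<in> idc_relators m b \<Longrightarrow> u \<in> idc_ideal m b"
proof -
  interpret ideal "idc_ideal m b" "free_algebra m" by (rule idc_ideal_ideal)
  show "u \<in> idc_ideal m b \<Longrightarrow> u \<in> FA m" by (rule Icarr)
  show "0 \<in> idc_ideal m b" using additive_subgroup.zero_closed[OF is_additive_subgroup] by simp
  show "u \<in> idc_ideal m b \<Longrightarrow> v \<in> idc_ideal m b \<Longrightarrow> u + v \<in> idc_ideal m b"
    using additive_subgroup.a_closed[OF is_additive_subgroup] by simp
  show "u \<in> idc_ideal m b \<Longrightarrow> x \<in> FA m \<Longrightarrow> x * u \<in> idc_ideal m b"
    using I_l_closed by simp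
  show "u \<in> idc_ideal m b \<Longrightarrow> x \<in> FA m \<Longrightarrow> u * x \<in> idc_ideal m b"
    using I_r_closed by simp
  show "u \<in> idc_relators m b \<Longrightarrow> u \<in> idc_ideal m b"
    using ring.genideal_self[OF ring_free_algebra idc_relators_subset, of m b]
    by (auto simp: idc_ideal_def)
qed

text \<open>Congruence modulo the ideal of relations.\<close>

definition eqv :: "nat \<Rightarrow> 'a::comm_ring_1 \<Rightarrow> (fword \<Rightarrow>\<^sub>0 'a) \<Rightarrow> (fword \<Rightarrow>\<^sub>0 'a) \<Rightarrow> bool" where
  "eqv m b u v \<longleftrightarrow> u - v \<in> idc_ideal m b"

lemma idc_class_eq_iff:
  "u \<in> FA m \<Longrightarrow> v \<in> FA m \<Longrightarrow> idc_class m b u = idc_class m b v \<longleftrightarrow> eqv m b u v"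
  using ring.quotient_eq_iff_same_a_r_cos[OF ring_free_algebra idc_ideal_ideal[of m b], of u v]
  by (simp add: idc_class_def a_minus_free_algebra eqv_def)

lemma eqv_refl [simp]: "eqv m b u u"
  by (simp add: eqv_def idc_ideal_closed)

lemma eqv_add: "eqv m b u v \<Longrightarrow> eqv m b u' v' \<Longrightarrow> eqv m b (u + u') (v + v')"
  unfolding eqv_def using idc_ideal_closed(3)[of "u - v" m b "u' - v'"]
  by (simp add: algebra_simps)

lemma eqv_trans [trans]: "eqv m b u v \<Longrightarrow> eqv m b v w \<Longrightarrow> eqv m b u w"
  unfolding eqv_def using idc_ideal_closed(3)[of "u - v" m b "v - w"] by simp

lemma eqv_sym: "eqv m b u v \<Longrightarrow> eqv m b v u"
  unfolding eqv_def using idc_ideal_closed(4)[of "u - v" m b "- 1"] by (simp add: FA_uminus)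

lemma eqv_mult_left: "eqv m b u v \<Longrightarrow> x \<in> FA m \<Longrightarrow> eqv m b (x * u) (x * v)"
  unfolding eqv_def using idc_ideal_closed(4)[of "u - v" m b x] by (simp add: algebra_simps)

lemma eqv_mult_right: "eqv m b u v \<Longrightarrow> x \<in> FA m \<Longrightarrow> eqv m b (u * x) (v * x)"
  unfolding eqv_def using idc_ideal_closed(5)[of "u - v" m b x] by (simp add: algebra_simps)

lemma eqv_relations:
  assumes "i \<in> {1..<m}"
  shows "j \<in> {1..<m} \<Longrightarrow> i + 2 \<le> j \<or> j + 2 \<le> i \<Longrightarrow> eqv m b (gen i * gen j) (gen j * gen i)"
    and "Suc i \<in> {1..<m} \<Longrightarrow>
      eqv m b (gen i * gen (Suc i) * gen i) (gen (Suc i) * gen i * gen (Suc i))"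
    and "eqv m b (gen i * gen i) (scalar b * gen i)"
proof -
  have *: "eqv m b (gen i * gen j) (gen j * gen i)"
    if "i + 2 \<le> j" "i \<in> {1..<m}" "j \<in> {1..<m}" for i j
    unfolding eqv_def by (rule idc_ideal_closed(6)) (use that in \<open>unfold idc_relators_def, blast\<close>)
  show "j \<in> {1..<m} \<Longrightarrow> i + 2 \<le> j \<or> j + 2 \<le> i \<Longrightarrow> eqv m b (gen i * gen j) (gen j * gen i)"
    using *[of i j] *[of j i] assms by (auto intro: eqv_sym)
  show "eqv m b (gen i * gen (Suc i) * gen i) (gen (Suc i) * gen i * gen (Suc i))"
    if "Suc i \<in> {1..<m}"
    unfolding eqv_def
    by (rule idc_ideal_closed(6)) (use that assms in \<open>fastforce simp: idc_relators_def\<close>)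
  show "eqv m b (gen i * gen i) (scalar b * gen i)"
    unfolding eqv_def
    by (rule idc_ideal_closed(6)) (use assms in \<open>unfold idc_relators_def, blast\<close>)
qed

text \<open>The elements that act as zero form a two-sided ideal containing the relators.\<close>

lemma rep_eqv:
  fixes u v :: "fword \<Rightarrow>\<^sub>0 'a::comm_ring_1"
  assumes "eqv m b u v"
  shows "rep b u f = rep b v f"
proof -
  define K where "K = {u \<in> FA m. \<forall>f w. rep b u f w = (0::'a)}"
  interpret R: ring "free_algebra m :: (fword \<Rightarrow>\<^sub>0 'a) ring" by (rule ring_free_algebra)
  have z: "rep b u (\<lambda>w. 0) w = 0" for u w
    using rep_linear[where A = "{}"] by simp
  have "ideal K (free_algebra m)"
  proof (rule idealI[OF ring_free_algebra])
    show "subgroup K (add_monoid (free_algebra m))"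
    proof
      fix u assume u: "u \<in> K"
      then have "\<ominus>\<^bsub>free_algebra m\<^esub> u = - u"
        using a_minus_free_algebra[of 0 m u] by (auto simp: K_def a_minus_def FA_uminus)
      then show "inv\<^bsub>add_monoid (free_algebra m)\<^esub> u \<in> K"
        using u by (simp add: a_inv_def K_def FA_uminus rep_uminus)
    qed (auto simp: K_def FA_add rep_add)
    fix u x :: "fword \<Rightarrow>\<^sub>0 'a" assume u: "u \<in> K" and x: "x \<in> FA m"
    show "x \<otimes>\<^bsub>free_algebra m\<^esub> u \<in> K"
      using u x by (auto simp: K_def FA_mult rep_mult)
    have "rep b u f = (\<lambda>w. 0)" for f using u by (auto simp: K_def)
    then show "u \<otimes>\<^bsub>free_algebra m\<^esub> x \<in> K"
      using u x by (auto simp: K_def FA_mult rep_mult z)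
  qed
  moreover have "idc_relators m b \<subseteq> K"
    using idc_relators_subset rep_relator by (auto simp: K_def)
  ultimately have "idc_ideal m b \<subseteq> K"
    unfolding idc_ideal_def by (rule R.genideal_minimal)
  then show ?thesis using assms by (auto simp: eqv_def K_def rep_diff fun_eq_iff)
qed


section \<open>Reduced words\<close>

text \<open>Reduced words, built by adding a letter \<open>i\<close> at the end whenever this increases the number of
  inversions. That these are the shortest words of a permutation is \<open>red_word_shorter\<close>.\<close>

inductive red :: "nat \<Rightarrow> (nat \<Rightarrow> nat) \<Rightarrow> nat list \<Rightarrow> bool" for m where
  red_Nil: "red m id []"
| red_snoc: "red m w us \<Longrightarrow> i \<in> {1..<m} \<Longrightarrow> w i < w (Suc i) \<Longrightarrow>
    red m (w \<circ> transpose i (Suc i)) (us @ [i])"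

lemma permutes_comp_transpose:
  "w permutes {1..m} \<Longrightarrow> i \<in> {1..<m} \<Longrightarrow> w \<circ> transpose i (Suc i) permutes {1..m}"
  by (rule permutes_compose[rotated], assumption, rule permutes_swap_id) auto

lemma red_permutes: "red m w us \<Longrightarrow> w permutes {1..m}"
  by (induction rule: red.induct) (rule permutes_id, rule permutes_comp_transpose)

lemma comp_transpose_twice: "w \<circ> transpose i j \<circ> transpose i j = w"
  by (simp add: fun_eq_iff)

lemma red_snocD:
  assumes "red m w (us @ [i])"
  shows "red m (w \<circ> transpose i (Suc i)) us" "w (Suc i) < w i" "i \<in> {1..<m}"
proof -
  obtain w' where w': "w = w' \<circ> transpose i (Suc i)" "red m w' us" "i \<in> {1..<m}" "w' i < w' (Suc i)"
    using assms by (cases rule: red.cases) simp_all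
  show "red m (w \<circ> transpose i (Suc i)) us"
    unfolding w'(1) comp_transpose_twice by (rule w'(2))
  show "w (Suc i) < w i" "i \<in> {1..<m}"
    using w'(3,4) by (simp_all add: w'(1))
qed

lemma red_descent:
  assumes "red m (w \<circ> transpose i (Suc i)) us" "i \<in> {1..<m}" "w (Suc i) < w i"
  shows "red m w (us @ [i])"
  using red_snoc[OF assms(1,2)] assms(3) unfolding comp_transpose_twice
  by (simp only: o_apply transpose_apply_first transpose_apply_second)

lemma red_set: "red m w us \<Longrightarrow> set us \<subseteq> {1..<m}"
  by (induction rule: red.induct) auto

lemma ascending_permutes_id:
  assumes w: "w permutes {1..m}" and asc: "\<And>i. i \<in> {1..<m} \<Longrightarrow> w i < w (Suc i)"
  shows "w = id"
proof (rule permutes_natset_ge[OF w], rule ballI)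
  fix i assume "i \<in> {1..m}"
  then have "1 \<le> i" "i \<le> m" by auto
  then show "i \<le> w i"
  proof (induction i rule: dec_induct)
    case base
    then show ?case using permutes_in_image[OF w, of 1] by auto
  next
    case (step i)
    then have "i \<le> w i" "w i < w (Suc i)" using asc[of i] by auto
    then show ?case by simp
  qed
qed

lemma inj_Suc_neq: "inj w \<Longrightarrow> w i \<noteq> w (Suc i)" for w :: "nat \<Rightarrow> nat"
  by (simp add: inj_eq)

text \<open>Sorting \<open>w\<close> by adjacent transpositions stops, because removing a descent increases
  the sum of the \<open>a \<cdot> w a\<close>.\<close>

lemma ex_red:
  assumes "w permutes {1..m}"
  shows "\<exists>us. red m w us"
  using assms
proof (induction "(\<Sum>a\<in>{1..m}. a * m) - (\<Sum>a\<in>{1..m}. a * w a)" arbitrary: w rule: less_induct)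
  case less
  show ?case
  proof (cases "\<exists>i\<in>{1..<m}. w (Suc i) < w i")
    case False
    then have "w i < w (Suc i)" if "i \<in> {1..<m}" for i
      using that inj_Suc_neq[OF permutes_inj[OF less.prems], of i] by force
    then have "w = id" by (rule ascending_permutes_id[OF less.prems])
    then show ?thesis using red_Nil[of m] by metis
  next
    case True
    then obtain i where i: "i \<in> {1..<m}" "w (Suc i) < w i" by blast
    define s where "s = transpose i (Suc i)"
    have s: "s permutes {1..m}" unfolding s_def by (rule permutes_swap_id) (use i in auto)
    have ws: "w \<circ> s permutes {1..m}" using permutes_compose[OF s less.prems] .
    have ss: "s (s a) = a" for a by (simp add: s_def)
    have "(\<Sum>a\<in>{1..m}. int (a * (w \<circ> s) a)) = (\<Sum>a\<in>{1..m}. int (s a * w a))"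
      by (subst sum.permute[OF s]) (simp add: o_def ss)
    also have "\<dots> = (\<Sum>a\<in>{1..m}. int (a * w a)) + (\<Sum>a\<in>{1..m}. (int (s a) - int a) * int (w a))"
      unfolding sum.distrib[symmetric] by (intro sum.cong) (auto simp: algebra_simps)
    also have "(\<Sum>a\<in>{1..m}. (int (s a) - int a) * int (w a))
        = (\<Sum>a\<in>{i, Suc i}. (int (s a) - int a) * int (w a))"
      by (rule sum.mono_neutral_right) (use i in \<open>auto simp: s_def transpose_def\<close>)
    also have "\<dots> = int (w i) - int (w (Suc i))" by (simp add: s_def algebra_simps)
    finally have "int (\<Sum>a\<in>{1..m}. a * (w \<circ> s) a) > int (\<Sum>a\<in>{1..m}. a * w a)"
      using i by simp
    then have gt: "(\<Sum>a\<in>{1..m}. a * (w \<circ> s) a) > (\<Sum>a\<in>{1..m}. a * w a)"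
      by (simp only: of_nat_less_iff)
    have "(\<Sum>a\<in>{1..m}. a * (w \<circ> s) a) \<le> (\<Sum>a\<in>{1..m}. a * m)"
    proof (rule sum_mono)
      fix a assume "a \<in> {1..m}"
      then have "(w \<circ> s) a \<in> {1..m}" using permutes_in_image[OF ws] by blast
      then show "a * (w \<circ> s) a \<le> a * m" by simp
    qed
    with gt have "(\<Sum>a\<in>{1..m}. a * m) - (\<Sum>a\<in>{1..m}. a * (w \<circ> s) a)
        < (\<Sum>a\<in>{1..m}. a * m) - (\<Sum>a\<in>{1..m}. a * w a)" by linarith
    from less.hyps[OF this ws] obtain us where us: "red m (w \<circ> s) us" ..
    then show ?thesis using red_descent[OF us[unfolded s_def] i] by blast
  qed
qed

text \<open>The monomial of a word in the free algebra.\<close>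

abbreviation word :: "nat list \<Rightarrow> (fword \<Rightarrow>\<^sub>0 'a::comm_ring_1)" where
  "word us \<equiv> prod_list (map gen us)"

lemma FA_word: "set us \<subseteq> {1..<m} \<Longrightarrow> word us \<in> FA m"
  by (rule FA_prod_list) (metis FA_gen imageE list.set_map subsetD)

text \<open>Two reduced words of the same permutation have the same length and are congruent. If they end in
  different letters \<open>i\<close> and \<open>j\<close>, then the permutation has descents at both, hence also reduced words that end in
  the two sides of the commutation or braid relation of \<open>i\<close> and \<open>j\<close> and agree before. The induction hypothesis
  compares each given word with the one of these that has the same last letter.\<close>

lemma matsumoto:
  assumes "red m w us" "red m w vs"
  shows "length us = length vs \<and> eqv m b (word us) (word vs)"
  using assms
proof (induction "length us" arbitrary: w us vs rule: less_induct)
  case less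
  have inj: "inj w" using red_permutes[OF less.prems(1)] by (rule permutes_inj)
  show ?case
  proof (cases us rule: rev_cases)
    case Nil
    have "w = id" using less.prems(1)[unfolded Nil] by (cases rule: red.cases) simp_all
    then have "red m id vs" using less.prems(2) by simp
    then have "vs = []"
      using red_snocD(2)[of m id "butlast vs" "last vs"] by (cases vs rule: rev_cases) simp_all
    then show ?thesis using Nil by simp
  next
    case (snoc u' i)
    note u' = red_snocD[OF less.prems(1)[unfolded snoc]]
    have "vs \<noteq> []"
    proof
      assume "vs = []"
      have "w = id" using less.prems(2)[unfolded \<open>vs = []\<close>] by (cases rule: red.cases) simp_all
      then show False using u'(2) by simp
    qed
    then obtain v' j where vs: "vs = v' @ [j]" by (metis rev_exhaust)
    note v' = red_snocD[OF less.prems(2)[unfolded vs]]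
    let ?s = "transpose i (Suc i)" and ?t = "transpose j (Suc j)"
    note IH = less.hyps
    consider "i = j" | "i + 2 \<le> j \<or> j + 2 \<le> i" | "j = Suc i \<or> i = Suc j" by linarith
    then show ?thesis
    proof cases
      case 1
      then have "red m (w \<circ> ?s) v'" using v'(1) by simp
      then have "length u' = length v'" and e: "eqv m b (word u') (word v')"
        using IH[OF _ u'(1), of v'] snoc by simp_all
      then show ?thesis using 1 snoc vs eqv_mult_right[OF e FA_gen[OF u'(3)]] by simp
    next
      case 2
      have perm: "w \<circ> ?s \<circ> ?t permutes {1..m}"
        using permutes_comp_transpose[OF permutes_comp_transpose[OF red_permutes[OF less.prems(1)]]]
          u'(3) v'(3) by blast
      then obtain z where z: "red m (w \<circ> ?s \<circ> ?t) z" using ex_red by blast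
      have comm: "w \<circ> ?s \<circ> ?t = w \<circ> ?t \<circ> ?s"
        using 2 by (auto simp: fun_eq_iff transpose_def)
      have 3: "red m (w \<circ> ?s) (z @ [j])"
        by (rule red_descent[OF z v'(3)]) (use 2 v'(2) in \<open>auto simp: transpose_def\<close>)
      have 4: "red m (w \<circ> ?t) (z @ [i])"
        by (rule red_descent[OF z[unfolded comm] u'(3)])
          (use 2 u'(2) in \<open>auto simp: transpose_def\<close>)
      have 5: "length u' = length (z @ [j]) \<and> eqv m b (word u') (word (z @ [j]))"
        using IH[OF _ u'(1) 3] snoc by simp
      then have 6: "length (z @ [i]) = length v' \<and> eqv m b (word (z @ [i])) (word v')"
        using IH[OF _ 4 v'(1)] snoc by simp
      have zFA: "word z \<in> FA m" by (rule FA_word[OF red_set[OF z]])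
      have "eqv m b (word us) (word z * (gen j * gen i))"
        using eqv_mult_right[OF conjunct2[OF 5] FA_gen[OF u'(3)]] snoc by (simp add: mult.assoc)
      also have "eqv m b (word z * (gen j * gen i)) (word z * (gen i * gen j))"
        by (intro eqv_mult_left zFA eqv_relations(1)) (use u'(3) v'(3) 2 in auto)
      also have "eqv m b (word z * (gen i * gen j)) (word vs)"
        using eqv_mult_right[OF conjunct2[OF 6] FA_gen[OF v'(3)]] vs by (simp add: mult.assoc)
      finally show ?thesis using 5 6 snoc vs by simp
    next
      case 3
      have perm: "w \<circ> ?s \<circ> ?t \<circ> ?s permutes {1..m}"
        using permutes_comp_transpose[OF permutes_comp_transpose[OF
            permutes_comp_transpose[OF red_permutes[OF less.prems(1)]]]] u'(3) v'(3) by blast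
      then obtain z where z: "red m (w \<circ> ?s \<circ> ?t \<circ> ?s) z" using ex_red by blast
      have br: "w \<circ> ?s \<circ> ?t \<circ> ?s = w \<circ> ?t \<circ> ?s \<circ> ?t"
        using 3 by (auto simp: fun_eq_iff transpose_def)
      have "red m (w \<circ> ?s \<circ> ?t) (z @ [i])"
        by (rule red_descent[OF z u'(3)]) (use 3 u'(2) v'(2) in \<open>auto simp: transpose_def\<close>)
      then have "red m (w \<circ> ?s) ((z @ [i]) @ [j])"
        by (rule red_descent[OF _ v'(3)]) (use 3 u'(2) v'(2) in \<open>auto simp: transpose_def\<close>)
      then have r1: "red m (w \<circ> ?s) (z @ [i, j])"
        unfolding append_assoc append_Cons append_Nil .
      have "red m (w \<circ> ?t \<circ> ?s) (z @ [j])"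
        by (rule red_descent[OF z[unfolded br] v'(3)])
          (use 3 u'(2) v'(2) in \<open>auto simp: transpose_def\<close>)
      then have "red m (w \<circ> ?t) ((z @ [j]) @ [i])"
        by (rule red_descent[OF _ u'(3)]) (use 3 u'(2) v'(2) in \<open>auto simp: transpose_def\<close>)
      then have r2: "red m (w \<circ> ?t) (z @ [j, i])"
        unfolding append_assoc append_Cons append_Nil .
      have 5: "length u' = length (z @ [i, j]) \<and> eqv m b (word u') (word (z @ [i, j]))"
        using IH[OF _ u'(1) r1] snoc by simp
      then have 6: "length (z @ [j, i]) = length v' \<and> eqv m b (word (z @ [j, i])) (word v')"
        using IH[OF _ r2 v'(1)] snoc by simp
      have zFA: "word z \<in> FA m" by (rule FA_word[OF red_set[OF z]])
      have "eqv m b (word us) (word z * (gen i * gen j * gen i))"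
        using eqv_mult_right[OF conjunct2[OF 5] FA_gen[OF u'(3)]] snoc by (simp add: mult.assoc)
      also have "eqv m b (word z * (gen i * gen j * gen i)) (word z * (gen j * gen i * gen j))"
      proof (intro eqv_mult_left zFA)
        show "eqv m b (gen i * gen j * gen i) (gen j * gen i * gen j)"
          using 3
        proof
          assume "j = Suc i"
          then show ?thesis using eqv_relations(2)[OF u'(3), of b] v'(3) by simp
        next
          assume "i = Suc j"
          then show ?thesis using eqv_sym[OF eqv_relations(2)[OF v'(3), of b]] u'(3) by simp
        qed
      qed
      also have "eqv m b (word z * (gen j * gen i * gen j)) (word vs)"
        using eqv_mult_right[OF conjunct2[OF 6] FA_gen[OF v'(3)]] vs by (simp add: mult.assoc)
      finally show ?thesis using 5 6 snoc vs by simp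
    qed
  qed
qed

lemma perm_of_letters_snoc:
  "perm_of_letters (us @ [i]) = perm_of_letters us \<circ> transpose i (Suc i)"
proof -
  have "foldr (\<lambda>i w. transpose i (i + 1) \<circ> w) us g
      = foldr (\<lambda>i w. transpose i (i + 1) \<circ> w) us id \<circ> g" for g :: "nat \<Rightarrow> nat"
    by (induction us) (auto simp: comp_assoc)
  from this[of "transpose i (Suc i)"] show ?thesis
    by (simp add: perm_of_letters_def)
qed

lemma perm_of_letters_Nil [simp]: "perm_of_letters [] = id"
  by (simp add: perm_of_letters_def)

lemma red_perm_of_letters: "red m w us \<Longrightarrow> perm_of_letters us = w"
  by (induction rule: red.induct) (auto simp: perm_of_letters_snoc)

text \<open>A word that is not reduced can be shortened; so the shortest words, which enter the definition
  of \<open>e\<^sub>w\<close>, are reduced in the above sense.\<close>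

lemma red_word_shorter:
  assumes "set us \<subseteq> {1..<m}"
  shows "\<exists>vs. red m (perm_of_letters us) vs \<and> length vs \<le> length us
    \<and> (length vs = length us \<longrightarrow> red m (perm_of_letters us) us)"
  using assms
proof (induction us rule: rev_induct)
  case Nil
  then show ?case using red_Nil by (intro exI[of _ "[]"]) (simp only: perm_of_letters_Nil list.size simp_thms order_refl)
next
  case (snoc i us)
  then obtain vs where vs: "red m (perm_of_letters us) vs" "length vs \<le> length us"
    "length vs = length us \<longrightarrow> red m (perm_of_letters us) us" and i: "i \<in> {1..<m}" by auto
  define v where "v = perm_of_letters us"
  have vp: "v permutes {1..m}" unfolding v_def by (rule red_permutes[OF vs(1)])
  show ?case
  proof (cases "v i < v (Suc i)")
    case True
    have "red m (v \<circ> transpose i (Suc i)) (vs @ [i])"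
      using red_snoc[OF vs(1) i] True unfolding v_def .
    moreover have "red m (v \<circ> transpose i (Suc i)) (us @ [i])" if "length vs = length us"
      using red_snoc[OF _ i] True vs(3) that unfolding v_def by blast
    moreover have "length (vs @ [i]) \<le> length (us @ [i])"
      "length (vs @ [i]) = length (us @ [i]) \<longleftrightarrow> length vs = length us"
      using vs(2) by auto
    ultimately show ?thesis unfolding perm_of_letters_snoc v_def by blast
  next
    case False
    then have d: "v (Suc i) < v i"
      using inj_Suc_neq[OF permutes_inj[OF vp], of i] by force
    obtain z where z: "red m (v \<circ> transpose i (Suc i)) z"
      using ex_red[OF permutes_comp_transpose[OF vp i]] by blast
    from red_descent[OF z i d] have "length (z @ [i]) = length vs"
      using matsumoto[OF _ vs(1), of "z @ [i]"] unfolding v_def by blast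
    then have "length z < length (us @ [i])" using vs(2) by simp
    then show ?thesis using z unfolding perm_of_letters_snoc v_def
      by (metis less_imp_le less_irrefl)
  qed
qed

lemma e_perm_red:
  assumes "w permutes {1..m}"
  obtains us where "red m w us" "e_perm m w = word us"
proof -
  obtain vs0 where vs0: "red m w vs0" using ex_red[OF assms] by blast
  define P where "P us \<longleftrightarrow> set us \<subseteq> {1..<m} \<and> perm_of_letters us = w" for us
  have "P vs0" using red_set[OF vs0] red_perm_of_letters[OF vs0] by (simp add: P_def)
  then obtain us0 where "P us0" "\<And>us. P us \<Longrightarrow> length us0 \<le> length us"
    using arg_min_nat_lemma[of P vs0 length] by blast
  then have "reduced_word m w us0" by (auto simp: reduced_word_def P_def)
  then have r: "reduced_word m w (SOME us. reduced_word m w us)" by (rule someI)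
  define us where "us = (SOME us. reduced_word m w us)"
  have us: "set us \<subseteq> {1..<m}" "perm_of_letters us = w"
    "\<And>vs. set vs \<subseteq> {1..<m} \<Longrightarrow> perm_of_letters vs = w \<Longrightarrow> length us \<le> length vs"
    using r by (auto simp: reduced_word_def us_def)
  obtain vs where vs: "red m w vs" "length vs \<le> length us" "length vs = length us \<longrightarrow> red m w us"
    using red_word_shorter[OF us(1)] us(2) by auto
  have "length us \<le> length vs"
    using us(3)[OF red_set[OF vs(1)] red_perm_of_letters[OF vs(1)]] .
  then have "red m w us" using vs by simp
  moreover have "e_perm m w = word us" by (simp add: e_perm_def us_def)
  ultimately show thesis by (rule that)
qed

lemma FA_e_perm: "w permutes {1..m} \<Longrightarrow> e_perm m w \<in> FA m"
  by (metis e_perm_red FA_word red_set)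

lemma scalar_commute: "scalar c * u = u * scalar c"
  by (subst (1 2) poly_mapping_eq_sum[of u])
    (simp add: scalar_def sum_distrib_left sum_distrib_right mult_single mult.commute)

lemma scalar_mult: "scalar c * scalar d = scalar (c * d)"
  by (simp add: scalar_def mult_single)

lemma e_perm_gen:
  assumes w: "w permutes {1..m}" and i: "i \<in> {1..<m}"
  shows "w i < w (Suc i) \<Longrightarrow> eqv m b (e_perm m w * gen i) (e_perm m (w \<circ> transpose i (Suc i)))"
    and "\<not> w i < w (Suc i) \<Longrightarrow> eqv m b (e_perm m w * gen i) (scalar b * e_perm m w)"
proof -
  obtain us where us: "red m w us" "e_perm m w = (word us :: fword \<Rightarrow>\<^sub>0 'a)"
    by (rule e_perm_red[OF w])
  obtain vs where vs: "red m (w \<circ> transpose i (Suc i)) vs"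
      "e_perm m (w \<circ> transpose i (Suc i)) = (word vs :: fword \<Rightarrow>\<^sub>0 'a)"
    by (rule e_perm_red[OF permutes_comp_transpose[OF w i]])
  {
    assume "w i < w (Suc i)"
    from red_snoc[OF us(1) i this] have "eqv m b (word (us @ [i])) (word vs)"
      using matsumoto[OF _ vs(1)] by blast
    then show "eqv m b (e_perm m w * gen i) (e_perm m (w \<circ> transpose i (Suc i)))"
      by (simp add: us vs)
  next
    assume "\<not> w i < w (Suc i)"
    then have d: "w (Suc i) < w i"
      using inj_Suc_neq[OF permutes_inj[OF w], of i] by force
    have e: "eqv m b (word us) (word (vs @ [i]))"
      using matsumoto[OF us(1) red_descent[OF vs(1) i d]] by blast
    have vFA: "word vs \<in> FA m" by (rule FA_word[OF red_set[OF vs(1)]])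
    have "eqv m b (word us * gen i) (word vs * (gen i * gen i))"
      using eqv_mult_right[OF e FA_gen[OF i]] by (simp add: mult.assoc)
    also have "eqv m b (word vs * (gen i * gen i)) (word vs * (scalar b * gen i))"
      by (rule eqv_mult_left[OF eqv_relations(3)[OF i] vFA])
    also have "word vs * (scalar b * gen i) = scalar b * word (vs @ [i])"
      by (simp add: mult.assoc scalar_commute)
    also have "eqv m b (scalar b * word (vs @ [i])) (scalar b * word us)"
      by (rule eqv_mult_left[OF eqv_sym[OF e]]) simp
    finally show "eqv m b (e_perm m w * gen i) (scalar b * e_perm m w)"
      by (simp add: us)
  }
qed


section \<open>The basis of the algebra\<close>

text \<open>The indicator function of a permutation.\<close>

definition delta :: "(nat \<Rightarrow> nat) \<Rightarrow> (nat \<Rightarrow> nat) \<Rightarrow> 'a::comm_ring_1" where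
  "delta v = (\<lambda>w. if w = v then 1 else 0)"

lemma rep_word: "rep b (word us) f = fold (act b) us f"
  by (induction us arbitrary: f) (auto simp: rep_mult)

lemma fold_act_red:
  fixes b :: "'a::comm_ring_1"
  assumes "red m w us"
  shows "fold (act b) us (delta id) = delta w"
  using assms
proof (induction rule: red.induct)
  case (red_snoc w us i)
  have "inj w" using permutes_inj[OF red_permutes[OF red_snoc(1)]] .
  let ?t = "transpose i (Suc i)"
  have eq: "v \<circ> ?t = w \<longleftrightarrow> v = w \<circ> ?t" for v
    by (metis comp_transpose_twice)
  have "act b i (delta w) v = delta (w \<circ> ?t) v" for v
  proof (cases "v = w \<circ> ?t")
    case True
    then have "v (Suc i) < v i" "inj v" "v \<circ> ?t = w"
      using red_snoc(3) \<open>inj w\<close> eq by simp_all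
    moreover from this have "v \<noteq> w" using red_snoc(3) by fastforce
    ultimately have "act b i (delta w) v = 1" by (simp only: act_def delta_def) simp
    then show ?thesis using True by (simp add: delta_def)
  next
    case False
    then have "v \<circ> ?t \<noteq> w" using eq by blast
    then have "delta w (v \<circ> ?t) = (0::'a)" "delta (w \<circ> ?t) v = (0::'a)"
      using False by (simp_all only: delta_def if_False)
    moreover have "delta w v = (0::'a) \<or> \<not> v (Suc i) < v i"
      using red_snoc(3) by (auto simp: delta_def)
    ultimately show ?thesis by (auto simp: act_def simp del: o_apply)
  qed
  then have "act b i (delta w) = delta (w \<circ> ?t)" by (rule ext)
  moreover have "fold (act b) (us @ [i]) (delta id) = act b i (fold (act b) us (delta id))"
    by simp
  ultimately show ?case unfolding red_snoc(4) by (rule trans[rotated])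
qed simp

lemma rep_scalar_mult: "rep b (scalar c * u) f w = c * rep b u f w"
  using rep_linear[where A = "{()}" and c = "\<lambda>_. c" and F = "\<lambda>_. f" and b = b and u = u and w = w]
  by (simp add: rep_mult rep_scalar[abs_def])

text \<open>The element of the free algebra with coordinates \<open>c w\<close> with respect to the \<open>e\<^sub>w\<close>.\<close>

definition span :: "nat \<Rightarrow> ((nat \<Rightarrow> nat) \<Rightarrow> 'a::comm_ring_1) \<Rightarrow> (fword \<Rightarrow>\<^sub>0 'a)" where
  "span m c = (\<Sum>w | w permutes {1..m}. scalar (c w) * e_perm m w)"

lemma FA_span: "span m c \<in> FA m"
  unfolding span_def by (intro FA_sum FA_mult FA_scalar FA_e_perm) auto

lemma rep_span:
  assumes "v permutes {1..m}"
  shows "rep b (span m c) (delta id) v = c v"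
proof -
  have "rep b (e_perm m w) (delta id) = delta w" if "w permutes {1..m}" for w
    by (rule e_perm_red[OF that, where ?'a = 'a]) (simp add: rep_word fold_act_red)
  then have "rep b (span m c) (delta id) v = (\<Sum>w | w permutes {1..m}. c w * delta w v)"
    by (simp add: span_def rep_sum rep_scalar_mult)
  also have "\<dots> = (\<Sum>w | w permutes {1..m}. if w = v then c v else 0)"
    by (intro sum.cong) (auto simp: delta_def)
  also have "\<dots> = c v" using assms finite_permutations[of "{1..m}"] by (simp add: sum.delta)
  finally show ?thesis .
qed

text \<open>Being congruent to a linear combination of the \<open>e\<^sub>w\<close>; it will be shown to hold for all elements.\<close>

definition spanned :: "nat \<Rightarrow> 'a::comm_ring_1 \<Rightarrow> (fword \<Rightarrow>\<^sub>0 'a) \<Rightarrow> bool" where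
  "spanned m b u \<longleftrightarrow> (\<exists>c. eqv m b u (span m c))"

lemma spanned_add: "spanned m b u \<Longrightarrow> spanned m b v \<Longrightarrow> spanned m b (u + v)"
proof -
  assume "spanned m b u" "spanned m b v"
  then obtain c d where "eqv m b u (span m c)" "eqv m b v (span m d)" by (auto simp: spanned_def)
  then have "eqv m b (u + v) (span m c + span m d)" by (rule eqv_add)
  also have "span m c + span m d = span m (\<lambda>w. c w + d w)"
    by (simp add: span_def scalar_def single_add algebra_simps sum.distrib)
  finally show ?thesis by (auto simp: spanned_def)
qed

lemma spanned_zero: "spanned m b 0"
proof -
  have "span m (\<lambda>w. 0) = 0" by (simp add: span_def scalar_def)
  then show ?thesis unfolding spanned_def by (metis eqv_refl)
qed

lemma spanned_sum: "(\<And>a. a \<in> A \<Longrightarrow> spanned m b (F a)) \<Longrightarrow> spanned m b (sum F A)"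
  by (induction A rule: infinite_finite_induct) (auto simp: spanned_zero spanned_add)

lemma spanned_scalar: "spanned m b u \<Longrightarrow> spanned m b (scalar r * u)"
proof -
  assume "spanned m b u"
  then obtain c where "eqv m b u (span m c)" by (auto simp: spanned_def)
  then have "eqv m b (scalar r * u) (scalar r * span m c)" by (rule eqv_mult_left) simp
  also have "scalar r * span m c = span m (\<lambda>w. r * c w)"
    by (simp add: span_def sum_distrib_left scalar_mult flip: mult.assoc)
  finally show ?thesis by (auto simp: spanned_def)
qed

lemma spanned_e_perm:
  assumes "w permutes {1..m}"
  shows "spanned m b (e_perm m w)"
proof -
  have "span m (delta w) = (\<Sum>v | v permutes {1..m}. if v = w then e_perm m w else 0)"
    unfolding span_def by (intro sum.cong) (auto simp: delta_def scalar_def)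
  also have "\<dots> = e_perm m w"
    using assms finite_permutations[of "{1..m}"] by (simp add: sum.delta)
  finally show ?thesis unfolding spanned_def by (metis eqv_refl)
qed

lemma spanned_eqv: "eqv m b u v \<Longrightarrow> spanned m b v \<Longrightarrow> spanned m b u"
  unfolding spanned_def using eqv_trans by blast

lemma spanned_word:
  assumes "set us \<subseteq> {1..<m}"
  shows "spanned m b (word us)"
  using assms
proof (induction us rule: rev_induct)
  case Nil
  obtain us where us: "red m id us" "e_perm m id = (word us :: fword \<Rightarrow>\<^sub>0 'a)"
    by (rule e_perm_red[OF permutes_id])
  have "us = []"
  proof (cases us rule: rev_cases)
    case (snoc vs i)
    then show ?thesis using red_snocD(2)[of m id vs i] us(1) by simp
  qed
  then have "e_perm m id = (word [] :: fword \<Rightarrow>\<^sub>0 'a)" using us(2) by (simp only:)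
  then show ?case using spanned_e_perm[OF permutes_id, of m b] by (simp only:)
next
  case (snoc i us)
  then obtain c where c: "eqv m b (word us) (span m c)" and i: "i \<in> {1..<m}"
    by (auto simp: spanned_def)
  have "eqv m b (word (us @ [i])) (span m c * gen i)"
    using eqv_mult_right[OF c FA_gen[OF i]] by simp
  moreover have "spanned m b (span m c * gen i)"
    unfolding span_def sum_distrib_right mult.assoc
  proof (intro spanned_sum spanned_scalar)
    fix w assume "w \<in> {w. w permutes {1..m}}"
    then have w: "w permutes {1..m}" by simp
    show "spanned m b (e_perm m w * gen i)"
    proof (cases "w i < w (Suc i)")
      case True
      show ?thesis
        by (rule spanned_eqv[OF e_perm_gen(1)[OF w i True]])
          (rule spanned_e_perm[OF permutes_comp_transpose[OF w i]])
    next
      case False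
      show ?thesis
        by (rule spanned_eqv[OF e_perm_gen(2)[OF w i False]])
          (rule spanned_scalar[OF spanned_e_perm[OF w]])
    qed
  qed
  ultimately show ?case by (rule spanned_eqv)
qed

lemma single_eq_scalar_word: "Poly_Mapping.single (Fword us) c = scalar c * word us"
proof -
  have "word us = Poly_Mapping.single (Fword us) (1 :: 'a)"
  proof (induction us)
    case Nil
    show ?case using single_one[where ?'a = fword and ?'b = 'a] by (simp add: zero_fword_def)
  next
    case (Cons i us)
    have "word (i # us) = gen i * Poly_Mapping.single (Fword us) (1 :: 'a)"
      using Cons by simp
    also have "\<dots> = Poly_Mapping.single (Fword (i # us)) 1"
      by (simp add: gen_def mult_single plus_fword_def)
    finally show ?case .
  qed
  then show ?thesis by (simp add: scalar_def mult_single)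
qed

lemma spanned_FA:
  assumes "u \<in> FA m"
  shows "spanned m b u"
proof (subst poly_mapping_eq_sum[of u], rule spanned_sum)
  fix v assume "v \<in> Poly_Mapping.keys u"
  then have "set (letters v) \<subseteq> {1..<m}" using assms by (auto simp: in_FA)
  then show "spanned m b (Poly_Mapping.single v (Poly_Mapping.lookup u v))"
    using spanned_scalar[OF spanned_word] single_eq_scalar_word[of "letters v"] by (metis fword.collapse)
qed

text \<open>The \<open>e\<^sub>w\<close> form a basis of \<open>IdC\<^sub>m(b)\<close>, and the coordinates of \<open>u\<close> can be read off from its action on the
  identity permutation.\<close>

theorem eqv_span_iff:
  assumes "u \<in> FA m"
  shows "eqv m b u (span m c) \<longleftrightarrow> (\<forall>w. w permutes {1..m} \<longrightarrow> c w = rep b u (delta id) w)"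
proof
  assume "eqv m b u (span m c)"
  from rep_eqv[OF this] show "\<forall>w. w permutes {1..m} \<longrightarrow> c w = rep b u (delta id) w"
    by (simp add: rep_span)
next
  assume c: "\<forall>w. w permutes {1..m} \<longrightarrow> c w = rep b u (delta id) w"
  obtain d where d: "eqv m b u (span m d)" using spanned_FA[OF assms] by (auto simp: spanned_def)
  have "span m c = span m d"
    unfolding span_def using c rep_eqv[OF d] by (intro sum.cong) (auto simp: rep_span)
  then show "eqv m b u (span m c)" using d by simp
qed


section \<open>Grothendieck polynomials as coefficients in the regular representation\<close>

text \<open>The action of the factor \<open>h\<^sub>i(x) = 1 + x e\<^sub>i\<close>.\<close>

definition hop :: "'a::comm_ring_1 \<Rightarrow> nat \<Rightarrow> 'a \<Rightarrow> ((nat \<Rightarrow> nat) \<Rightarrow> 'a) \<Rightarrow> (nat \<Rightarrow> nat) \<Rightarrow> 'a" where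
  "hop b i x f = (\<lambda>w. f w + x * act b i f w)"

text \<open>The action of \<open>A\<^sub>i(x) = h\<^bsub>m-1\<^esub>(x) \<cdots> h\<^sub>i(x)\<close>. As the action is from the right, the letters act in
  the order \<open>m - 1, \<dots>, i\<close>.\<close>

definition aop :: "'a::comm_ring_1 \<Rightarrow> nat \<Rightarrow> nat \<Rightarrow> 'a \<Rightarrow> ((nat \<Rightarrow> nat) \<Rightarrow> 'a) \<Rightarrow> (nat \<Rightarrow> nat) \<Rightarrow> 'a" where
  "aop b m i x = fold (\<lambda>j. hop b j x) (rev [i..<m])"

text \<open>The coefficients of \<open>A\<^sub>1(x\<^sub>1) \<cdots> A\<^bsub>m-1\<^esub>(x\<^bsub>m-1\<^esub>)\<close> with respect to the \<open>e\<^sub>w\<close>, for values \<open>x\<^sub>i\<close> in any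
  commutative ring.\<close>

definition Gr :: "'a::comm_ring_1 \<Rightarrow> nat \<Rightarrow> (nat \<Rightarrow> 'a) \<Rightarrow> (nat \<Rightarrow> nat) \<Rightarrow> 'a" where
  "Gr b m x = fold (\<lambda>i. aop b m i (x i)) [1..<m] (delta id)"

lemma rep_prod_list: "rep b (prod_list (map F us)) f = fold (\<lambda>i. rep b (F i)) us f"
  by (induction us arbitrary: f) (auto simp: rep_mult)

lemma rep_h_factor: "rep b (h_factor i x) f = hop b i x f"
  by (rule ext) (simp add: h_factor_def hop_def rep_add rep_scalar_mult)

lemma rep_A_factor: "rep b (A_factor m i x) f = aop b m i x f"
  by (simp add: A_factor_def aop_def rep_prod_list rep_h_factor[abs_def])

lemma rep_A_factor_prod:
  "rep b (prod_list (map (\<lambda>i. A_factor m i (x i)) us)) f = fold (\<lambda>i. aop b m i (x i)) us f"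
  by (simp add: rep_prod_list rep_A_factor[abs_def])

lemma FA_A_factor: "i \<ge> 1 \<Longrightarrow> A_factor m i x \<in> FA m"
  unfolding A_factor_def h_factor_def
  by (rule FA_prod_list) (auto intro!: FA_add FA_mult FA_gen)

theorem grothendieck_eq:
  assumes w: "w permutes {1..m}"
  shows "grothendieck m w = Gr beta m xvar w"
proof -
  let ?P = "prod_list (map (\<lambda>i. A_factor m i (xvar i)) [1..<m])"
  have P: "?P \<in> FA m" by (rule FA_prod_list) (auto intro: FA_A_factor)
  have fam: "grothendieck_family m G \<longleftrightarrow> (\<forall>w. \<not> w permutes {1..m} \<longrightarrow> G w = 0)
      \<and> (\<forall>w. w permutes {1..m} \<longrightarrow> G w = Gr beta m xvar w)" for G
    unfolding grothendieck_family_def span_def[symmetric] idc_class_eq_iff[OF P FA_span]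
      eqv_span_iff[OF P] rep_A_factor_prod Gr_def ..
  have "grothendieck m = (\<lambda>w. if w permutes {1..m} then Gr beta m xvar w else 0)"
    unfolding grothendieck_def by (rule the_equality) (auto simp: fam fun_eq_iff)
  then show ?thesis using w by simp
qed

context comm_ring_hom
begin

lemma act_hom: "hom (act b i f w) = act (hom b) i (\<lambda>w. hom (f w)) w"
  by (simp add: act_def hom_distribs)

lemma hop_hom: "hom (hop b i x f w) = hop (hom b) i (hom x) (\<lambda>w. hom (f w)) w"
  by (simp add: hop_def act_hom hom_distribs)

lemma aop_hom: "hom (aop b m i x f w) = aop (hom b) m i (hom x) (\<lambda>w. hom (f w)) w"
proof -
  have "hom (fold (\<lambda>j. hop b j x) us f w) = fold (\<lambda>j. hop (hom b) j (hom x)) us (\<lambda>w. hom (f w)) w"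
    for us
    by (induction us arbitrary: f) (simp_all add: hop_hom[abs_def])
  then show ?thesis by (simp add: aop_def)
qed

lemma Gr_hom: "hom (Gr b m x w) = Gr (hom b) m (\<lambda>i. hom (x i)) w"
proof -
  have "hom (fold (\<lambda>i. aop b m i (x i)) us f w)
      = fold (\<lambda>i. aop (hom b) m i (hom (x i))) us (\<lambda>w. hom (f w)) w" for us f
    by (induction us arbitrary: f) (simp_all add: aop_hom[abs_def])
  from this[of "[1..<m]" "delta id"] show ?thesis
    by (simp add: Gr_def delta_def if_distrib[of hom] cong: if_cong)
qed

end

lemma eval_subst_eq:
  "eval_x (\<lambda>i. 1) (subst_beta q P) = (\<Sum>a\<in>Poly_Mapping.keys P. pcompose (Poly_Mapping.lookup P a) q)"
proof -
  have l: "Poly_Mapping.lookup (subst_beta q P) a = pcompose (Poly_Mapping.lookup P a) q" for a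
    by (simp add: subst_beta_def Poly_Mapping.map.rep_eq when_def pcompose_0)
  have "eval_x (\<lambda>i. 1) (subst_beta q P)
      = (\<Sum>a\<in>Poly_Mapping.keys (subst_beta q P). pcompose (Poly_Mapping.lookup P a) q)"
    by (simp add: eval_x_def l)
  also have "\<dots> = (\<Sum>a\<in>Poly_Mapping.keys P. pcompose (Poly_Mapping.lookup P a) q)"
    by (rule sum.mono_neutral_left) (auto simp: in_keys_iff l)
  finally show ?thesis .
qed

lemma comm_ring_hom_eval: "comm_ring_hom (\<lambda>P. eval_x (\<lambda>i. 1) (subst_beta q P))"
proof -
  define h where "h P = (\<Sum>a\<in>Poly_Mapping.keys P. pcompose (Poly_Mapping.lookup P a) q)" for P :: xpoly
  have sup: "h P = (\<Sum>a\<in>A. pcompose (Poly_Mapping.lookup P a) q)"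
    if "finite A" "Poly_Mapping.keys P \<subseteq> A" for P A
    unfolding h_def by (rule sum.mono_neutral_left) (use that in \<open>auto simp: in_keys_iff\<close>)
  have add: "h (P + Q) = h P + h Q" for P Q
  proof -
    let ?A = "Poly_Mapping.keys P \<union> Poly_Mapping.keys Q"
    have "h R = (\<Sum>a\<in>?A. pcompose (Poly_Mapping.lookup R a) q)" if "R \<in> {P, Q, P + Q}" for R
      by (rule sup) (use that keys_add[of P Q] in auto)
    then show ?thesis by (simp add: lookup_add pcompose_add sum.distrib)
  qed
  have zero: "h 0 = 0" by (simp add: h_def)
  have sum: "h (sum F A) = (\<Sum>a\<in>A. h (F a))" for F and A :: "(nat \<Rightarrow>\<^sub>0 nat) set"
    by (induction A rule: infinite_finite_induct) (auto simp: zero add)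
  have single: "h (Poly_Mapping.single a c) = pcompose c q" for a c
    by (simp add: h_def)
  have mult: "h (P * Q) = h P * h Q" for P Q
  proof -
    have "h (P * Q) = h (\<Sum>a\<in>Poly_Mapping.keys P. \<Sum>c\<in>Poly_Mapping.keys Q.
        Poly_Mapping.single (a + c) (Poly_Mapping.lookup P a * Poly_Mapping.lookup Q c))"
      by (subst poly_mapping_eq_sum[of P], subst poly_mapping_eq_sum[of Q])
        (simp add: sum_product mult_single)
    also have "\<dots> = h P * h Q"
      unfolding sum single pcompose_mult by (simp add: sum_product h_def)
    finally show ?thesis .
  qed
  have one: "h 1 = 1" using single[of 0 1] by (simp add: pcompose_1)
  show ?thesis unfolding eval_subst_eq h_def[symmetric]
    by unfold_locales (auto simp: add zero mult one)
qed

lemma groth_at_ones_eq: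
  assumes "w permutes {1..m}"
  shows "groth_at_ones m w = Gr [:-1, 1:] m (\<lambda>i. 1) w"
proof -
  interpret comm_ring_hom "\<lambda>P. eval_x (\<lambda>i. 1) (subst_beta [:-1, 1:] P)"
    by (rule comm_ring_hom_eval)
  have "eval_x (\<lambda>i. 1) (subst_beta [:-1, 1:] (xvar i)) = 1" for i
    by (simp add: eval_subst_eq xvar_def pcompose_1)
  moreover have "eval_x (\<lambda>i. 1) (subst_beta [:-1, 1:] beta) = [:-1, 1:]"
    by (simp add: eval_subst_eq beta_def pcompose_pCons)
  ultimately show ?thesis
    unfolding groth_at_ones_def grothendieck_eq[OF assms] Gr_hom by simp
qed

lemma poly_groth_at_ones:
  assumes "w permutes {1..m}"
  shows "poly (map_poly real_of_int (groth_at_ones m w)) z = Gr (z - 1) m (\<lambda>i. 1) w"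
proof -
  have add: "map_poly real_of_int (P + Q) = map_poly real_of_int P + map_poly real_of_int Q" for P Q
    by (rule poly_eqI) (simp add: coeff_map_poly)
  have mult: "map_poly real_of_int (P * Q) = map_poly real_of_int P * map_poly real_of_int Q" for P Q
    by (rule poly_eqI) (simp add: coeff_map_poly coeff_mult)
  interpret comm_ring_hom "\<lambda>P. poly (map_poly real_of_int P) z"
    by unfold_locales (simp_all add: add mult)
  have "poly (map_poly real_of_int [:-1, 1:]) z = z - 1"
    by (simp add: map_poly_pCons)
  then show ?thesis
    unfolding groth_at_ones_eq[OF assms] Gr_hom by simp
qed


section \<open>The Yang-Baxter relation\<close>

lemma hop_zero: "hop b i 0 f = f"
  by (simp add: hop_def)

lemma hop_hop: "hop b i y (hop b i x f) = hop b i (x + y + b * x * y) f"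
  by (simp add: hop_def act_add act_cmult act_quadratic algebra_simps fun_eq_iff)

lemma hop_commute_same: "hop b i y (hop b i x f) = hop b i x (hop b i y f)"
  by (simp add: hop_hop algebra_simps)

lemma hop_commute:
  assumes "i + 2 \<le> j"
  shows "hop b i y (hop b j x f) = hop b j x (hop b i y f)"
  by (simp add: hop_def act_add act_cmult act_commute[OF assms] algebra_simps fun_eq_iff)

text \<open>The middle parameter \<open>x + z + b x z\<close> is the sum of \<open>x\<close> and \<open>z\<close> in the formal group law of
  \<open>hop_hop\<close>.\<close>

lemma hop_yang_baxter:
  "hop b i z (hop b (Suc i) (x + z + b * x * z) (hop b i x f))
    = hop b (Suc i) x (hop b i (x + z + b * x * z) (hop b (Suc i) z f))"
  by (simp add: hop_def act_add act_cmult act_quadratic act_braid algebra_simps fun_eq_iff)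

lemma aop_rec: "i < m \<Longrightarrow> aop b m i x f = hop b i x (aop b m (Suc i) x f)"
  by (simp add: aop_def upt_conv_Cons)

lemma aop_trivial: "m \<le> i \<Longrightarrow> aop b m i x f = f"
  by (simp add: aop_def)

lemma hop_fold_commute:
  "(\<And>j. j \<in> set us \<Longrightarrow> i + 2 \<le> j) \<Longrightarrow>
    hop b i y (fold (\<lambda>j. hop b j x) us f) = fold (\<lambda>j. hop b j x) us (hop b i y f)"
  by (induction us arbitrary: f) (auto simp: hop_commute)

lemma hop_aop_commute: "i + 2 \<le> j \<Longrightarrow> hop b i y (aop b m j x f) = aop b m j x (hop b i y f)"
  unfolding aop_def by (rule hop_fold_commute) auto

lemma hop_inverse:
  fixes b :: "'a::field"
  assumes "1 + b * y \<noteq> 0"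
  shows "hop b i (- y / (1 + b * y)) (hop b i y f) = f"
    and "hop b i y (hop b i (- y / (1 + b * y)) f) = f"
proof -
  have "y + - y / (1 + b * y) + b * y * (- y / (1 + b * y)) = 0"
    using assms by (simp add: field_simps)
  then show "hop b i (- y / (1 + b * y)) (hop b i y f) = f"
    by (simp only: hop_hop hop_zero)
  then show "hop b i y (hop b i (- y / (1 + b * y)) f) = f"
    by (simp only: hop_commute_same)
qed

lemma aop_commute_step:
  fixes b :: "'a::field"
  assumes "1 + b * x \<noteq> 0" "1 + b * y \<noteq> 0"
  shows "hop b i y (hop b (Suc i) y (hop b i x (hop b (Suc i) (- y / (1 + b * y)) g)))
    = hop b i x (hop b (Suc i) x (hop b i y (hop b (Suc i) (- x / (1 + b * x)) g)))"
proof -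
  \<comment> \<open>The difference of \<open>x\<close> and \<open>y\<close> in the formal group law, so that \<open>x\<close> is the sum of \<open>y\<close> and \<open>z\<close>.\<close>
  define z where "z = x + - y / (1 + b * y) + b * x * (- y / (1 + b * y))"
  define g' where "g' = hop b (Suc i) (- x / (1 + b * x)) g"
  have g: "g = hop b (Suc i) x g'" unfolding g'_def by (simp only: hop_inverse[OF assms(1)])
  have x: "y + z + b * y * z = x" "z + y + b * z * y = x"
    using assms(2) by (simp_all add: z_def divide_simps) (simp_all add: algebra_simps)
  have "hop b i y (hop b (Suc i) y (hop b i x (hop b (Suc i) (- y / (1 + b * y)) g)))
      = hop b i y (hop b (Suc i) y (hop b i x (hop b (Suc i) z g')))"
    by (simp only: g hop_hop z_def)
  also have "\<dots> = hop b i y (hop b i z (hop b (Suc i) x (hop b i y g')))"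
    using hop_yang_baxter[of b i z y g'] by (simp only: x)
  also have "\<dots> = hop b i x (hop b (Suc i) x (hop b i y g'))"
    by (simp only: hop_hop x)
  finally show ?thesis by (simp only: g'_def)
qed

text \<open>Only \<open>A\<^sub>i(x) = A\<^bsub>i+1\<^esub>(x) h\<^sub>i(x)\<close> and the inverse of \<open>h\<^bsub>i+1\<^esub>(y)\<close> are needed to reduce the claim for \<open>i\<close> to
  the one for \<open>i + 1\<close> and the Yang-Baxter relation.\<close>

lemma aop_commute:
  fixes b :: "'a::field"
  assumes "1 + b * x \<noteq> 0" "1 + b * y \<noteq> 0"
  shows "aop b m i y (aop b m i x f) = aop b m i x (aop b m i y f)"
proof (induction "m - i" arbitrary: i f)
  case 0
  then show ?case by (simp add: aop_trivial)
next
  case (Suc d)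
  then have i: "i < m" and IH: "aop b m (Suc i) y (aop b m (Suc i) x f)
      = aop b m (Suc i) x (aop b m (Suc i) y f)" for f
    by auto
  show ?case
  proof (cases "Suc i < m")
    case False
    then have "m = Suc i" using i by simp
    then show ?thesis using i by (simp add: aop_rec aop_trivial hop_commute_same)
  next
    case True
    have *: "aop b m i y (aop b m i x f) = hop b i y (hop b (Suc i) y (hop b i x
        (hop b (Suc i) (- y / (1 + b * y)) (aop b m (Suc i) y (aop b m (Suc i) x f)))))"
      if y: "1 + b * y \<noteq> 0" for x y
    proof -
      have "aop b m i y (aop b m i x f)
          = hop b i y (hop b (Suc i) y (aop b m (Suc (Suc i)) y (hop b i x (aop b m (Suc i) x f))))"
        by (simp only: aop_rec i True)
      also have "aop b m (Suc (Suc i)) y (hop b i x (aop b m (Suc i) x f))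
          = hop b i x (aop b m (Suc (Suc i)) y (aop b m (Suc i) x f))"
        by (rule hop_aop_commute[symmetric]) simp
      also have "aop b m (Suc (Suc i)) y (aop b m (Suc i) x f)
          = hop b (Suc i) (- y / (1 + b * y)) (aop b m (Suc i) y (aop b m (Suc i) x f))"
        unfolding aop_rec[OF True, of b y] by (rule hop_inverse(1)[OF y, symmetric])
      finally show ?thesis .
    qed
    show ?thesis
      unfolding *[OF assms(2)] *[OF assms(1)] IH by (rule aop_commute_step[OF assms])
  qed
qed

text \<open>Since \<open>A\<^bsub>i+1\<^esub>(y) h\<^sub>i(y) = A\<^sub>i(y)\<close>, multiplication by \<open>h\<^sub>i(x\<^bsub>i+1\<^esub>)\<close> makes the product of the \<open>A\<^sub>j(x\<^sub>j)\<close>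
  symmetric in \<open>x\<^sub>i\<close> and \<open>x\<^bsub>i+1\<^esub>\<close>.\<close>

lemma hop_Gr_symmetric:
  fixes b :: "'a::field"
  assumes i: "i \<in> {1..<m}" and x: "1 + b * x i \<noteq> 0" "1 + b * x (Suc i) \<noteq> 0"
  shows "hop b i (x (Suc i)) (Gr b m x) = hop b i (x i) (Gr b m (x \<circ> transpose i (Suc i)))"
proof -
  let ?t = "transpose i (Suc i)"
  define R where "R x = fold (\<lambda>j. aop b m j (x j)) [Suc (Suc i)..<m]" for x
  define f where "f x = fold (\<lambda>j. aop b m j (x j)) [1..<i] (delta id)" for x
  have split: "[1..<m] = [1..<i] @ i # [Suc i..<m]"
    using i upt_add_eq_append[of 1 i "m - i"] by (simp add: upt_conv_Cons)
  have Gr: "Gr b m x = R x (aop b m (Suc i) (x (Suc i)) (aop b m i (x i) (f x)))" for x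
  proof (cases "Suc i < m")
    case True
    then show ?thesis unfolding Gr_def split R_def f_def by (simp add: upt_conv_Cons)
  next
    case False
    then show ?thesis unfolding Gr_def split R_def f_def by (simp add: aop_trivial)
  qed
  have comm: "hop b i y (R x g) = R x (hop b i y g)" for x y g
  proof -
    have *: "hop b i y (fold (\<lambda>j. aop b m j (x j)) us g)
        = fold (\<lambda>j. aop b m j (x j)) us (hop b i y g)"
      if "\<And>j. j \<in> set us \<Longrightarrow> i + 2 \<le> j" for us g
      using that by (induction us arbitrary: g) (auto simp: hop_aop_commute)
    show ?thesis unfolding R_def by (rule *) simp
  qed
  have *: "hop b i (x (Suc i)) (Gr b m x)
      = R x (aop b m i (x (Suc i)) (aop b m i (x i) (f x)))" for x
    using i unfolding Gr comm by (simp add: aop_rec)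
  have R: "R (x \<circ> ?t) = R x" "f (x \<circ> ?t) = f x"
    unfolding R_def f_def by (intro fold_cong ext; force simp: transpose_def)+
  show ?thesis
    using *[of "x \<circ> ?t"] unfolding *[of x] by (simp add: R aop_commute[OF x])
qed

lemma Gr_ascent:
  fixes b :: "'a::field"
  assumes i: "i \<in> {1..<m}" and x: "1 + b * x i \<noteq> 0" "1 + b * x (Suc i) \<noteq> 0"
    and v: "v i < v (Suc i)"
  shows "Gr b m (x \<circ> transpose i (Suc i)) v = Gr b m x v"
  using fun_cong[OF hop_Gr_symmetric[OF i, of b x], of v] x v by (simp add: hop_def act_def)

text \<open>The isobaric divided difference that leads from \<open>v\<close> to \<open>v s\<^sub>i\<close>, multiplied by \<open>x\<^sub>i - x\<^bsub>i+1\<^esub>\<close>.\<close>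

lemma Gr_descent:
  fixes b :: "'a::field"
  assumes i: "i \<in> {1..<m}" and x: "1 + b * x i \<noteq> 0" "1 + b * x (Suc i) \<noteq> 0"
    and v: "inj v" "v (Suc i) < v i"
  shows "(x i - x (Suc i)) * Gr b m x (v \<circ> transpose i (Suc i))
    = (1 + b * x (Suc i)) * Gr b m x v - (1 + b * x i) * Gr b m (x \<circ> transpose i (Suc i)) v"
proof -
  let ?t = "transpose i (Suc i)"
  have "Gr b m (x \<circ> ?t) (v \<circ> ?t) = Gr b m x (v \<circ> ?t)"
    by (rule Gr_ascent[OF i x]) (use v in simp)
  then show ?thesis
    using fun_cong[OF hop_Gr_symmetric[OF i, of b x], of v] x v
    by (simp add: hop_def act_def algebra_simps)
qed


section \<open>Splitting off the first row\<close>

text \<open>For a permutation \<open>u\<close> of \<open>1, \<dots>, c\<close>, the permutation \<open>c + 1, u 1, \<dots>, u c\<close> in one-line notation,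
  whose code is that of \<open>u\<close> with \<open>c\<close> put in front.\<close>

definition ins :: "nat \<Rightarrow> (nat \<Rightarrow> nat) \<Rightarrow> nat \<Rightarrow> nat" where
  "ins c u = (\<lambda>l. if l = 0 then 0 else if l = 1 then Suc c else if l \<le> Suc c then u (l - 1) else l)"

lemma permutes_range: "u permutes {1..c} \<Longrightarrow> 1 \<le> l \<Longrightarrow> l \<le> c \<Longrightarrow> 1 \<le> u l \<and> u l \<le> c"
  for u :: "nat \<Rightarrow> nat"
  using permutes_in_image[of u "{1..c}" l] by auto

lemma permutes_fixed: "u permutes {1..c} \<Longrightarrow> l = 0 \<or> c < l \<Longrightarrow> u l = l"
  for u :: "nat \<Rightarrow> nat"
  by (rule permutes_not_in) auto

lemma ins_permutes:
  assumes u: "u permutes {1..c}"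
  shows "ins c u permutes {1..Suc c}"
proof (rule bij_imp_permutes)
  have r: "ins c u a = u (a - 1) \<and> 1 \<le> ins c u a \<and> ins c u a \<le> c"
    if "a \<in> {1..Suc c}" "a \<noteq> 1" for a
  proof -
    have "1 \<le> a - 1" "a - 1 \<le> c" using that by auto
    then show ?thesis using permutes_range[OF u, of "a - 1"] that by (simp add: ins_def)
  qed
  have one: "ins c u 1 = Suc c" by (simp add: ins_def)
  have "inj_on (ins c u) {1..Suc c}"
  proof (rule inj_onI)
    fix a b assume ab: "a \<in> {1..Suc c}" "b \<in> {1..Suc c}" "ins c u a = ins c u b"
    consider "a = 1" "b = 1" | "a = 1" "b \<noteq> 1" | "a \<noteq> 1" "b = 1" | "a \<noteq> 1" "b \<noteq> 1" by blast
    then show "a = b"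
    proof cases
      case 4
      then have "u (a - 1) = u (b - 1)" using r[of a] r[of b] ab by simp
      then have "a - 1 = b - 1" using permutes_inj[OF u] by (simp only: inj_eq)
      then show ?thesis using 4 ab(1,2) by auto
    qed (use ab one r[of a] r[of b] in auto)
  qed
  moreover have "ins c u ` {1..Suc c} \<subseteq> {1..Suc c}"
  proof
    fix y assume "y \<in> ins c u ` {1..Suc c}"
    then obtain a where a: "a \<in> {1..Suc c}" "y = ins c u a" by blast
    then show "y \<in> {1..Suc c}" using r[of a] one by (cases "a = 1") simp_all
  qed
  ultimately show "bij_betw (ins c u) {1..Suc c} {1..Suc c}"
    by (simp add: bij_betw_def endo_inj_surj)
qed (auto simp: ins_def)

lemma act_no_descent: "w i \<le> w (Suc i) \<Longrightarrow> act b i f w = 0"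
  by (simp add: act_def)

text \<open>The values of \<open>f\<close> at the permutations \<open>ins c u\<close> are those of \<open>g\<close> at \<open>u\<close>, multiplied by \<open>k\<close>. The letter
  \<open>i + 1\<close> acts on \<open>f\<close> as \<open>i\<close> acts on \<open>g\<close>, so all the factors \<open>A\<^bsub>i+1\<^esub>\<close> with \<open>i \<ge> 1\<close> preserve this relation with
  shifted indices.\<close>

definition row_rel :: "nat \<Rightarrow> 'a::comm_ring_1 \<Rightarrow> ((nat \<Rightarrow> nat) \<Rightarrow> 'a) \<Rightarrow> ((nat \<Rightarrow> nat) \<Rightarrow> 'a) \<Rightarrow> bool"
  where "row_rel c k f g \<longleftrightarrow> (\<forall>u. u permutes {1..c} \<longrightarrow> f (ins c u) = k * g u)"

lemma act_ins:
  assumes fg: "row_rel c k f g" and i: "1 \<le> i" and u: "u permutes {1..c}"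
  shows "act b (Suc i) f (ins c u) = k * act b i g u"
proof (cases "i < c")
  case True
  have eq: "ins c u \<circ> transpose (Suc i) (Suc (Suc i)) = ins c (u \<circ> transpose i (Suc i))"
  proof
    fix l
    consider "l = 0" | "l = 1" | "l = Suc i" | "l = Suc (Suc i)"
      | "l \<ge> 2" "l \<noteq> Suc i" "l \<noteq> Suc (Suc i)" by linarith
    then show "(ins c u \<circ> transpose (Suc i) (Suc (Suc i))) l = ins c (u \<circ> transpose i (Suc i)) l"
      using i True by cases (auto simp: ins_def transpose_def)
  qed
  have v: "ins c u (Suc i) = u i" "ins c u (Suc (Suc i)) = u (Suc i)"
    using i True by (auto simp: ins_def)
  have p: "u \<circ> transpose i (Suc i) permutes {1..c}"
    by (rule permutes_comp_transpose[OF u]) (use i True in auto)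
  show ?thesis
    using fg[unfolded row_rel_def, rule_format, OF u]
      fg[unfolded row_rel_def, rule_format, OF p]
      permutes_inj[OF u] permutes_inj[OF ins_permutes[OF u]]
    by (simp only: act_def v eq) (simp add: algebra_simps)
next
  case False
  have "u i \<le> u (Suc i)"
    using False permutes_fixed[OF u, of "Suc i"] permutes_fixed[OF u, of i]
      permutes_range[OF u i] by (cases "i = c") auto
  moreover have "ins c u (Suc i) \<le> ins c u (Suc (Suc i))"
    using False permutes_range[OF u i] by (auto simp: ins_def)
  ultimately show ?thesis by (simp add: act_no_descent)
qed

lemma row_rel_hop:
  assumes "row_rel c k f g" "1 \<le> i"
  shows "row_rel c k (hop b (Suc i) y f) (hop b i y g)"
  unfolding row_rel_def
proof (intro allI impI)
  fix u :: "nat \<Rightarrow> nat" assume u: "u permutes {1..c}"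
  have "f (ins c u) = k * g u" using assms(1) u by (simp add: row_rel_def)
  then show "hop b (Suc i) y f (ins c u) = k * hop b i y g u"
    unfolding hop_def act_ins[OF assms u] by (simp only:) (simp add: algebra_simps)
qed

lemma row_rel_fold:
  assumes "\<And>i f g. 1 \<le> i \<Longrightarrow> row_rel c k f g \<Longrightarrow> row_rel c k (F (Suc i) f) (G i g)"
    and "row_rel c k f g" "\<forall>i\<in>set us. 1 \<le> i"
  shows "row_rel c k (fold F (map Suc us) f) (fold G us g)"
  using assms(2,3)
proof (induction us arbitrary: f g)
  case (Cons i us)
  then have "row_rel c k (F (Suc i) f) (G i g)" using assms(1) by simp
  then show ?case using Cons by simp
qed simp

lemma row_rel_aop:
  assumes "row_rel c k f g" "1 \<le> i"
  shows "row_rel c k (aop b (Suc m) (Suc i) y f) (aop b m i y g)"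
proof -
  have "rev [Suc i..<Suc m] = map Suc (rev [i..<m])" by (simp only: rev_map[symmetric] map_Suc_upt)
  then show ?thesis unfolding aop_def
    by (simp only:) (rule row_rel_fold, rule row_rel_hop, use assms in auto)
qed

lemma Gr_shift:
  assumes "row_rel c k f g"
  shows "row_rel c k (fold (\<lambda>i. aop b (Suc m) i (x i)) [2..<Suc m] f)
    (fold (\<lambda>i. aop b m i (x (Suc i))) [1..<m] g)"
proof -
  have "[2..<Suc m] = map Suc [1..<m]" by (simp only: map_Suc_upt numeral_2_eq_2 One_nat_def)
  then show ?thesis
    by (simp only:) (rule row_rel_fold, rule row_rel_aop, use assms in auto)
qed

text \<open>The product \<open>s\<^sub>c \<cdots> s\<^sub>j\<close>, which moves \<open>c + 1\<close> to position \<open>j\<close>.\<close>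

definition cyc :: "nat \<Rightarrow> nat \<Rightarrow> nat \<Rightarrow> nat" where
  "cyc c j = (\<lambda>l. if l = j then Suc c else if j < l \<and> l \<le> Suc c then l - 1 else l)"

text \<open>The coefficients of \<open>h\<^sub>c(y) \<cdots> h\<^sub>j(y)\<close> at those permutations that have \<open>c + 1\<close> at position \<open>j\<close>: only
  \<open>s\<^sub>c \<cdots> s\<^sub>j\<close> occurs, since each factor has to move \<open>c + 1\<close>.\<close>

lemma aop_first_row:
  assumes G: "\<And>w. w permutes {1..Suc c} \<Longrightarrow> G w = delta id w"
    and "1 \<le> j" "j \<le> Suc c"
  shows "\<forall>w. w permutes {1..Suc c} \<longrightarrow>
    (aop b (Suc c) j y G w \<noteq> 0 \<longrightarrow> (\<forall>l<j. w l = l))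
    \<and> (w j = Suc c \<longrightarrow> aop b (Suc c) j y G w = y ^ (Suc c - j) * delta (cyc c j) w)"
  using assms(3,2)
proof (induction j rule: inc_induct)
  case base
  have "cyc c (Suc c) = id" by (auto simp: cyc_def)
  then show ?case by (simp add: aop_trivial G) (auto simp: delta_def split: if_splits)
next
  case (step j)
  let ?F = "aop b (Suc c) (Suc j) y G"
  let ?t = "transpose j (Suc j)"
  have j: "1 \<le> j" "j < Suc c" using step by auto
  have IH0: "?F w \<noteq> 0 \<Longrightarrow> l < Suc j \<Longrightarrow> w l = l" if "w permutes {1..Suc c}" for w l
    using step.IH that by auto
  have IH1: "w (Suc j) = Suc c \<Longrightarrow> ?F w = y ^ (Suc c - Suc j) * delta (cyc c (Suc j)) w"
    if "w permutes {1..Suc c}" for w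
    using step.IH that by auto
  show ?case
  proof (intro allI impI)
    fix w assume w: "w permutes {1..Suc c}"
    have wt: "w \<circ> ?t permutes {1..Suc c}" by (rule permutes_comp_transpose[OF w]) (use j in auto)
    have F: "aop b (Suc c) j y G w = ?F w + y * act b j ?F w"
      using j by (simp add: aop_rec hop_def)
    show "(aop b (Suc c) j y G w \<noteq> 0 \<longrightarrow> (\<forall>l<j. w l = l))
      \<and> (w j = Suc c \<longrightarrow> aop b (Suc c) j y G w = y ^ (Suc c - j) * delta (cyc c j) w)"
    proof (intro conjI impI allI)
      fix l assume nz: "aop b (Suc c) j y G w \<noteq> 0" and l: "l < j"
      then have "?F w \<noteq> 0 \<or> ?F (w \<circ> ?t) \<noteq> 0"
        unfolding F act_def by (cases "inj w \<and> w (Suc j) < w j") auto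
      then show "w l = l"
        using IH0[OF w, of l] IH0[OF wt, of l] l by (auto simp: transpose_def)
    next
      assume wj: "w j = Suc c"
      have z: "?F w = 0" using IH0[OF w, of j] wj j by auto
      have "w (Suc j) \<noteq> w j" using inj_Suc_neq[OF permutes_inj[OF w], of j] by auto
      then have "w (Suc j) < w j" using permutes_range[OF w, of "Suc j"] j wj by auto
      then have "aop b (Suc c) j y G w = y * ?F (w \<circ> ?t)"
        unfolding F act_def using z permutes_inj[OF w] by simp
      also have "?F (w \<circ> ?t) = y ^ (Suc c - Suc j) * delta (cyc c (Suc j)) (w \<circ> ?t)"
        by (rule IH1[OF wt]) (simp add: wj)
      also have "delta (cyc c (Suc j)) (w \<circ> ?t) = (delta (cyc c j) w :: 'a)"
      proof -
        have "cyc c (Suc j) \<circ> ?t = cyc c j"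
          using j by (auto simp: cyc_def fun_eq_iff transpose_def)
        then have "w \<circ> ?t = cyc c (Suc j) \<longleftrightarrow> w = cyc c j"
          by (metis comp_transpose_twice)
        then show ?thesis unfolding delta_def by (simp only:)
      qed
      also have "y * (y ^ (Suc c - Suc j) * delta (cyc c j) w) = y ^ (Suc c - j) * delta (cyc c j) w"
        using j by (simp add: Suc_diff_le flip: mult.assoc power_Suc)
      finally show "aop b (Suc c) j y G w = y ^ (Suc c - j) * delta (cyc c j) w" .
    qed
  qed
qed

text \<open>The first factor \<open>A\<^sub>1(x\<^sub>1)\<close> must bring \<open>c + 1\<close> to the first position, because the other factors do
  not move that position. Its letters above \<open>c\<close> do not contribute.\<close>

theorem Gr_ins:
  assumes u: "u permutes {1..c}" and m: "c \<le> m"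
  shows "Gr b (Suc m) x (ins c u) = x 1 ^ c * Gr b m (\<lambda>i. x (Suc i)) u"
proof (cases "m = 0")
  case True
  then have "c = 0" "u = id" using m u by auto
  then have "ins c u = id" by (auto simp: ins_def)
  then show ?thesis using True \<open>c = 0\<close> \<open>u = id\<close> by (simp add: Gr_def delta_def)
next
  case False
  define G where "G = aop b (Suc m) (Suc c) (x 1) (delta id)"
  have "fold (\<lambda>j. hop b j y) us (delta id) w = delta id w"
    if "w permutes {1..Suc c}" "\<forall>j\<in>set us. c < j" for us w y
    using that(2)
  proof (induction us rule: rev_induct)
    case (snoc j us)
    have "w j \<le> w (Suc j)"
      using permutes_fixed[OF that(1), of "Suc j"] permutes_range[OF that(1), of j] 
        permutes_fixed[OF that(1), of j] snoc.prems
      by (cases "j = Suc c") auto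
    then show ?case using snoc by (simp add: hop_def act_no_descent)
  qed simp
  then have G: "G w = delta id w" if "w permutes {1..Suc c}" for w
    unfolding G_def aop_def using that by (auto simp del: upt_Suc)
  have split: "[1..<Suc m] = [1..<Suc c] @ [Suc c..<Suc m]"
    using m by (metis le_add1 plus_1_eq_Suc upt_add_eq_append le_add_diff_inverse Suc_le_mono)
  have f: "row_rel c (x 1 ^ c) (aop b (Suc m) 1 (x 1) (delta id)) (delta id)"
    unfolding row_rel_def
  proof (intro allI impI)
    fix v :: "nat \<Rightarrow> nat" assume v: "v permutes {1..c}"
    have "aop b (Suc m) 1 (x 1) (delta id) = aop b (Suc c) 1 (x 1) G"
      unfolding aop_def split G_def by simp
    moreover have "ins c v 1 = Suc c" by (simp add: ins_def)
    ultimately have "aop b (Suc m) 1 (x 1) (delta id) (ins c v)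
        = x 1 ^ c * delta (cyc c 1) (ins c v)"
      using aop_first_row[OF G, of c 1 b "x 1"] ins_permutes[OF v] by simp
    moreover have "ins c v = cyc c 1 \<longleftrightarrow> v = id"
    proof
      assume "v = id"
      then show "ins c v = cyc c 1" by (auto simp: ins_def cyc_def fun_eq_iff)
    next
      assume eq: "ins c v = cyc c 1"
      have "v l = l" for l
      proof (cases "1 \<le> l \<and> l \<le> c")
        case True
        then show ?thesis using fun_cong[OF eq, of "Suc l"] by (simp add: ins_def cyc_def)
      qed (use permutes_fixed[OF v, of l] in auto)
      then show "v = id" by auto
    qed
    ultimately show "aop b (Suc m) 1 (x 1) (delta id) (ins c v) = x 1 ^ c * delta id v"
      by (simp add: delta_def)
  qed
  have "[1..<Suc m] = 1 # [2..<Suc m]" using False by (simp add: upt_rec numeral_2_eq_2)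
  then have "Gr b (Suc m) x = fold (\<lambda>i. aop b (Suc m) i (x i)) [2..<Suc m] (aop b (Suc m) 1 (x 1) (delta id))"
    unfolding Gr_def by (simp only: fold_Cons o_apply)
  then show ?thesis
    using Gr_shift[OF f, of b m x] u by (simp only: Gr_def row_rel_def)
qed


section \<open>Divided differences\<close>

text \<open>The Newton divided difference of \<open>g\<close> on the nodes \<open>s l\<close>, \<open>l \<in> S\<close>, in Lagrange form. It is only
  meaningful if the nodes are distinct.\<close>

definition dd :: "(nat \<Rightarrow> 'a::field) \<Rightarrow> ('a \<Rightarrow> 'a) \<Rightarrow> nat set \<Rightarrow> 'a" where
  "dd s g S = (\<Sum>l\<in>S. g (s l) / (\<Prod>i\<in>S - {l}. s l - s i))"

lemma inj_transpose: "inj (transpose i j)"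
  by (rule inj_on_inverseI[of _ "transpose i j"]) simp

lemma dd_cong: "(\<And>l. l \<in> S \<Longrightarrow> f (s l) = g (s l)) \<Longrightarrow> dd s f S = dd s g S"
  by (simp add: dd_def)

lemma dd_reindex:
  assumes "inj_on \<pi> S"
  shows "dd (\<lambda>l. s (\<pi> l)) g S = dd s g (\<pi> ` S)"
proof -
  have "(\<Prod>i\<in>\<pi> ` S - {\<pi> l}. s (\<pi> l) - s i) = (\<Prod>i\<in>S - {l}. s (\<pi> l) - s (\<pi> i))"
    if "l \<in> S" for l
  proof -
    have "\<pi> ` S - {\<pi> l} = \<pi> ` (S - {l})" using assms that by (auto simp: inj_on_def)
    moreover have "inj_on \<pi> (S - {l})" using assms by (rule inj_on_subset) auto
    ultimately show ?thesis by (simp add: prod.reindex)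
  qed
  then show ?thesis unfolding dd_def by (simp add: sum.reindex[OF assms])
qed

lemma dd_linear: "dd s (\<lambda>z. c * f z + d * g z) S = c * dd s f S + d * dd s g S"
  by (simp add: dd_def sum_distrib_left add_divide_distrib flip: sum.distrib)

lemma dd_remove:
  assumes "finite S" "inj_on s S" "a \<in> S"
  shows "dd s g (S - {a}) = dd s (\<lambda>z. (z - s a) * g z) S"
proof -
  have "dd s (\<lambda>z. (z - s a) * g z) S
      = (\<Sum>l\<in>S - {a}. (s l - s a) * g (s l) / (\<Prod>i\<in>S - {l}. s l - s i))"
    unfolding dd_def by (subst sum.remove[OF assms(1,3)]) simp
  also have "\<dots> = dd s g (S - {a})"
    unfolding dd_def
  proof (rule sum.cong[OF refl])
    fix l assume l: "l \<in> S - {a}"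
    then have "s l - s a \<noteq> 0" using assms by (auto simp: inj_on_def)
    moreover have "(\<Prod>i\<in>S - {l}. s l - s i) = (s l - s a) * (\<Prod>i\<in>S - {a} - {l}. s l - s i)"
    proof -
      have "S - {l} = insert a (S - {a} - {l})" using assms(3) l by auto
      then show ?thesis using assms(1) by simp
    qed
    ultimately show "(s l - s a) * g (s l) / (\<Prod>i\<in>S - {l}. s l - s i)
        = g (s l) / (\<Prod>i\<in>S - {a} - {l}. s l - s i)" by simp
  qed
  finally show ?thesis by simp
qed

lemma dd_step:
  assumes "finite T" "inj_on s T" "a \<in> T" "c \<in> T"
  shows "(1 - \<beta> * s a) * dd s g (T - {c}) - (1 - \<beta> * s c) * dd s g (T - {a})
    = (s a - s c) * dd s (\<lambda>z. (1 - \<beta> * z) * g z) T"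
proof -
  have "(1 - \<beta> * s a) * dd s g (T - {c}) - (1 - \<beta> * s c) * dd s g (T - {a})
      = dd s (\<lambda>z. (1 - \<beta> * s a) * ((z - s c) * g z) + (- (1 - \<beta> * s c)) * ((z - s a) * g z)) T"
    unfolding dd_remove[OF assms(1,2,3)] dd_remove[OF assms(1,2,4)] dd_linear
    by (simp only: mult_minus_left diff_conv_add_uminus)
  also have "\<dots> = dd s (\<lambda>z. (s a - s c) * ((1 - \<beta> * z) * g z) + 0 * g z) T"
    by (rule dd_cong) (simp add: algebra_simps)
  finally show ?thesis unfolding dd_linear by simp
qed


section \<open>Moving the first row\<close>

text \<open>The permutation \<open>ins c u\<close> after its first entry \<open>c + 1\<close> has been moved to the right by \<open>t\<close> places.\<close>

fun row_perm :: "nat \<Rightarrow> nat \<Rightarrow> (nat \<Rightarrow> nat) \<Rightarrow> nat \<Rightarrow> nat" where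
  "row_perm 0 c u = ins c u"
| "row_perm (Suc t) c u = row_perm t c u \<circ> transpose (Suc t) (Suc (Suc t))"

lemma row_perm_apply:
  "row_perm t c u l = (if l = 0 then 0 else if l \<le> t then ins c u (Suc l)
     else if l = Suc t then Suc c else ins c u l)"
proof (induction t arbitrary: l)
  case 0
  then show ?case by (auto simp: ins_def)
next
  case (Suc t)
  consider "l = Suc t" | "l = Suc (Suc t)" | "l \<noteq> Suc t" "l \<noteq> Suc (Suc t)" by blast
  then show ?case
  proof cases
    case 1
    then show ?thesis using Suc[of "Suc (Suc t)"] by simp
  next
    case 2
    then show ?thesis using Suc[of "Suc t"] by simp
  next
    case 3
    then have "transpose (Suc t) (Suc (Suc t)) l = l" by simp
    then show ?thesis using 3 Suc[of l] by (auto simp: le_Suc_eq)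
  qed
qed

lemma row_perm_permutes:
  "u permutes {1..c} \<Longrightarrow> t \<le> c \<Longrightarrow> row_perm t c u permutes {1..Suc c}"
proof (induction t)
  case 0
  then show ?case using ins_permutes by simp
next
  case (Suc t)
  show ?case unfolding row_perm.simps
    by (rule permutes_comp_transpose) (use Suc in auto)
qed

text \<open>\<open>Gr\<close> with parameter \<open>\<beta> - 1\<close>, in the coordinates \<open>s\<^sub>i\<close> with \<open>x\<^sub>i = 1 / (1 - \<beta> s\<^sub>i)\<close>. In these
  \<open>1 + (\<beta> - 1) x\<^sub>i = \<beta> (1 - s\<^sub>i) / (1 - \<beta> s\<^sub>i)\<close>.\<close>

definition GX :: "'a::field \<Rightarrow> nat \<Rightarrow> (nat \<Rightarrow> 'a) \<Rightarrow> (nat \<Rightarrow> nat) \<Rightarrow> 'a" where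
  "GX \<beta> m s w = Gr (\<beta> - 1) m (\<lambda>i. 1 / (1 - \<beta> * s i)) w"

text \<open>The first \<open>M\<close> nodes are distinct, no denominator vanishes at them, and \<open>\<beta>\<close> is nonzero.\<close>

definition good :: "'a::field \<Rightarrow> nat \<Rightarrow> (nat \<Rightarrow> 'a) \<Rightarrow> bool" where
  "good \<beta> M s \<longleftrightarrow> \<beta> \<noteq> 0 \<and> inj_on s {1..M} \<and> (\<forall>i\<in>{1..M}. 1 - \<beta> * s i \<noteq> 0 \<and> 1 - s i \<noteq> 0)"

lemma good_swap:
  assumes "good \<beta> M s" "i \<in> {1..<M}"
  shows "good \<beta> M (s \<circ> transpose i (Suc i))"
proof -
  have p: "transpose i (Suc i) permutes {1..M}" by (rule permutes_swap_id) (use assms in auto)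
  have "inj_on (s \<circ> transpose i (Suc i)) {1..M}"
    by (rule comp_inj_on)
      (use assms p in \<open>auto simp: good_def permutes_image[OF p] intro: permutes_inj_on[OF p]\<close>)
  moreover have "transpose i (Suc i) l \<in> {1..M}" if "l \<in> {1..M}" for l
    using permutes_in_image[OF p] that by blast
  ultimately show ?thesis using assms(1) by (simp add: good_def)
qed

lemma good_shift: "good \<beta> (Suc M) s \<Longrightarrow> good \<beta> M (\<lambda>i. s (Suc i))"
  unfolding good_def inj_on_def by fastforce

lemma clear_denominators:
  fixes \<beta> :: "'a::field"
  assumes "\<beta> \<noteq> 0" "P \<noteq> 0" "Q \<noteq> 0"
    and "\<beta> * d / (P * Q) * C = \<beta> * a / Q * A - \<beta> * e / P * B"
  shows "d * C = a * P * A - e * Q * B"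
proof -
  have "\<beta> * (d * C) = (\<beta> * d / (P * Q) * C) * (P * Q)" using assms(2,3) by simp
  also have "\<dots> = \<beta> * (a * P * A - e * Q * B)"
    unfolding assms(4) using assms(2,3) by (simp add: algebra_simps)
  finally show ?thesis using assms(1) by simp
qed

lemma GX_descent:
  assumes "good \<beta> M s" "i \<in> {1..<m}" "Suc i \<le> M" "inj v" "v (Suc i) < v i"
  shows "(s i - s (Suc i)) * GX \<beta> m s (v \<circ> transpose i (Suc i))
    = (1 - s (Suc i)) * (1 - \<beta> * s i) * GX \<beta> m s v
      - (1 - s i) * (1 - \<beta> * s (Suc i)) * GX \<beta> m (s \<circ> transpose i (Suc i)) v"
proof -
  have g: "\<beta> \<noteq> 0" "1 - \<beta> * s i \<noteq> 0" "1 - s i \<noteq> 0" "1 - \<beta> * s (Suc i) \<noteq> 0" "1 - s (Suc i) \<noteq> 0"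
    using assms by (auto simp: good_def)
  define x where "x = (\<lambda>i. 1 / (1 - \<beta> * s i))"
  have x': "1 + (\<beta> - 1) * x l = \<beta> * (1 - s l) / (1 - \<beta> * s l)" if "1 - \<beta> * s l \<noteq> 0" for l
    using that by (simp add: x_def field_simps)
  have x: "1 + (\<beta> - 1) * x i \<noteq> 0" "1 + (\<beta> - 1) * x (Suc i) \<noteq> 0"
    unfolding x'[OF g(2)] x'[OF g(4)] using g by auto
  have d: "x i - x (Suc i) = \<beta> * (s i - s (Suc i)) / ((1 - \<beta> * s i) * (1 - \<beta> * s (Suc i)))"
    using g by (simp add: x_def field_simps)
  define A B C where "A = GX \<beta> m s v" and "B = GX \<beta> m (s \<circ> transpose i (Suc i)) v"
    and "C = GX \<beta> m s (v \<circ> transpose i (Suc i))"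
  have "\<beta> * (s i - s (Suc i)) / ((1 - \<beta> * s i) * (1 - \<beta> * s (Suc i))) * C
      = \<beta> * (1 - s (Suc i)) / (1 - \<beta> * s (Suc i)) * A - \<beta> * (1 - s i) / (1 - \<beta> * s i) * B"
    using Gr_descent[OF assms(2) x assms(4,5)] unfolding d x'[OF g(2)] x'[OF g(4)]
    by (simp add: GX_def x_def o_def A_def B_def C_def)
  from clear_denominators[OF g(1,2,4) this] show ?thesis unfolding A_def B_def C_def .
qed

lemma GX_ins:
  assumes "u permutes {1..c}" "c \<le> m"
  shows "GX \<beta> (Suc m) s (ins c u) = (1 / (1 - \<beta> * s 1)) ^ c * GX \<beta> m (\<lambda>i. s (Suc i)) u"
  unfolding GX_def by (rule Gr_ins[OF assms])

text \<open>If \<open>GX\<close> at \<open>ins c u\<close> is a combination of functions \<open>f j\<close> of \<open>s\<^sub>1\<close> with coefficients that are symmetric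
  in \<open>s\<^sub>1, \<dots>, s\<^bsub>k+1\<^esub>\<close>, then moving the first entry by \<open>t \<le> k\<close> places replaces these functions by divided
  differences on \<open>t + 1\<close> nodes.\<close>

lemma GX_row:
  assumes u: "u permutes {1..c}" and c: "Suc c \<le> m" "k \<le> c" "Suc k \<le> M"
    and C: "\<And>s i j. 1 \<le> i \<Longrightarrow> i \<le> k \<Longrightarrow> C (s \<circ> transpose i (Suc i)) j = C s j"
    and base: "\<And>s. good \<beta> M s \<Longrightarrow> GX \<beta> m s (ins c u) = (\<Sum>j\<in>J. C s j * f j (s 1))"
    and t: "t \<le> k" and s: "good \<beta> M s"
  shows "GX \<beta> m s (row_perm t c u) = (\<Sum>j\<in>J. C s j * ((\<Prod>l=1..Suc t. 1 - s l)
    * dd s (\<lambda>z. f j z * (1 - \<beta> * z) ^ t / (1 - z)) {1..Suc t}))"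
  using t s
proof (induction t arbitrary: s)
  case 0
  have "1 - s 1 \<noteq> 0" using 0 c by (auto simp: good_def)
  then show ?case using base[OF 0(2)] by (simp add: dd_def)
next
  case (Suc t)
  define i where "i = Suc t"
  let ?\<tau> = "transpose i (Suc i)"
  let ?v = "row_perm t c u"
  have i: "i \<in> {1..<m}" "i \<in> {1..<M}" "Suc i \<le> M" "1 \<le> i" "i \<le> k"
    using Suc.prems c by (auto simp: i_def)
  have v: "inj ?v" using permutes_inj[OF row_perm_permutes[OF u, of t]] Suc.prems c by simp
  have "1 \<le> u i \<and> u i \<le> c" by (rule permutes_range[OF u]) (use i c in auto)
  then have d: "?v (Suc i) < ?v i"
    using i c by (simp add: row_perm_apply i_def) (simp add: ins_def)
  define E where "E = (\<Prod>l=1..Suc i. 1 - s l)"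
  define g where "g j = (\<lambda>z. f j z * (1 - \<beta> * z) ^ t / (1 - z))" for j
  let ?T = "{1..Suc i}"
  have injT: "inj_on s ?T"
    by (rule inj_on_subset[of s "{1..M}"]) (use Suc.prems(2) i in \<open>simp_all add: good_def\<close>)
  have IH: "GX \<beta> m s' ?v = (\<Sum>j\<in>J. C s' j * ((\<Prod>l=1..i. 1 - s' l) * dd s' (g j) {1..i}))"
    if "good \<beta> M s'" for s'
    unfolding i_def g_def by (rule Suc.IH) (use that Suc.prems in auto)
  have IH1: "(1 - s (Suc i)) * GX \<beta> m s ?v
      = (\<Sum>j\<in>J. C s j * (E * dd s (g j) (?T - {Suc i})))"
  proof -
    have "?T - {Suc i} = {1..i}" by auto
    moreover have p: "(1 - s (Suc i)) * (\<Prod>l=1..i. 1 - s l) = E" by (simp add: E_def)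
    have "(1 - s (Suc i)) * (a * ((\<Prod>l=1..i. 1 - s l) * y)) = a * (E * y)" for a y
      by (simp only: p[symmetric] mult_ac)
    ultimately show ?thesis unfolding IH[OF Suc.prems(2)] sum_distrib_left by (simp only:)
  qed
  have IH2: "(1 - s i) * GX \<beta> m (s \<circ> ?\<tau>) ?v
      = (\<Sum>j\<in>J. C s j * (E * dd s (g j) (?T - {i})))"
  proof -
    have "?\<tau> ` {1..i} = ?T - {i}"
    proof -
      have "?\<tau> ` ?T = ?T" by (rule permutes_image, rule permutes_swap_id) (use i in auto)
      moreover have "{1..i} = ?T - {Suc i}" by auto
      ultimately show ?thesis using image_set_diff[of ?\<tau> ?T "{Suc i}"] by simp
    qed
    then have dd: "dd (s \<circ> ?\<tau>) (g j) {1..i} = dd s (g j) (?T - {i})" for j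
      using dd_reindex[OF inj_on_subset[OF inj_transpose subset_UNIV],
          where S = "{1..i}" and s = s and g = "g j"] by (simp only: o_def)
    have p: "(\<Prod>l=1..i. 1 - (s \<circ> ?\<tau>) l) * (1 - s i) = E"
    proof -
      have "(\<Prod>l=1..t. 1 - (s \<circ> ?\<tau>) l) = (\<Prod>l=1..t. 1 - s l)"
        by (rule prod.cong) (auto simp: transpose_def i_def)
      then show ?thesis by (simp add: E_def i_def)
    qed
    have E: "(1 - s i) * (a * ((\<Prod>l=1..i. 1 - (s \<circ> ?\<tau>) l) * y)) = a * (E * y)" for a y
      by (simp only: p[symmetric] mult_ac)
    show ?thesis
      unfolding IH[OF good_swap[OF Suc.prems(2) i(2)]] sum_distrib_left dd C[OF i(4,5)] E ..
  qed
  have "(s i - s (Suc i)) * GX \<beta> m s (?v \<circ> ?\<tau>)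
      = (1 - \<beta> * s i) * ((1 - s (Suc i)) * GX \<beta> m s ?v)
        - (1 - \<beta> * s (Suc i)) * ((1 - s i) * GX \<beta> m (s \<circ> ?\<tau>) ?v)"
    using GX_descent[OF Suc.prems(2) i(1,3) v d] by (simp add: algebra_simps)
  also have "\<dots> = (\<Sum>j\<in>J. C s j * (E * ((1 - \<beta> * s i) * dd s (g j) (?T - {Suc i})
      - (1 - \<beta> * s (Suc i)) * dd s (g j) (?T - {i}))))"
    unfolding IH1 IH2 sum_distrib_left sum_subtractf[symmetric]
    by (rule sum.cong[OF refl]) (simp only: right_diff_distrib mult_ac)
  also have "\<dots> = (\<Sum>j\<in>J. C s j * (E * ((s i - s (Suc i))
      * dd s (\<lambda>z. (1 - \<beta> * z) * g j z) ?T)))"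
    using dd_step[OF _ injT, of i "Suc i"] i by simp
  also have "\<dots> = (s i - s (Suc i)) * (\<Sum>j\<in>J. C s j * (E * dd s (\<lambda>z. (1 - \<beta> * z) * g j z) ?T))"
    unfolding sum_distrib_left by (rule sum.cong[OF refl]) (simp only: mult_ac)
  finally have "(s i - s (Suc i)) * GX \<beta> m s (?v \<circ> ?\<tau>)
    = (s i - s (Suc i)) * (\<Sum>j\<in>J. C s j * (E * dd s (\<lambda>z. (1 - \<beta> * z) * g j z) ?T))" .
  moreover have "s i - s (Suc i) \<noteq> 0"
    using inj_onD[OF injT, of i "Suc i"] i by auto
  ultimately have "GX \<beta> m s (?v \<circ> ?\<tau>) = (\<Sum>j\<in>J. C s j * (E * dd s (\<lambda>z. (1 - \<beta> * z) * g j z) ?T))"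
    by simp
  moreover have "(\<lambda>z. (1 - \<beta> * z) * g j z) = (\<lambda>z. f j z * (1 - \<beta> * z) ^ i / (1 - z))" for j
    by (simp add: g_def i_def fun_eq_iff)
  ultimately show ?case
    unfolding row_perm.simps unfolding i_def[symmetric] E_def by (simp only:)
qed


section \<open>Determinants\<close>

lemma mat_cong:
  "(\<And>i j. i < n \<Longrightarrow> j < n \<Longrightarrow> f i j = g i j) \<Longrightarrow>
    mat n n (\<lambda>(i, j). f i j) = mat n n (\<lambda>(i, j). g i j)"
  by (rule eq_matI) auto

lemma mat_delete_mat:
  "mat_delete (mat (Suc n) (Suc n) (\<lambda>(i, j). f i j)) a b
    = mat n n (\<lambda>(i, j). f (if i < a then i else Suc i) (if j < b then j else Suc j))"
  unfolding mat_delete_def by (rule eq_matI) auto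

lemma det_unit_row:
  fixes A :: "'a::comm_ring_1 mat"
  assumes A: "A \<in> carrier_mat n n" and ic: "i < n" "c < n"
    and row: "\<And>j. j < n \<Longrightarrow> A $$ (i, j) = (if j = c then 1 else 0)"
  shows "det A = (-1) ^ (i + c) * det (mat_delete A i c)"
proof -
  have "det A = (\<Sum>j<n. A $$ (i, j) * cofactor A i j)"
    by (rule laplace_expansion_row[OF A ic(1)])
  also have "\<dots> = (\<Sum>j<n. if j = c then cofactor A i c else 0)"
    by (rule sum.cong) (auto simp: row)
  finally show ?thesis using ic(2) by (simp add: cofactor_def)
qed

lemma det_unitriangular:
  fixes A :: "'a::comm_ring_1 mat"
  assumes A: "A \<in> carrier_mat n n" and diag: "\<And>i. i < n \<Longrightarrow> A $$ (i, i) = 1"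
    and tri: "(\<forall>i j. i < j \<longrightarrow> j < n \<longrightarrow> A $$ (i, j) = 0) \<or> (\<forall>i j. j < i \<longrightarrow> i < n \<longrightarrow> A $$ (i, j) = 0)"
  shows "det A = 1"
proof -
  have "det A = prod_list (diag_mat A)"
    using tri
  proof
    assume "\<forall>i j. i < j \<longrightarrow> j < n \<longrightarrow> A $$ (i, j) = 0"
    then show ?thesis by (intro det_lower_triangular[OF _ A]) auto
  next
    assume "\<forall>i j. j < i \<longrightarrow> i < n \<longrightarrow> A $$ (i, j) = 0"
    then show ?thesis using A by (intro det_upper_triangular[OF _ A]) auto
  qed
  also have "diag_mat A = map (\<lambda>i. 1) [0..<n]"
    unfolding diag_mat_def using A diag by (intro map_cong) auto
  also have "prod_list \<dots> = (1 :: 'a)"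
    by (simp only: map_replicate_const prod_list_replicate power_one)
  finally show ?thesis .
qed

lemma det_mat_leibniz:
  "det (mat n n (\<lambda>(i, j). M i j)) = (\<Sum>p | p permutes {0..<n}. signof p * (\<Prod>i = 0..<n. M i (p i)))"
  for M :: "nat \<Rightarrow> nat \<Rightarrow> 'a::comm_ring_1"
  unfolding det_def'[OF mat_carrier]
proof (intro sum.cong refl arg_cong2[of _ _ _ _ "(*)"] prod.cong)
  fix p i assume "p \<in> {p. p permutes {0..<n}}" "i \<in> {0..<n}"
  then have "p i < n" "i < n" using permutes_in_image[of p "{0..<n}" i] by auto
  then show "mat n n (\<lambda>(i, j). M i j) $$ (i, p i) = M i (p i)" by simp
qed

section \<open>The determinantal formula at distinct nodes\<close>

text \<open>Subtracting from each column of a matrix \<open>x\<close> times the preceding one, and dropping the first column, gives the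
  same determinant as putting the row of powers of \<open>x\<close> on top. The latter is expanded along that row.\<close>

lemma bordered_det:
  fixes a :: "nat \<Rightarrow> nat \<Rightarrow> 'a::comm_ring_1"
  shows "det (mat n n (\<lambda>(i, j). a (Suc i) (Suc j) - x * a (Suc i) j))
    = (\<Sum>j<Suc n. x ^ j * cofactor (mat (Suc n) (Suc n) (\<lambda>(i, j). a i j)) 0 j)"
proof -
  define M where "M = mat (Suc n) (Suc n) (\<lambda>(i, j). if i = 0 then x ^ j else a i j)"
  define U where "U = mat (Suc n) (Suc n) (\<lambda>(i, j). if i = j then 1 else if Suc i = j then - x else 0)"
  have M: "M \<in> carrier_mat (Suc n) (Suc n)" and U: "U \<in> carrier_mat (Suc n) (Suc n)"
    by (simp_all add: M_def U_def)
  have "mat_delete M 0 j = mat_delete (mat (Suc n) (Suc n) (\<lambda>(i, j). a i j)) 0 j" for j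
    unfolding M_def mat_delete_mat by (rule mat_cong) simp
  then have cof: "cofactor M 0 j = cofactor (mat (Suc n) (Suc n) (\<lambda>(i, j). a i j)) 0 j" for j
    by (simp add: cofactor_def)
  have "det M = (\<Sum>j<Suc n. M $$ (0, j) * cofactor M 0 j)"
    by (rule laplace_expansion_row[OF M]) simp
  also have "\<dots> = (\<Sum>j<Suc n. x ^ j * cofactor (mat (Suc n) (Suc n) (\<lambda>(i, j). a i j)) 0 j)"
  proof (rule sum.cong[OF refl])
    fix j assume "j \<in> {..<Suc n}"
    then have "M $$ (0, j) = x ^ j" by (simp add: M_def)
    then show "M $$ (0, j) * cofactor M 0 j
        = x ^ j * cofactor (mat (Suc n) (Suc n) (\<lambda>(i, j). a i j)) 0 j" by (simp only: cof)
  qed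
  finally have detM: "det M = \<dots>" .
  have detU: "det U = 1" by (rule det_unitriangular[OF U]) (auto simp: U_def)
  have ent: "(M * U) $$ (i, j) = (if j = 0 then M $$ (i, 0) else M $$ (i, j) - x * M $$ (i, j - 1))"
    if "i < Suc n" "j < Suc n" for i j
  proof -
    have "(M * U) $$ (i, j) = (\<Sum>l\<in>{0..<Suc n}. M $$ (i, l) * U $$ (l, j))"
      using that M U by (simp add: scalar_prod_def)
    also have "\<dots> = (\<Sum>l\<in>{0..<Suc n}. (if l = j then M $$ (i, j) else 0)
        + (if Suc l = j then - x * M $$ (i, l) else 0))"
      using that by (intro sum.cong) (auto simp: U_def)
    also have "\<dots> = M $$ (i, j) + (\<Sum>l\<in>{0..<Suc n}. if Suc l = j then - x * M $$ (i, l) else 0)"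
      using that by (simp add: sum.distrib)
    also have "(\<Sum>l\<in>{0..<Suc n}. if Suc l = j then - x * M $$ (i, l) else 0)
        = (if j = 0 then 0 else - x * M $$ (i, j - 1))"
    proof (cases j)
      case (Suc j')
      have "(\<Sum>l\<in>{0..<Suc n}. if Suc l = j then - x * M $$ (i, l) else 0)
          = (\<Sum>l\<in>{0..<Suc n}. if l = j' then - x * M $$ (i, j') else 0)"
        by (rule sum.cong) (auto simp: Suc)
      then show ?thesis using that Suc by simp
    qed simp
    finally show ?thesis by auto
  qed
  have MU: "M * U \<in> carrier_mat (Suc n) (Suc n)" using M U by simp
  have row0: "(M * U) $$ (0, j) = (if j = 0 then 1 else 0)" if "j < Suc n" for j
  proof (cases j)
    case 0
    then show ?thesis using ent[of 0 0] by (simp add: M_def)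
  next
    case (Suc j')
    then show ?thesis using ent[of 0 j] that by (simp add: M_def)
  qed
  have "det M = det (M * U)" using det_mult[OF M U] detU by simp
  also have "\<dots> = det (mat_delete (M * U) 0 0)"
    using det_unit_row[OF MU _ _ row0] by simp
  also have "mat_delete (M * U) 0 0 = mat n n (\<lambda>(i, j). a (Suc i) (Suc j) - x * a (Suc i) j)"
  proof (rule eq_matI)
    fix i j assume "i < dim_row (mat n n (\<lambda>(i, j). a (Suc i) (Suc j) - x * a (Suc i) j))"
      "j < dim_col (mat n n (\<lambda>(i, j). a (Suc i) (Suc j) - x * a (Suc i) j))"
    then have ij: "i < n" "j < n" by auto
    then have "mat_delete (M * U) 0 0 $$ (i, j) = (M * U) $$ (Suc i, Suc j)"
      using M U by (simp add: mat_delete_def)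
    also have "\<dots> = M $$ (Suc i, Suc j) - x * M $$ (Suc i, j)" using ent ij by simp
    also have "\<dots> = a (Suc i) (Suc j) - x * a (Suc i) j" using ij by (simp add: M_def)
    finally show "mat_delete (M * U) 0 0 $$ (i, j)
        = mat n n (\<lambda>(i, j). a (Suc i) (Suc j) - x * a (Suc i) j) $$ (i, j)" using ij by simp
  qed (use M U in \<open>auto simp: mat_delete_def\<close>)
  finally show ?thesis using detM by simp
qed

text \<open>The permutation with code \<open>(0\<^sup>k, \<lambda>\<^sub>1, \<lambda>\<^sub>2, \<dots>)\<close> for a strictly decreasing list \<open>\<lambda>\<close> (see
  \<open>code_flag_perm\<close>): the one for \<open>\<lambda>\<^sub>2, \<lambda>\<^sub>3, \<dots>\<close> gets the first entry \<open>\<lambda>\<^sub>1 + k + 1\<close>, which then moves to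
  position \<open>k + 1\<close>.\<close>

fun flag_perm :: "nat \<Rightarrow> nat list \<Rightarrow> nat \<Rightarrow> nat" where
  "flag_perm k [] = id"
| "flag_perm k (l # ls) = row_perm k (l + k) (flag_perm k ls)"

text \<open>\<open>flag_perm k ls\<close> lies in the symmetric group of this degree.\<close>

definition flag_size :: "nat \<Rightarrow> nat list \<Rightarrow> nat" where
  "flag_size k ls = (case ls of [] \<Rightarrow> 0 | l # _ \<Rightarrow> Suc (l + k))"

lemma flag_perm_permutes:
  "sorted_wrt (>) ls \<Longrightarrow> flag_perm k ls permutes {1..flag_size k ls}"
proof (induction ls)
  case (Cons l ls)
  have sub: "{1..flag_size k ls} \<subseteq> {1..l + k}"
    using Cons.prems by (cases ls) (auto simp: flag_size_def)
  have "flag_perm k ls permutes {1..flag_size k ls}" using Cons by simp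
  from permutes_subset[OF this sub] have "flag_perm k ls permutes {1..l + k}" .
  from row_perm_permutes[OF this, of k] show ?case by (simp add: flag_size_def)
qed (simp add: permutes_id)

text \<open>The entry \<open>(i, j)\<close> of the determinant at distinct nodes, both indices starting from \<open>0\<close>.\<close>

definition node_entry :: "'a::field \<Rightarrow> nat \<Rightarrow> nat list \<Rightarrow> (nat \<Rightarrow> 'a) \<Rightarrow> nat \<Rightarrow> nat \<Rightarrow> 'a" where
  "node_entry \<beta> k ls s i j = (\<Prod>l=1..k + Suc i. 1 - s l)
    * dd s (\<lambda>z. z ^ j * (1 / ((1 - \<beta> * z) ^ (ls ! i) * (1 - z) ^ (length ls - i)))) {1..k + Suc i}"

lemma node_entry_swap:
  assumes "i \<ge> 1" "Suc i \<le> k + Suc r"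
  shows "node_entry \<beta> k ls (s \<circ> transpose i (Suc i)) r j = node_entry \<beta> k ls s r j"
proof -
  let ?\<tau> = "transpose i (Suc i)"
  have p: "?\<tau> permutes {1..k + Suc r}" by (rule permutes_swap_id) (use assms in auto)
  have "(\<Prod>l=1..k + Suc r. 1 - (s \<circ> ?\<tau>) l) = (\<Prod>l=1..k + Suc r. 1 - s l)"
    using prod.permute[OF p, of "\<lambda>l. 1 - s l"] by (simp only: o_def)
  moreover have "dd (s \<circ> ?\<tau>) g {1..k + Suc r} = dd s g {1..k + Suc r}" for g
    using dd_reindex[OF inj_on_subset[OF inj_transpose subset_UNIV],
        where S = "{1..k + Suc r}" and s = s and g = g]
    by (simp only: o_def permutes_image[OF p])
  ultimately show ?thesis by (simp only: node_entry_def)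
qed

text \<open>Removing the node \<open>s\<^sub>1\<close> from a divided difference of \<open>g\<close> amounts to multiplying \<open>g\<close> by \<open>z - s\<^sub>1\<close>. So the entries
  of the smaller determinant, in the variables \<open>s\<^sub>2, s\<^sub>3, \<dots>\<close>, are of the form that \<open>bordered_det\<close> needs.\<close>

lemma node_entry_shift:
  assumes s: "good \<beta> M s" "k + Suc (Suc i) \<le> M"
  shows "node_entry \<beta> k ls (\<lambda>l. s (Suc l)) i j
    = 1 / (1 - s 1) * (node_entry \<beta> k (l # ls) s (Suc i) (Suc j)
        - s 1 * node_entry \<beta> k (l # ls) s (Suc i) j)"
proof -
  let ?T = "{1..k + Suc (Suc i)}"
  have T: "Suc ` {1..k + Suc i} = ?T - {1}" by (auto simp: image_Suc_atLeastAtMost)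
  have s1: "1 - s 1 \<noteq> 0" using s by (auto simp: good_def)
  have injT: "inj_on s ?T"
    by (rule inj_on_subset[of s "{1..M}"]) (use s in \<open>simp_all add: good_def\<close>)
  define g where "g = (\<lambda>z. 1 / ((1 - \<beta> * z) ^ (ls ! i) * (1 - z) ^ (length ls - i)))"
  define E where "E = (\<Prod>l\<in>?T. 1 - s l)"
  have E: "(\<Prod>l=1..k + Suc i. 1 - s (Suc l)) = 1 / (1 - s 1) * E"
  proof -
    have "(\<Prod>l=1..k + Suc i. 1 - s (Suc l)) = (\<Prod>l\<in>?T - {1}. 1 - s l)"
      unfolding T[symmetric] by (subst prod.reindex) auto
    moreover have "E = (1 - s 1) * (\<Prod>l\<in>?T - {1}. 1 - s l)"
      unfolding E_def by (rule prod.remove) auto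
    ultimately show ?thesis using s1 by simp
  qed
  have "dd (\<lambda>l. s (Suc l)) (\<lambda>z. z ^ j * g z) {1..k + Suc i} = dd s (\<lambda>z. z ^ j * g z) (?T - {1})"
    unfolding T[symmetric] by (rule dd_reindex) simp
  also have "\<dots> = dd s (\<lambda>z. (z - s 1) * (z ^ j * g z)) ?T"
    by (rule dd_remove) (use injT in auto)
  also have "\<dots> = dd s (\<lambda>z. 1 * (z ^ Suc j * g z) + (- s 1) * (z ^ j * g z)) ?T"
    by (rule dd_cong) (simp add: algebra_simps)
  also have "\<dots> = dd s (\<lambda>z. z ^ Suc j * g z) ?T - s 1 * dd s (\<lambda>z. z ^ j * g z) ?T"
    unfolding dd_linear by simp
  finally have d: "dd (\<lambda>l. s (Suc l)) (\<lambda>z. z ^ j * g z) {1..k + Suc i} = \<dots>" .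
  have n1: "node_entry \<beta> k ls (\<lambda>l. s (Suc l)) i j = 1 / (1 - s 1) * E *
      dd (\<lambda>l. s (Suc l)) (\<lambda>z. z ^ j * g z) {1..k + Suc i}"
    unfolding node_entry_def g_def E ..
  have n2: "node_entry \<beta> k (l # ls) s (Suc i) j' = E * dd s (\<lambda>z. z ^ j' * g z) ?T" for j'
    unfolding node_entry_def g_def E_def by simp
  show ?thesis unfolding n1 n2 d by (simp only: right_diff_distrib mult_ac)
qed

theorem GX_flag_perm:
  assumes "sorted_wrt (>) ls" "flag_size k ls \<le> m" "good \<beta> (k + length ls) s"
  shows "GX \<beta> m s (flag_perm k ls)
    = det (mat (length ls) (length ls) (\<lambda>(i, j). node_entry \<beta> k ls s i j))"
  using assms
proof (induction ls arbitrary: m s)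
  case Nil
  have "fold (\<lambda>i. aop b m i (x i)) us f id = f id" for b :: 'a and x us f
  proof -
    have h: "hop b i y f id = f id" for i y f by (simp add: hop_def act_def)
    have "fold (\<lambda>j. hop b j y) us f id = f id" for y us f
      by (induction us arbitrary: f) (simp_all add: h)
    then have "aop b m i y f id = f id" for i y f by (simp add: aop_def)
    then show ?thesis by (induction us arbitrary: f) simp_all
  qed
  then have "GX \<beta> m s id = delta id id" unfolding GX_def Gr_def .
  then show ?case by (simp only: flag_perm.simps list.size) (simp add: delta_def)
next
  case (Cons l ls)
  define n where "n = length ls"
  define M where "M = k + Suc n"
  define c where "c = l + k"
  define u where "u = flag_perm k ls"
  define mm where "mm = m - 1"
  have m: "m = Suc mm" "c \<le> mm" using Cons.prems(2) by (auto simp: mm_def flag_size_def c_def)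
  have sz: "flag_size k ls \<le> c" using Cons.prems(1) by (cases ls) (auto simp: flag_size_def c_def)
  have "u permutes {1..flag_size k ls}"
    unfolding u_def by (rule flag_perm_permutes) (use Cons.prems in auto)
  then have u: "u permutes {1..c}" by (rule permutes_subset) (use sz in auto)
  define N where "N s = mat (Suc n) (Suc n) (\<lambda>(i, j). node_entry \<beta> k (l # ls) s i j)" for s
  define C where "C s j = cofactor (N s) 0 j" for s j
  define f where "f j z = (1 / (1 - \<beta> * z)) ^ c * (1 / (1 - z)) ^ n * z ^ j" for j z
  have good: "good \<beta> M s" using Cons.prems(3) by (simp add: M_def n_def)
  have C: "C (s \<circ> transpose i (Suc i)) j = C s j" if "1 \<le> i" "i \<le> k" for s i j
  proof -
    have "mat_delete (N (s \<circ> transpose i (Suc i))) 0 j = mat_delete (N s) 0 j"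
      unfolding N_def mat_delete_mat
      by (rule mat_cong) (use that in \<open>simp add: node_entry_swap del: o_apply\<close>)
    then show ?thesis by (simp only: C_def cofactor_def)
  qed
  have base: "GX \<beta> m s (ins c u) = (\<Sum>j<Suc n. C s j * f j (s 1))" if s: "good \<beta> M s" for s
  proof -
    have "GX \<beta> m s (ins c u) = (1 / (1 - \<beta> * s 1)) ^ c * GX \<beta> mm (\<lambda>i. s (Suc i)) u"
      unfolding m(1) by (rule GX_ins[OF u m(2)])
    also have "GX \<beta> mm (\<lambda>i. s (Suc i)) u
        = det (mat n n (\<lambda>(i, j). node_entry \<beta> k ls (\<lambda>l. s (Suc l)) i j))"
      unfolding u_def n_def
      by (rule Cons.IH) (use Cons.prems sz m s good_shift in \<open>auto simp: M_def n_def\<close>)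
    also have "mat n n (\<lambda>(i, j). node_entry \<beta> k ls (\<lambda>l. s (Suc l)) i j)
        = (1 / (1 - s 1)) \<cdot>\<^sub>m mat n n (\<lambda>(i, j). node_entry \<beta> k (l # ls) s (Suc i) (Suc j)
            - s 1 * node_entry \<beta> k (l # ls) s (Suc i) j)"
      by (rule eq_matI) (use node_entry_shift[OF s, of k] in \<open>auto simp: M_def\<close>)
    also have "det \<dots> = (1 / (1 - s 1)) ^ n * (\<Sum>j<Suc n. s 1 ^ j * C s j)"
      by (simp only: det_smult bordered_det C_def N_def dim_col_mat)
    finally show ?thesis by (simp only: f_def sum_distrib_left mult_ac)
  qed
  have "GX \<beta> m s (flag_perm k (l # ls)) = GX \<beta> m s (row_perm k c u)"
    by (simp add: u_def c_def)
  also have "\<dots> = (\<Sum>j<Suc n. C s j * ((\<Prod>l=1..Suc k. 1 - s l)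
      * dd s (\<lambda>z. f j z * (1 - \<beta> * z) ^ k / (1 - z)) {1..Suc k}))"
    by (rule GX_row[OF u _ _ _ C base _ good]) (use m in \<open>auto simp: c_def M_def\<close>)
  also have "\<dots> = (\<Sum>j<Suc n. N s $$ (0, j) * cofactor (N s) 0 j)"
  proof (rule sum.cong[OF refl])
    fix j assume j: "j \<in> {..<Suc n}"
    have "dd s (\<lambda>z. f j z * (1 - \<beta> * z) ^ k / (1 - z)) {1..Suc k}
        = dd s (\<lambda>z. z ^ j * (1 / ((1 - \<beta> * z) ^ l * (1 - z) ^ Suc n))) {1..Suc k}"
    proof (rule dd_cong)
      fix i assume "i \<in> {1..Suc k}"
      then have "1 - \<beta> * s i \<noteq> 0" "1 - s i \<noteq> 0" using good by (auto simp: good_def M_def)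
      then show "f j (s i) * (1 - \<beta> * s i) ^ k / (1 - s i)
          = s i ^ j * (1 / ((1 - \<beta> * s i) ^ l * (1 - s i) ^ Suc n))"
        by (simp add: f_def c_def power_add power_one_over divide_simps)
    qed
    then have "N s $$ (0, j) = (\<Prod>l=1..Suc k. 1 - s l)
      * dd s (\<lambda>z. f j z * (1 - \<beta> * z) ^ k / (1 - z)) {1..Suc k}"
      using j by (simp add: N_def node_entry_def n_def)
    then show "C s j * ((\<Prod>l=1..Suc k. 1 - s l)
      * dd s (\<lambda>z. f j z * (1 - \<beta> * z) ^ k / (1 - z)) {1..Suc k}) = N s $$ (0, j) * cofactor (N s) 0 j"
      by (simp only: C_def mult.commute)
  qed
  also have "\<dots> = det (N s)"
    by (rule laplace_expansion_row[symmetric]) (auto simp: N_def)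
  finally show ?case by (simp add: N_def n_def)
qed


section \<open>Confluent nodes\<close>

lemma dd_power:
  assumes "finite S" "inj_on s S" "a < card S"
  shows "dd s (\<lambda>z. z ^ a) S = (if Suc a = card S then 1 else 0)"
  using assms
proof (induction a arbitrary: S)
  case 0
  then show ?case
  proof (induction "card S" arbitrary: S)
    case (Suc r)
    show ?case
    proof (cases "r = 0")
      case True
      then obtain l where "S = {l}" using Suc(2) card_1_singletonE by (metis One_nat_def)
      then show ?thesis by (simp add: dd_def)
    next
      case False
      then obtain p where p: "p \<in> S" using Suc(2,5) by fastforce
      then have "card (S - {p}) = r" using Suc(2,3) by simp
      then have "S - {p} \<noteq> {}" using False by (metis card.empty)
      then obtain q where q: "q \<in> S" "q \<noteq> p" by auto
      have "dd s (\<lambda>z. z ^ 0) (S - {t}) = (if Suc 0 = r then 1 else 0)" if "t \<in> S" for t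
      proof -
        have r: "card (S - {t}) = r" using Suc(2,3) that by simp
        then show ?thesis
          using Suc.hyps(1)[of "S - {t}"] Suc(3,4) False by (simp add: inj_on_diff)
      qed
      then have "(s p - s q) * dd s (\<lambda>z. (1 - 0 * z) * z ^ 0) S = 0"
        using dd_step[OF Suc(3,4) p q(1), of 0 "\<lambda>z. z ^ 0"] p q by simp
      moreover have "s p - s q \<noteq> 0" using inj_onD[OF Suc(4) _ p q(1)] q(2) by auto
      ultimately show ?thesis using False Suc(2) by simp
    qed
  qed simp
next
  case (Suc a)
  then obtain q where q: "q \<in> S" by fastforce
  have "dd s (\<lambda>z. z ^ Suc a) S = dd s (\<lambda>z. 1 * ((z - s q) * z ^ a) + s q * z ^ a) S"
    by (rule dd_cong) (simp add: algebra_simps)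
  also have "\<dots> = dd s (\<lambda>z. z ^ a) (S - {q}) + s q * dd s (\<lambda>z. z ^ a) S"
    unfolding dd_linear dd_remove[OF Suc(2,3) q] by simp
  also have "dd s (\<lambda>z. z ^ a) (S - {q}) = (if Suc a = card (S - {q}) then 1 else 0)"
    by (rule Suc.IH) (use Suc.prems q in \<open>auto simp: inj_on_diff\<close>)
  also have "dd s (\<lambda>z. z ^ a) S = 0"
    using Suc.IH[OF Suc.prems(1,2)] Suc.prems(3) by simp
  finally show ?case using Suc.prems q by auto
qed

lemma dd_sum: "dd s (\<lambda>z. \<Sum>a\<in>A. c a * f a z) S = (\<Sum>a\<in>A. c a * dd s (f a) S)"
  unfolding dd_def sum_distrib_left sum_divide_distrib by (subst sum.swap) (simp add: mult.assoc)

text \<open>The divided difference on the nodes \<open>e, 2 e, \<dots>, (r + 1) e\<close> tends to the Taylor coefficient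
  \<open>c r\<close> as \<open>e\<close> tends to \<open>0\<close>.\<close>

lemma dd_tendsto:
  fixes g R :: "real \<Rightarrow> real"
  assumes g: "eventually (\<lambda>z. g z = (\<Sum>a<Suc r. c a * z ^ a) + z ^ Suc r * R z) (at 0)"
    and R: "(R \<longlongrightarrow> R0) (at 0)"
  shows "((\<lambda>e. dd (\<lambda>l. e * real l) g {1..Suc r}) \<longlongrightarrow> c r) (at_right 0)"
proof -
  let ?S = "{1..Suc r}"
  have lim: "filterlim (\<lambda>e. e * real l) (at 0) (at_right 0)" if "l \<in> ?S" for l
  proof -
    have "((\<lambda>e. e * real l) \<longlongrightarrow> 0 * real l) (at_right 0)" by (intro tendsto_intros)
    moreover have "eventually (\<lambda>e. e * real l \<noteq> 0) (at_right 0)"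
      using that by (auto simp: eventually_at_filter)
    ultimately show ?thesis by (simp add: filterlim_at)
  qed
  have ev: "eventually (\<lambda>e. \<forall>l\<in>?S. g (e * real l) = (\<Sum>a<Suc r. c a * (e * real l) ^ a)
      + (e * real l) ^ Suc r * R (e * real l)) (at_right 0)"
    by (rule eventually_ball_finite) (use eventually_compose_filterlim[OF g lim] in blast)+
  define rest where "rest e = (\<Sum>l\<in>?S. e * (real l ^ Suc r * R (e * real l) / (\<Prod>i\<in>?S - {l}. real l - real i)))" for e
  have eq: "dd (\<lambda>l. e * real l) g ?S = c r + rest e"
    if e: "e > 0" and ge: "\<forall>l\<in>?S. g (e * real l) = (\<Sum>a<Suc r. c a * (e * real l) ^ a)
      + (e * real l) ^ Suc r * R (e * real l)" for e
  proof -
    have inj: "inj_on (\<lambda>l. e * real l) ?S" by (rule inj_onI) (use e in simp)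
    have "dd (\<lambda>l. e * real l) g ?S = dd (\<lambda>l. e * real l)
        (\<lambda>z. 1 * (\<Sum>a<Suc r. c a * z ^ a) + 1 * (z ^ Suc r * R z)) ?S"
      by (rule dd_cong) (use ge in auto)
    also have "\<dots> = (\<Sum>a<Suc r. c a * dd (\<lambda>l. e * real l) (\<lambda>z. z ^ a) ?S)
        + dd (\<lambda>l. e * real l) (\<lambda>z. z ^ Suc r * R z) ?S"
      unfolding dd_linear dd_sum by simp
    also have "(\<Sum>a<Suc r. c a * dd (\<lambda>l. e * real l) (\<lambda>z. z ^ a) ?S)
        = (\<Sum>a<Suc r. if a = r then c r else 0)"
    proof (rule sum.cong[OF refl])
      fix a assume "a \<in> {..<Suc r}"
      then have "dd (\<lambda>l. e * real l) (\<lambda>z. z ^ a) ?S = (if a = r then 1 else 0)"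
        using dd_power[OF _ inj, of a] by simp
      then show "c a * dd (\<lambda>l. e * real l) (\<lambda>z. z ^ a) ?S = (if a = r then c r else 0)"
        by (simp only:) simp
    qed
    also have "\<dots> = c r" by simp
    also have "dd (\<lambda>l. e * real l) (\<lambda>z. z ^ Suc r * R z) ?S = rest e"
      unfolding dd_def rest_def
    proof (rule sum.cong[OF refl])
      fix l assume l: "l \<in> ?S"
      have "(\<Prod>i\<in>?S - {l}. e * real l - e * real i) = e ^ r * (\<Prod>i\<in>?S - {l}. real l - real i)"
        using l by (simp add: prod.distrib flip: right_diff_distrib)
      then show "(e * real l) ^ Suc r * R (e * real l) / (\<Prod>i\<in>?S - {l}. e * real l - e * real i)
          = e * (real l ^ Suc r * R (e * real l) / (\<Prod>i\<in>?S - {l}. real l - real i))"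
        using e by (simp add: power_mult_distrib)
    qed
    finally show ?thesis .
  qed
  have "(rest \<longlongrightarrow> (\<Sum>l\<in>?S. 0 * (real l ^ Suc r * R0 / (\<Prod>i\<in>?S - {l}. real l - real i)))) (at_right 0)"
    unfolding rest_def divide_inverse
    by (intro tendsto_sum tendsto_mult tendsto_const tendsto_ident_at filterlim_compose[OF R lim])
  then have "((\<lambda>e. c r + rest e) \<longlongrightarrow> c r + 0) (at_right 0)"
    by (intro tendsto_add tendsto_const) simp
  moreover have "eventually (\<lambda>e. c r + rest e = dd (\<lambda>l. e * real l) g ?S) (at_right 0)"
    using ev eventually_at_right_less[of "0::real"] by eventually_elim (rule eq[symmetric])
  ultimately show ?thesis using tendsto_cong by force
qed

text \<open>The power series of \<open>1 / ((1 - \<beta> s)\<^sup>a (1 - s)\<^sup>e)\<close>.\<close>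

definition row_series :: "real \<Rightarrow> nat \<Rightarrow> nat \<Rightarrow> real fps" where
  "row_series \<beta> a e = inverse ((1 - fps_const \<beta> * fps_X) ^ a * (1 - fps_X) ^ e)"

lemma rational_expansion:
  fixes \<beta> :: real
  obtains R R0 where
    "eventually (\<lambda>z. z ^ j * (1 / ((1 - \<beta> * z) ^ a * (1 - z) ^ e))
      = (\<Sum>i<r. fps_nth (fps_X ^ j * row_series \<beta> a e) i * z ^ i) + z ^ r * R z) (at 0)"
    "(R \<longlongrightarrow> R0) (at 0)"
proof -
  define q :: "real poly" where "q = [:1, - \<beta>:] ^ a * [:1, -1:] ^ e"
  define G where "G = fps_X ^ j * row_series \<beta> a e"
  define T where "T = (\<Sum>i<r. monom (fps_nth G i) i)"
  have fq: "fps_of_poly q = (1 - fps_const \<beta> * fps_X) ^ a * (1 - fps_X) ^ e"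
  proof -
    have "fps_of_poly [:1, - c:] = 1 - fps_const c * fps_X" for c :: real
      by (simp add: fps_of_poly_pCons fps_const_neg[symmetric] mult.commute del: fps_const_neg)
    from this[of \<beta>] this[of 1] show ?thesis
      by (simp add: q_def fps_of_poly_mult fps_of_poly_power)
  qed
  have "fps_nth (fps_of_poly q) 0 = 1" by (simp add: fq fps_power_zeroth)
  then have "fps_of_poly q * row_series \<beta> a e = 1"
    unfolding row_series_def fq[symmetric] by (simp add: inverse_mult_eq_1')
  then have qG: "fps_of_poly q * G = fps_X ^ j" by (simp add: G_def algebra_simps)
  have cT: "coeff T i = fps_nth G i" if "i < r" for i
  proof -
    have "coeff T i = (\<Sum>l<r. if l = i then fps_nth G i else 0)"
      unfolding T_def coeff_sum by (rule sum.cong) auto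
    then show ?thesis using that by simp
  qed
  have "coeff (q * T - monom 1 j) l = 0" if "l < r" for l
  proof -
    have "coeff (q * T) l = (\<Sum>i\<le>l. fps_nth (fps_of_poly q) i * fps_nth G (l - i))"
      unfolding coeff_mult by (rule sum.cong) (use that cT in auto)
    also have "\<dots> = fps_nth (fps_X ^ j) l"
      unfolding qG[symmetric] fps_mult_nth by (simp add: atLeast0AtMost)
    finally show ?thesis by (simp add: fps_X_power_nth)
  qed
  then have "monom 1 r dvd q * T - monom 1 j" by (simp add: monom_1_dvd_iff')
  then obtain R1 where R1: "q * T - monom 1 j = monom 1 r * R1" by blast
  have pq: "poly q z = (1 - \<beta> * z) ^ a * (1 - z) ^ e" for z
    by (simp add: q_def poly_power algebra_simps)
  have pT: "poly T z = (\<Sum>i<r. fps_nth G i * z ^ i)" for z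
    by (simp add: T_def poly_sum poly_monom)
  have pR: "poly q z * poly T z - z ^ j = z ^ r * poly R1 z" for z
    using arg_cong[OF R1, of "\<lambda>p. poly p z"] by (simp add: poly_monom)
  have cont: "((\<lambda>z. poly p z) \<longlongrightarrow> poly p 0) (at 0)" for p :: "real poly"
    using poly_isCont[where p = p and x = 0] by (simp add: isCont_def)
  have q0: "poly q 0 = 1" by (simp add: pq)
  have "eventually (\<lambda>z. poly q z \<noteq> 0) (at 0)"
    using tendsto_imp_eventually_ne[OF cont[of q], of 0] q0 by simp
  then have "eventually (\<lambda>z. z ^ j * (1 / ((1 - \<beta> * z) ^ a * (1 - z) ^ e))
      = (\<Sum>i<r. fps_nth G i * z ^ i) + z ^ r * (- (poly R1 z / poly q z))) (at 0)"
  proof eventually_elim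
    case (elim z)
    have "z ^ j = poly q z * poly T z - z ^ r * poly R1 z" using pR[of z] by simp
    then have "z ^ j * (1 / poly q z) = poly T z + z ^ r * (- (poly R1 z / poly q z))"
      using elim by (simp add: field_simps)
    then show ?case by (simp only: pq pT)
  qed
  moreover have "((\<lambda>z. - (poly R1 z / poly q z)) \<longlongrightarrow> - (poly R1 0 / poly q 0)) (at 0)"
    by (intro tendsto_intros cont) (simp add: q0)
  ultimately show thesis unfolding G_def by (rule that)
qed

lemma tendsto_det:
  fixes A :: "'b \<Rightarrow> nat \<Rightarrow> nat \<Rightarrow> real"
  assumes "\<And>i j. i < n \<Longrightarrow> j < n \<Longrightarrow> ((\<lambda>e. A e i j) \<longlongrightarrow> B i j) F"
  shows "((\<lambda>e. det (mat n n (\<lambda>(i, j). A e i j))) \<longlongrightarrow> det (mat n n (\<lambda>(i, j). B i j))) F"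
proof -
  show ?thesis unfolding det_mat_leibniz
  proof (intro tendsto_sum tendsto_mult tendsto_const tendsto_prod)
    fix p i assume "p \<in> {p. p permutes {0..<n}}" "i \<in> {0..<n}"
    then have "p i < n" "i < n" using permutes_in_image[of p "{0..<n}" i] by auto
    then show "((\<lambda>e. A e i (p i)) \<longlongrightarrow> B i (p i)) F" by (rule assms[rotated])
  qed
qed

lemma tendsto_Gr:
  fixes b :: real
  assumes x: "\<And>i. ((\<lambda>e. x e i) \<longlongrightarrow> y i) F"
  shows "((\<lambda>e. Gr b m (x e) w) \<longlongrightarrow> Gr b m y w) F"
proof -
  have act: "((\<lambda>e. act b i (f e) w) \<longlongrightarrow> act b i g w) F"
    if "\<And>w. ((\<lambda>e. f e w) \<longlongrightarrow> g w) F" for i f g w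
    unfolding act_def using that by (auto intro!: tendsto_intros)
  have hop: "((\<lambda>e. hop b i (x e q) (f e) w) \<longlongrightarrow> hop b i (y q) g w) F"
    if "\<And>w. ((\<lambda>e. f e w) \<longlongrightarrow> g w) F" for i f g w q
    unfolding hop_def by (intro tendsto_add tendsto_mult x that act)
  have aop: "((\<lambda>e. aop b m i (x e q) (f e) w) \<longlongrightarrow> aop b m i (y q) g w) F"
    if "\<And>w. ((\<lambda>e. f e w) \<longlongrightarrow> g w) F" for i f g w q
  proof -
    have "((\<lambda>e. fold (\<lambda>j. hop b j (x e q)) us (f e) w) \<longlongrightarrow> fold (\<lambda>j. hop b j (y q)) us g w) F"
      if "\<And>w. ((\<lambda>e. f e w) \<longlongrightarrow> g w) F" for us f g w
      using that
    proof (induction us arbitrary: f g w)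
      case (Cons j us)
      show ?case unfolding fold_Cons o_apply by (rule Cons.IH) (rule hop[OF Cons.prems])
    qed simp
    from this[OF that] show ?thesis unfolding aop_def .
  qed
  have "((\<lambda>e. fold (\<lambda>i. aop b m i (x e i)) us (f e) w) \<longlongrightarrow> fold (\<lambda>i. aop b m i (y i)) us g w) F"
    if "\<And>w. ((\<lambda>e. f e w) \<longlongrightarrow> g w) F" for us f g w
    using that
  proof (induction us arbitrary: f g w)
    case (Cons j us)
    show ?case unfolding fold_Cons o_apply by (rule Cons.IH) (rule aop[OF Cons.prems])
  qed simp
  from this[of "\<lambda>e. delta id" "delta id"] show ?thesis unfolding Gr_def by simp
qed

text \<open>The entry \<open>(i, j)\<close> of the determinant at \<open>x = 1\<close>, both indices starting from \<open>0\<close>: the limit of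
  \<open>node_entry\<close> as all nodes tend to \<open>0\<close>.\<close>

definition row_entry :: "real \<Rightarrow> nat \<Rightarrow> nat list \<Rightarrow> nat \<Rightarrow> nat \<Rightarrow> real" where
  "row_entry \<beta> k ls i j = fps_nth (fps_X ^ j * row_series \<beta> (ls ! i) (length ls - i)) (k + i)"

theorem Gr_ones_flag_perm:
  fixes \<beta> :: real
  assumes ls: "sorted_wrt (>) ls" "flag_size k ls \<le> m" and \<beta>: "\<beta> > 0"
  shows "Gr (\<beta> - 1) m (\<lambda>i. 1) (flag_perm k ls)
    = det (mat (length ls) (length ls) (\<lambda>(i, j). row_entry \<beta> k ls i j))"
proof -
  define s where "s e l = e * real l" for e l
  define M where "M = k + length ls"
  have "eventually (\<lambda>e. good \<beta> M (s e)) (at_right 0)"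
  proof -
    \<comment> \<open>For such \<open>e\<close>, both \<open>\<beta> e l\<close> and \<open>e l\<close> are less than \<open>1\<close> for all \<open>l \<le> M\<close>.\<close>
    have "eventually (\<lambda>e. e \<in> {0<..<1 / ((\<beta> + 1) * (real M + 1))}) (at_right 0)"
      by (rule eventually_at_right_real) (use \<beta> in simp)
    then show ?thesis
    proof eventually_elim
      case (elim e)
      have "inj_on (s e) {1..M}" by (rule inj_onI) (use elim in \<open>simp add: s_def\<close>)
      moreover have "1 - \<beta> * s e l \<noteq> 0 \<and> 1 - s e l \<noteq> 0" if "l \<in> {1..M}" for l
      proof -
        have "e * ((\<beta> + 1) * real l) \<le> e * ((\<beta> + 1) * (real M + 1))"
          using elim \<beta> that by (intro mult_left_mono) auto
        also have "\<dots> < 1"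
          using elim \<beta> pos_less_divide_eq[of "(\<beta> + 1) * (real M + 1)" e 1] by simp
        finally have "\<beta> * (e * real l) + e * real l < 1" by (simp add: algebra_simps)
        moreover have "0 \<le> \<beta> * (e * real l)" "0 \<le> e * real l" using elim \<beta> by auto
        ultimately show ?thesis unfolding s_def by linarith
      qed
      ultimately show ?case using \<beta> by (simp add: good_def)
    qed
  qed
  then have ev: "eventually (\<lambda>e. GX \<beta> m (s e) (flag_perm k ls)
      = det (mat (length ls) (length ls) (\<lambda>(i, j). node_entry \<beta> k ls (s e) i j))) (at_right 0)"
    by eventually_elim (rule GX_flag_perm[OF ls], simp add: M_def)
  have lhs: "((\<lambda>e. GX \<beta> m (s e) (flag_perm k ls)) \<longlongrightarrow> Gr (\<beta> - 1) m (\<lambda>i. 1) (flag_perm k ls)) (at_right 0)"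
    unfolding GX_def
  proof (rule tendsto_Gr)
    fix i
    have "((\<lambda>e. 1 / (1 - \<beta> * s e i)) \<longlongrightarrow> 1 / (1 - \<beta> * (0 * real i))) (at_right 0)"
      unfolding s_def by (intro tendsto_intros) simp
    then show "((\<lambda>e. 1 / (1 - \<beta> * s e i)) \<longlongrightarrow> 1) (at_right 0)" by simp
  qed
  have "((\<lambda>e. node_entry \<beta> k ls (s e) i j) \<longlongrightarrow> row_entry \<beta> k ls i j) (at_right 0)" for i j
  proof -
    obtain R R0 where R: "eventually (\<lambda>z. z ^ j * (1 / ((1 - \<beta> * z) ^ (ls ! i) * (1 - z) ^ (length ls - i)))
      = (\<Sum>l<Suc (k + i). fps_nth (fps_X ^ j * row_series \<beta> (ls ! i) (length ls - i)) l * z ^ l)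
        + z ^ Suc (k + i) * R z) (at 0)" "(R \<longlongrightarrow> R0) (at 0)"
      by (rule rational_expansion)
    have "((\<lambda>e. \<Prod>l=1..k + Suc i. 1 - s e l) \<longlongrightarrow> (\<Prod>l=1..k + Suc i. 1 - 0 * real l)) (at_right 0)"
      unfolding s_def by (intro tendsto_intros)
    from tendsto_mult[OF this dd_tendsto[OF R]]
    show ?thesis unfolding node_entry_def row_entry_def s_def by simp
  qed
  then have "((\<lambda>e. det (mat (length ls) (length ls) (\<lambda>(i, j). node_entry \<beta> k ls (s e) i j)))
      \<longlongrightarrow> det (mat (length ls) (length ls) (\<lambda>(i, j). row_entry \<beta> k ls i j))) (at_right 0)"
    by (intro tendsto_det)
  then have "((\<lambda>e. GX \<beta> m (s e) (flag_perm k ls))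
      \<longlongrightarrow> det (mat (length ls) (length ls) (\<lambda>(i, j). row_entry \<beta> k ls i j))) (at_right 0)"
    using tendsto_cong[OF ev] by blast
  with lhs show ?thesis by (rule tendsto_unique[rotated]) simp
qed


section \<open>The vexillary permutation\<close>

lemma flag_perm_fixes:
  assumes "sorted_wrt (>) ls"
  shows "l \<le> k \<Longrightarrow> flag_perm k ls l = l"
  using assms by (induction ls) (auto simp: row_perm_apply ins_def)

text \<open>One step of the recursion for \<open>flag_perm\<close>, with \<open>w\<close> obtained from \<open>u\<close>. The numbers \<open>1, \<dots>, k\<close> are
  fixed, and the values of \<open>w\<close> at positions above \<open>k + 1\<close> are in the same relative order as those of \<open>u\<close> one
  position earlier.\<close>

locale row_step =
  fixes k c :: nat and u w :: "nat \<Rightarrow> nat"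
  assumes u: "u permutes {1..c}" and kc: "k \<le> c" and fix_u: "\<And>l. l \<le> k \<Longrightarrow> u l = l"
    and w: "w = row_perm k c u"
begin

lemma w_small: "l \<le> k \<Longrightarrow> w l = l"
  using kc fix_u by (auto simp: w row_perm_apply ins_def)

lemma w_first: "w (Suc k) = Suc c"
  by (simp add: w row_perm_apply)

lemma w_big: "k < l \<Longrightarrow> w (Suc l) = (if l \<le> c then u l else Suc l)"
  using kc by (auto simp: w row_perm_apply ins_def)

lemma u_big: "k < l \<Longrightarrow> k < u l"
  using fix_u[of "u l"] permutes_inj[OF u] by (metis injD leI less_irrefl)

lemma u_le: "l \<le> c \<Longrightarrow> u l \<le> c"
  using permutes_range[OF u, of l] permutes_fixed[OF u, of 0] by (cases "l = 0") auto

lemma u_above: "c < l \<Longrightarrow> u l = l"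
  by (rule permutes_fixed[OF u]) simp

lemma w_small_less:
  assumes "l \<le> k" "l < j"
  shows "w l < w j"
proof -
  consider "j \<le> k" | "j = Suc k" | i where "j = Suc i" "k < i"
  proof (cases "j \<le> Suc k")
    case True
    then show ?thesis using that(1,2) by (cases "j = Suc k") auto
  next
    case False
    then show ?thesis using that(3)[of "j - 1"] by simp
  qed
  then show ?thesis
  proof cases
    case 1
    then show ?thesis using assms w_small[of l] w_small[of j] by simp
  next
    case 2
    then show ?thesis using assms w_small[of l] w_first kc by simp
  next
    case 3
    then show ?thesis using assms w_small[of l] w_big[of i] u_big[of i] by simp
  qed
qed

lemma w_shift_less:
  assumes "k < i" "k < j"
  shows "w (Suc i) < w (Suc j) \<longleftrightarrow> u i < u j"
  using w_big[OF assms(1)] w_big[OF assms(2)] u_le[of i] u_le[of j] u_above[of i] u_above[of j]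
  by (cases "i \<le> c"; cases "j \<le> c") auto

lemma code_w: "code w l = (if l \<le> k then 0 else if l = Suc k then c - k else code u (l - 1))"
proof -
  consider "l \<le> k" | "l = Suc k" | "Suc k < l" by linarith
  then show ?thesis
  proof cases
    case 1
    have "\<not> w j < w l" if "l < j" for j using w_small_less[OF 1 that] by simp
    then have "{j. l < j \<and> w j < w l} = {}" by blast
    then have "code w l = 0" by (simp only: code_def card.empty)
    then show ?thesis using 1 by simp
  next
    case 2
    have "{j. l < j \<and> w j < w l} = {Suc (Suc k)..Suc c}"
    proof (intro equalityI subsetI)
      fix j assume "j \<in> {j. l < j \<and> w j < w l}"
      then have "Suc k < j" "w j < Suc c" using 2 w_first by auto
      moreover from this obtain i where "j = Suc i" by (cases j) auto
      ultimately show "j \<in> {Suc (Suc k)..Suc c}" using w_big[of i] by (auto split: if_splits)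
    next
      fix j assume "j \<in> {Suc (Suc k)..Suc c}"
      moreover from this obtain i where "j = Suc i" by (cases j) auto
      ultimately show "j \<in> {j. l < j \<and> w j < w l}"
        using 2 w_first w_big[of i] u_le[of i] by auto
    qed
    then show ?thesis using 2 by (simp add: code_def)
  next
    case 3
    then obtain l' where l': "l = Suc l'" "k < l'" by (cases l) auto
    have "{j. l < j \<and> w j < w l} = Suc ` {j. l - 1 < j \<and> u j < u (l - 1)}"
    proof (intro equalityI subsetI)
      fix j assume "j \<in> {j. l < j \<and> w j < w l}"
      moreover from this obtain i where i: "j = Suc i" by (cases j) auto
      ultimately have "l' < i" "u i < u l'" using w_shift_less[of i l'] l' by auto
      then show "j \<in> Suc ` {j. l - 1 < j \<and> u j < u (l - 1)}" using l' i by simp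
    next
      fix j assume "j \<in> Suc ` {j. l - 1 < j \<and> u j < u (l - 1)}"
      then obtain i where "j = Suc i" "l - 1 < i" "u i < u (l - 1)" by blast
      then show "j \<in> {j. l < j \<and> w j < w l}" using w_shift_less[of i l'] l' by simp
    qed
    then show ?thesis using 3 by (simp add: code_def card_image)
  qed
qed

text \<open>A pattern 2143 in \<open>w\<close> cannot use the first \<open>k\<close> positions. If its first entry is \<open>c + 1\<close>, then its last
  two are fixed points of \<open>w\<close> and hence not in decreasing order; otherwise it is a pattern in \<open>u\<close>.\<close>

lemma vexillary_w: "vexillary u \<Longrightarrow> vexillary w"
  unfolding vexillary_def
proof (rule contrapos_nn)
  assume "\<exists>a b e d. a < b \<and> b < e \<and> e < d \<and> w b < w a \<and> w a < w d \<and> w d < w e"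
  then obtain a b e d where *: "a < b" "b < e" "e < d" "w b < w a" "w a < w d" "w d < w e" by blast
  have "k < a" using w_small_less[of a b] * by (meson leI less_asym)
  define a' b' e' d' where "a' = a - 1" "b' = b - 1" "e' = e - 1" "d' = d - 1"
  then have eq: "a = Suc a'" "b = Suc b'" "e = Suc e'" "d = Suc d'" "k \<le> a'" "a' < b'" "b' < e'" "e' < d'"
    using \<open>k < a\<close> * by auto
  show "\<exists>a b e d. a < b \<and> b < e \<and> e < d \<and> u b < u a \<and> u a < u d \<and> u d < u e"
  proof (cases "k = a'")
    case True
    then have "Suc c < w d" "Suc c < w e" using * w_first eq by auto
    then have "w d = d" "w e = e"
      using w_big[of d'] w_big[of e'] u_le[of d'] u_le[of e'] eq
      by (auto split: if_splits)
    then show ?thesis using * by simp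
  next
    case False
    then have "u b' < u a'" "u a' < u d'" "u d' < u e'"
      using * w_shift_less[of b' a'] w_shift_less[of a' d'] w_shift_less[of d' e'] eq by auto
    then show ?thesis using eq by blast
  qed
qed

end

lemma row_step_flag_perm:
  assumes "sorted_wrt (>) (l # ls)"
  shows "row_step k (l + k) (flag_perm k ls) (flag_perm k (l # ls))"
proof
  have "{1..flag_size k ls} \<subseteq> {1..l + k}"
    using assms by (cases ls) (auto simp: flag_size_def)
  moreover have "flag_perm k ls permutes {1..flag_size k ls}"
    using assms by (intro flag_perm_permutes) simp
  ultimately show "flag_perm k ls permutes {1..l + k}" using permutes_subset by blast
qed (use flag_perm_fixes assms in auto)

lemma code_flag_perm:
  assumes "sorted_wrt (>) ls"
  shows "code (flag_perm k ls) l = (if k < l \<and> l \<le> k + length ls then ls ! (l - Suc k) else 0)"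
  using assms
proof (induction ls arbitrary: l)
  case Nil
  have "{j. l < j \<and> id j < id l} = {}" by auto
  then show ?case by (simp add: code_def)
next
  case (Cons x ls)
  interpret row_step k "x + k" "flag_perm k ls" "flag_perm k (x # ls)"
    by (rule row_step_flag_perm[OF Cons.prems])
  show ?case
  proof (cases "l \<le> Suc k")
    case True
    then show ?thesis unfolding code_w by auto
  next
    case False
    then have "l - Suc k = Suc (l - 1 - Suc k)" by simp
    then show ?thesis unfolding code_w using Cons False by (auto simp del: diff_Suc_Suc diff_diff_left)
  qed
qed

lemma vexillary_flag_perm: "sorted_wrt (>) ls \<Longrightarrow> vexillary (flag_perm k ls)"
proof (induction ls)
  case Nil
  show ?case by (auto simp: vexillary_def)
next
  case (Cons x ls)
  interpret row_step k "x + k" "flag_perm k ls" "flag_perm k (x # ls)"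
    by (rule row_step_flag_perm[OF Cons.prems])
  show ?case using Cons by (intro vexillary_w) simp
qed

text \<open>If \<open>w\<close> and \<open>v\<close> agree before \<open>i\<close>, then the unused values are the same, and the code at \<open>i\<close> is the
  number of unused values below the next one.\<close>

lemma code_injective:
  assumes w: "w permutes {1..m}" and v: "v permutes {1..m'}" and eq: "code w = code v"
  shows "w = v"
proof
  have code: "code w i = card {x \<in> - w ` {..<i}. x < w i}" if w: "w permutes S" for w S i
  proof -
    have "bij_betw w {j. i < j \<and> w j < w i} {x \<in> - w ` {..<i}. x < w i}"
    proof (rule bij_betwI')
      fix x y show "w x = w y \<longleftrightarrow> x = y" using permutes_inj[OF w] by (auto simp: inj_eq)
    next
      fix x assume "x \<in> {j. i < j \<and> w j < w i}"
      then show "w x \<in> {x \<in> - w ` {..<i}. x < w i}"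
        using permutes_inj[OF w] by (auto simp: inj_eq)
    next
      fix y assume y: "y \<in> {x \<in> - w ` {..<i}. x < w i}"
      obtain x where x: "y = w x" using permutes_surj[OF w] by blast
      then have "\<not> x < i" "x \<noteq> i" using y by auto
      then have "x \<in> {j. i < j \<and> w j < w i}" using x y by auto
      then show "\<exists>x\<in>{j. i < j \<and> w j < w i}. y = w x" using x by blast
    qed
    then show ?thesis unfolding code_def by (rule bij_betw_same_card)
  qed
  fix i show "w i = v i"
  proof (induction i rule: less_induct)
    case (less i)
    define U where "U = - w ` {..<i}"
    have U: "U = - v ` {..<i}" using less by (auto simp: U_def image_iff)
    have card: "card {x \<in> U. x < w i} = card {x \<in> U. x < v i}"
      using code[OF w, of i] code[OF v, of i] fun_cong[OF eq, of i] U unfolding U_def by simp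
    have mem1: "w i \<in> U" unfolding U_def using permutes_inj[OF w] by (auto simp: inj_eq)
    have mem2: "v i \<in> U" unfolding U using permutes_inj[OF v] by (auto simp: inj_eq)
    note mem = mem1 mem2
    have fin: "finite {x \<in> U. x < y}" for y by simp
    show ?case
    proof (rule linorder_cases)
      assume "w i < v i"
      then have "{x \<in> U. x < w i} \<subset> {x \<in> U. x < v i}" using mem by auto
      from psubset_card_mono[OF fin this] show ?thesis using card by simp
    next
      assume "v i < w i"
      then have "{x \<in> U. x < v i} \<subset> {x \<in> U. x < w i}" using mem by auto
      from psubset_card_mono[OF fin this] show ?thesis using card by simp
    qed
  qed
qed

text \<open>The shape \<open>(n p, \<dots>, 2 p, p)\<close>.\<close>

definition stair :: "nat \<Rightarrow> nat \<Rightarrow> nat list" where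
  "stair n p = map (\<lambda>i. (n + 1 - i) * p) [1..<n+1]"

lemma length_stair [simp]: "length (stair n p) = n"
  by (simp add: stair_def)

lemma nth_stair: "i < n \<Longrightarrow> stair n p ! i = (n - i) * p"
  by (simp add: stair_def del: upt_Suc)

lemma sorted_stair: "p \<ge> 1 \<Longrightarrow> sorted_wrt (>) (stair n p)"
  by (auto simp: sorted_wrt_iff_nth_less nth_stair)

lemma sorted_rev_of_strict: "sorted_wrt (>) xs \<Longrightarrow> sorted (rev xs)" for xs :: "nat list"
  by (auto simp: sorted_wrt_rev intro: sorted_wrt_mono_rel[rotated])

lemma strict_desc_eq:
  fixes xs ys :: "nat list"
  assumes "sorted_wrt (>) xs" "sorted_wrt (>) ys" "mset xs = mset ys"
  shows "xs = ys"
  using properties_for_sort[of "rev ys" "xs"] properties_for_sort[of "rev xs" "xs"]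
    sorted_rev_of_strict[OF assms(1)] sorted_rev_of_strict[OF assms(2)] assms(3) by simp

lemma code_finite_support:
  assumes "finitary_perm w"
  shows "finite {i. code w i > 0}"
proof -
  obtain m where w: "w permutes {1..m}" using assms by (auto simp: finitary_perm_def)
  have "{i. code w i > 0} \<subseteq> {..m}"
  proof
    fix i assume "i \<in> {i. code w i > 0}"
    then have "code w i \<noteq> 0" by simp
    then have "{j. i < j \<and> w j < w i} \<noteq> {}" unfolding code_def by (metis card.empty)
    then obtain j where "i < j" "w j < w i" by auto
    then have "\<not> m < i" using permutes_fixed[OF w, of i] permutes_fixed[OF w, of j] by auto
    then show "i \<in> {..m}" by simp
  qed
  then show ?thesis by (rule finite_subset) simp
qed

lemma map_add_upt_shift: "map (\<lambda>i. k + i) [1..<n+1] = [Suc k..<Suc (k + n)]"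
  by (rule nth_equalityI) (simp_all del: upt_Suc)

lemma mset_set_interval: "mset_set {Suc k..k + n} = mset [Suc k..<Suc (k + n)]"
  unfolding mset_upt by (simp add: atLeastLessThanSuc_atLeastAtMost)

text \<open>Let \<open>S\<close> be the support of the code. The flag comes from a map \<open>\<phi>\<close> of \<open>S\<close> to itself with \<open>\<phi> i \<ge> i\<close>, which is
  injective because the flag has distinct entries. So \<open>\<phi>\<close> is the identity and \<open>S\<close> is the set of flag
  entries; this also forces the code to decrease strictly on \<open>S\<close>.\<close>

lemma spec_code:
  assumes p: "p \<ge> 1" and w: "finitary_perm w"
    and shape: "shape w = stair n p" and flag: "flag w = map (\<lambda>i. k + i) [1..<n+1]"
  shows "code w = code (flag_perm k (stair n p))"
proof -
  define c where "c = code w"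
  define S where "S = {i. c i > 0}"
  define \<phi> where "\<phi> i = Max {j. i \<le> j \<and> c i \<le> c j}" for i
  have fin: "finite S" using code_finite_support[OF w] by (simp add: S_def c_def)
  have ms: "image_mset c (mset_set S) = mset (stair n p)"
    using arg_cong[OF shape, of mset] by (simp add: shape_def c_def S_def)
  have mf: "image_mset \<phi> (mset_set S) = mset [Suc k..<Suc (k + n)]"
    using arg_cong[OF flag, of mset] unfolding map_add_upt_shift
    by (simp add: flag_def c_def S_def \<phi>_def[abs_def] del: upt_Suc)
  have cardS: "card S = n" using arg_cong[OF ms, of size] by simp
  have im: "\<phi> ` S = {Suc k..k + n}"
    using arg_cong[OF mf, of set_mset] fin
    by (simp add: atLeastLessThanSuc_atLeastAtMost del: upt_Suc)
  then have inj: "inj_on \<phi> S" by (intro eq_card_imp_inj_on fin) (simp add: cardS)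
  have A: "\<phi> i \<in> S \<and> i \<le> \<phi> i \<and> (\<forall>j. i \<le> j \<and> c i \<le> c j \<longrightarrow> j \<le> \<phi> i)" if "i \<in> S" for i
  proof -
    have sub: "{j. i \<le> j \<and> c i \<le> c j} \<subseteq> S" using that by (auto simp: S_def)
    then have f: "finite {j. i \<le> j \<and> c i \<le> c j}" using fin finite_subset by blast
    have "{j. i \<le> j \<and> c i \<le> c j} \<noteq> {}" by auto
    from Max_in[OF f this] Max_ge[OF f] sub show ?thesis unfolding \<phi>_def by blast
  qed
  then have "\<phi> ` S = S" by (intro endo_inj_surj fin inj) auto
  then have S: "S = {Suc k..k + n}" using im by simp
  have "\<phi> i = i" if "i \<in> S" for i
  proof (rule ccontr)
    assume "\<phi> i \<noteq> i"
    then have "(\<Sum>i\<in>S. i) < (\<Sum>i\<in>S. \<phi> i)"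
    proof (intro sum_strict_mono_ex1 fin)
      show "\<forall>x\<in>S. x \<le> \<phi> x" using A by blast
      show "\<exists>a\<in>S. a < \<phi> a"
        by (rule bexI[OF _ that]) (use A[OF that] \<open>\<phi> i \<noteq> i\<close> in simp)
    qed
    also have "\<dots> = (\<Sum>i\<in>S. i)"
      using sum.reindex[OF inj, of "\<lambda>i. i"] \<open>\<phi> ` S = S\<close> by simp
    finally show False by simp
  qed
  then have dec: "c j < c i" if "i \<in> S" "j \<in> S" "i < j" for i j
    using A[OF that(1)] that by (metis leD le_less_linear less_imp_le)
  have "map c [Suc k..<Suc (k + n)] = stair n p"
  proof (rule strict_desc_eq)
    show "sorted_wrt (>) (map c [Suc k..<Suc (k + n)])"
      using dec by (auto simp: sorted_wrt_iff_nth_less S simp del: upt_Suc)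
    show "mset (map c [Suc k..<Suc (k + n)]) = mset (stair n p)"
      unfolding ms[symmetric] S mset_set_interval by (simp del: upt_Suc)
  qed (rule sorted_stair[OF p])
  then have "c (Suc (k + i)) = stair n p ! i" if "i < n" for i
    using that by (metis add_Suc diff_add_inverse length_upt nth_map nth_upt add_less_cancel_left plus_nat.simps(2) length_map length_stair)
  then have on: "c l = stair n p ! (l - Suc k)" if "l \<in> S" for l
    using that S by (metis add_Suc atLeastAtMost_iff le_add_diff_inverse length_stair less_diff_conv2 less_Suc_eq_le add.commute)
  have "c l = code (flag_perm k (stair n p)) l" for l
  proof -
    have l: "l \<in> S \<longleftrightarrow> k < l \<and> l \<le> k + length (stair n p)" using S by auto
    have "c l = 0" if "l \<notin> S" using that by (simp add: S_def)
    then show ?thesis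
      unfolding code_flag_perm[OF sorted_stair[OF p]] l[symmetric] using on[of l] by simp
  qed
  then show ?thesis by (simp add: c_def fun_eq_iff)
qed

lemma flag_perm_spec:
  assumes p: "p \<ge> 1"
  shows "shape (flag_perm k (stair n p)) = stair n p"
    and "flag (flag_perm k (stair n p)) = map (\<lambda>i. k + i) [1..<n+1]"
proof -
  define c where "c = code (flag_perm k (stair n p))"
  have c: "c l = (if k < l \<and> l \<le> k + n then (n - (l - Suc k)) * p else 0)" for l
    unfolding c_def code_flag_perm[OF sorted_stair[OF p]]
    using nth_stair[of "l - Suc k" n p] by auto
  have S: "{i. c i > 0} = {Suc k..k + n}"
    using p by (auto simp: c split: if_splits)
  have "map c [Suc k..<Suc (k + n)] = stair n p"
    by (rule nth_equalityI) (simp_all add: c nth_stair del: upt_Suc)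
  then have "image_mset c (mset_set {Suc k..k + n}) = mset (stair n p)"
    unfolding mset_set_interval by (metis mset_map)
  then have "shape (flag_perm k (stair n p)) = rev (sort (stair n p))"
    unfolding shape_def c_def[symmetric] S by simp
  also have "sort (stair n p) = rev (stair n p)"
    by (rule properties_for_sort) (simp_all add: sorted_rev_of_strict[OF sorted_stair[OF p]])
  finally show "shape (flag_perm k (stair n p)) = stair n p" by simp
  have "Max {j. i \<le> j \<and> c i \<le> c j} = i" if "i \<in> {Suc k..k + n}" for i
  proof (rule Max_eqI)
    have sub: "j \<le> i" if "i \<le> j" "c i \<le> c j" for j
    proof (rule ccontr)
      assume "\<not> j \<le> i"
      then have "c j < c i" using \<open>i \<in> {Suc k..k + n}\<close> p by (auto simp: c)
      then show False using that by simp
    qed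
    then have "{j. i \<le> j \<and> c i \<le> c j} \<subseteq> {..i}" by auto
    then show "finite {j. i \<le> j \<and> c i \<le> c j}" by (rule finite_subset) simp
    show "y \<le> i" if "y \<in> {j. i \<le> j \<and> c i \<le> c j}" for y using that sub by auto
  qed auto
  then have "image_mset (\<lambda>i. Max {j. i \<le> j \<and> c i \<le> c j}) (mset_set {Suc k..k + n})
      = mset_set {Suc k..k + n}"
    using image_mset_cong[of "mset_set {Suc k..k + n}" "\<lambda>i. Max {j. i \<le> j \<and> c i \<le> c j}" "\<lambda>i. i"]
    by simp
  then have "flag (flag_perm k (stair n p)) = sort [Suc k..<Suc (k + n)]"
    unfolding flag_def c_def[symmetric] S mset_set_interval by (simp del: upt_Suc)
  then show "flag (flag_perm k (stair n p)) = map (\<lambda>i. k + i) [1..<n+1]"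
    unfolding map_add_upt_shift by (simp add: sorted_sort_id del: upt_Suc)
qed

theorem varpi_eq:
  assumes "p \<ge> 1"
  shows "varpi n k p = flag_perm k (stair n p)"
proof -
  have perm: "flag_perm k (stair n p) permutes {1..flag_size k (stair n p)}"
    by (rule flag_perm_permutes[OF sorted_stair[OF assms]])
  show ?thesis unfolding varpi_def stair_def[symmetric]
  proof (rule the_equality)
    show "finitary_perm (flag_perm k (stair n p)) \<and> vexillary (flag_perm k (stair n p))
      \<and> shape (flag_perm k (stair n p)) = stair n p
      \<and> flag (flag_perm k (stair n p)) = map (\<lambda>i. k + i) [1..<n+1]"
      using perm flag_perm_spec[OF assms] vexillary_flag_perm[OF sorted_stair[OF assms]]
      by (auto simp: finitary_perm_def simp del: upt_Suc)
  next
    fix w assume w: "finitary_perm w \<and> vexillary w \<and> shape w = stair n p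
      \<and> flag w = map (\<lambda>i. k + i) [1..<n+1]"
    then obtain m where "w permutes {1..m}" by (auto simp: finitary_perm_def)
    moreover have "code w = code (flag_perm k (stair n p))"
      using w by (intro spec_code[OF assms]) auto
    ultimately show "w = flag_perm k (stair n p)" using code_injective perm by blast
  qed
qed

lemma flag_size_le:
  assumes "p \<ge> 1" "n \<ge> 1" "flag_perm k (stair n p) permutes {1..m}"
  shows "flag_size k (stair n p) \<le> m"
proof -
  obtain x xs where st: "stair n p = x # xs" using assms(2) length_stair[of n p] by (cases "stair n p") auto
  interpret row_step k "x + k" "flag_perm k xs" "flag_perm k (x # xs)"
    by (rule row_step_flag_perm) (use sorted_stair[OF assms(1), of n] st in simp)
  have "x \<ge> 1" using nth_stair[of 0 n p] st assms by simp
  have "flag_perm k (stair n p) (Suc k) = Suc (x + k)" using w_first st by simp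
  moreover have "flag_perm k (stair n p) (Suc k) \<le> m"
  proof -
    have "flag_perm k (stair n p) (Suc k) \<noteq> Suc k" using w_first st \<open>x \<ge> 1\<close> by simp
    then have "Suc k \<in> {1..m}" using permutes_not_in[OF assms(3)] by blast
    then show ?thesis using permutes_in_image[OF assms(3), of "Suc k"] by simp
  qed
  ultimately show ?thesis by (simp add: flag_size_def st)
qed


section \<open>Lagrange inversion and the case of one fixed point\<close>

text \<open>Positive values of \<open>\<beta>\<close> suffice to identify a polynomial in \<open>\<beta>\<close>.\<close>

lemma poly_eq_from_positive:
  fixes P Q :: "real poly"
  assumes "\<And>x. x > 0 \<Longrightarrow> poly P x = poly Q x"
  shows "P = Q"
proof (rule ccontr)
  assume "P \<noteq> Q"
  then have "finite {x. poly (P - Q) x = 0}" by (intro poly_roots_finite) simp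
  moreover have "{0<..} \<subseteq> {x. poly (P - Q) x = 0}" using assms by auto
  ultimately have "finite {0::real<..}" by (rule finite_subset[rotated])
  then show False using infinite_Ioi by blast
qed

text \<open>Here \<open>g = X / \<theta>\<close>, and \<open>f\<close> is its compositional inverse. Differentiating \<open>f \<circ> g = X\<close> and multiplying by
  \<open>\<theta>\<^sup>m\<close> gives a sum over \<open>i\<close> in which only the term \<open>i = m - 1\<close> contributes to the coefficient of
  \<open>X\<^bsup>m-1\<^esup>\<close>. This is the usual residue computation, in which the derivative of a power of \<open>g\<close> has no residue.\<close>

lemma lagrange_inversion:
  fixes \<theta> g :: "real fps"
  assumes g: "g * \<theta> = fps_X" and f: "f oo g = fps_X" and g0: "fps_nth g 0 = 0" and m: "m \<ge> 1"
  shows "real m * fps_nth f m = fps_nth (\<theta> ^ m) (m - 1)"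
proof -
  define h where "h = fps_deriv g * \<theta> ^ m"
  have "fps_deriv (f oo g) = 1" using f by simp
  then have 1: "(fps_deriv f oo g) * h = \<theta> ^ m"
    unfolding h_def fps_compose_deriv[OF g0] mult.assoc[symmetric] by simp
  have d: "fps_deriv g * \<theta> + g * fps_deriv \<theta> = 1"
    using arg_cong[OF g, of fps_deriv] by (simp add: algebra_simps)
  have res: "fps_nth (g ^ i * h) (m - 1) = (if i = m - 1 then 1 else 0)" if "i < m" for i
  proof -
    define q where "q = m - 1 - i"
    have mq: "m = i + Suc q" using that by (simp add: q_def)
    have "g ^ i * h = (g * \<theta>) ^ i * (fps_deriv g * \<theta> ^ Suc q)"
      unfolding h_def mq power_add power_mult_distrib by (simp only: mult_ac)
    then have "fps_nth (g ^ i * h) (m - 1) = fps_nth (fps_deriv g * \<theta> ^ Suc q) q"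
      unfolding g using mq by (simp add: fps_X_power_mult_nth)
    also have "\<dots> = (if q = 0 then 1 else 0)"
    proof (cases q)
      case 0
      then show ?thesis using arg_cong[OF d, of "\<lambda>F. fps_nth F 0"] g0 by simp
    next
      case (Suc r)
      have "fps_deriv g * \<theta> ^ Suc q = (fps_deriv g * \<theta>) * \<theta> ^ q" by (simp only: power_Suc mult_ac)
      also have "fps_deriv g * \<theta> = 1 - g * fps_deriv \<theta>" using d by (simp add: algebra_simps)
      also have "(1 - g * fps_deriv \<theta>) * \<theta> ^ q = \<theta> ^ q - (g * \<theta>) * (fps_deriv \<theta> * \<theta> ^ r)"
        by (simp add: Suc algebra_simps)
      finally have e: "fps_deriv g * \<theta> ^ Suc q = \<theta> ^ q - fps_X * (fps_deriv \<theta> * \<theta> ^ r)"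
        unfolding g .
      have "fps_deriv (\<theta> ^ q) = fps_const (real q) * (fps_deriv \<theta> * \<theta> ^ r)"
        by (simp only: fps_deriv_power' Suc fps_of_nat[symmetric] diff_Suc_1 mult.assoc)
      then have "fps_nth (fps_deriv (\<theta> ^ q)) r = real q * fps_nth (fps_deriv \<theta> * \<theta> ^ r) r"
        by (simp only: fps_mult_left_const_nth)
      moreover have "fps_nth (fps_deriv (\<theta> ^ q)) r = real q * fps_nth (\<theta> ^ q) q"
        unfolding fps_deriv_nth Suc by simp
      ultimately have "real q * fps_nth (\<theta> ^ q) q = real q * fps_nth (fps_deriv \<theta> * \<theta> ^ r) r"
        by (simp only:)
      then have "fps_nth (\<theta> ^ q) q = fps_nth (fps_deriv \<theta> * \<theta> ^ r) r" using Suc by simp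
      then show ?thesis unfolding e using Suc by simp
    qed
    finally show ?thesis using mq by auto
  qed
  have "fps_nth (\<theta> ^ m) (m - 1) = (\<Sum>l=0..m - 1. fps_nth (fps_deriv f oo g) l * fps_nth h (m - 1 - l))"
    unfolding 1[symmetric] fps_mult_nth ..
  also have "\<dots> = (\<Sum>l=0..m - 1. \<Sum>i<m. fps_nth (fps_deriv f) i * (fps_nth (g ^ i) l * fps_nth h (m - 1 - l)))"
  proof (rule sum.cong[OF refl])
    fix l assume l: "l \<in> {0..m - 1}"
    have "fps_nth (fps_deriv f oo g) l = (\<Sum>i<m. fps_nth (fps_deriv f) i * fps_nth (g ^ i) l)"
      unfolding fps_compose_nth
      by (rule sum.mono_neutral_left) (use l m startsby_zero_power_prefix[OF g0] in auto)
    then show "fps_nth (fps_deriv f oo g) l * fps_nth h (m - 1 - l)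
      = (\<Sum>i<m. fps_nth (fps_deriv f) i * (fps_nth (g ^ i) l * fps_nth h (m - 1 - l)))"
      by (simp only: sum_distrib_right mult.assoc)
  qed
  also have "\<dots> = (\<Sum>i<m. fps_nth (fps_deriv f) i * fps_nth (g ^ i * h) (m - 1))"
    by (subst sum.swap) (simp only: fps_mult_nth sum_distrib_left)
  also have "\<dots> = (\<Sum>i<m. if i = m - 1 then fps_nth (fps_deriv f) i else 0)"
  proof (rule sum.cong[OF refl])
    fix i assume "i \<in> {..<m}"
    then have "i < m" by simp
    show "fps_nth (fps_deriv f) i * fps_nth (g ^ i * h) (m - 1)
        = (if i = m - 1 then fps_nth (fps_deriv f) i else 0)"
      unfolding res[OF \<open>i < m\<close>] by simp
  qed
  also have "\<dots> = real m * fps_nth f m" using m by simp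
  finally show ?thesis by simp
qed

text \<open>With \<open>g = X \<psi>\<close>, the matrix of the coefficients of \<open>g\<^bsup>n+1\<^esup>, \<dots>, g\<close> at \<open>X\<^bsup>n+1\<^esup>, \<dots>, X\<close> is unitriangular, and the
  present one arises from it by removing the first row and the last column. Replace the first row by the
  combination of the rows that represents \<open>X = f \<circ> g\<close>: on the one hand the determinant is now the coefficient of \<open>f\<close> at \<open>X\<^bsup>n+1\<^esup>\<close>, on
  the other hand the new row is a unit vector.\<close>

lemma hessenberg_det:
  fixes \<psi> :: "real fps"
  assumes \<psi>: "fps_nth \<psi> 0 = 1"
  shows "real (Suc n) * det (mat n n (\<lambda>(i, j). fps_nth (fps_X ^ j * \<psi> ^ (n - i)) (Suc i)))
    = (-1) ^ n * fps_nth (inverse \<psi> ^ Suc n) n"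
proof -
  define g where "g = fps_X * \<psi>"
  define f where "f = fps_inv g"
  have g0: "fps_nth g 0 = 0" by (simp add: g_def)
  have f: "f oo g = fps_X" unfolding f_def by (rule fps_inv[OF g0]) (simp add: g_def \<psi>)
  have "g * inverse \<psi> = fps_X"
    unfolding g_def mult.assoc using \<psi> by (simp add: inverse_mult_eq_1')
  from lagrange_inversion[OF this f g0, of "Suc n"]
  have lag: "real (Suc n) * fps_nth f (Suc n) = fps_nth (inverse \<psi> ^ Suc n) n" by simp
  have gnth: "fps_nth (g ^ a) b = (if b < a then 0 else fps_nth (\<psi> ^ a) (b - a))" for a b
    unfolding g_def power_mult_distrib by (simp add: fps_X_power_mult_nth)
  define c where "c = (\<lambda>i. fps_nth f (Suc n - i))"
  define M where "M = mat (Suc n) (Suc n) (\<lambda>(i, j). fps_nth (g ^ (Suc n - i)) (Suc n - j))"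
  \<comment> \<open>Multiplication by \<open>E\<close> from the left replaces the first row of \<open>M\<close> by the combination of its rows with coefficients \<open>c\<close>.\<close>
  define E where "E = mat (Suc n) (Suc n) (\<lambda>(i, j). if i = 0 then c j else if i = j then 1 else 0)"
  have M: "M \<in> carrier_mat (Suc n) (Suc n)" and E: "E \<in> carrier_mat (Suc n) (Suc n)"
    by (simp_all add: M_def E_def)
  have detM: "det M = 1"
    by (rule det_unitriangular[OF M]) (auto simp: M_def gnth \<psi> fps_power_zeroth)
  have "det E = prod_list (diag_mat E)"
    by (rule det_upper_triangular[OF _ E]) (auto simp: E_def)
  also have "diag_mat E = c 0 # map (\<lambda>i. 1) [1..<Suc n]"
    unfolding diag_mat_def by (simp add: E_def upt_conv_Cons del: upt_Suc)
  also have "prod_list \<dots> = c 0"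
    by (simp only: map_replicate_const prod_list.Cons prod_list_replicate power_one mult_1_right)
  finally have detE: "det E = c 0" .
  have EM: "E * M \<in> carrier_mat (Suc n) (Suc n)" using E M by simp
  have ent: "(E * M) $$ (i, j) = (\<Sum>l\<in>{0..<Suc n}. E $$ (i, l) * M $$ (l, j))"
    if "i < Suc n" "j < Suc n" for i j
    using that E M by (simp add: scalar_prod_def)
  have row0: "(E * M) $$ (0, j) = (if j = n then 1 else 0)" if j: "j < Suc n" for j
  proof -
    have "(E * M) $$ (0, j) = (\<Sum>l\<in>{0..<Suc n}. fps_nth f (Suc n - l) * fps_nth (g ^ (Suc n - l)) (Suc n - j))"
      unfolding ent[OF zero_less_Suc j] by (rule sum.cong) (use j in \<open>auto simp: E_def M_def c_def\<close>)
    also have "\<dots> = (\<Sum>i\<in>{1..Suc n}. fps_nth f i * fps_nth (g ^ i) (Suc n - j))"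
      by (rule sum.reindex_bij_witness[of _ "\<lambda>i. Suc n - i" "\<lambda>l. Suc n - l"]) auto
    also have "\<dots> = (\<Sum>i\<in>{0..Suc n - j}. fps_nth f i * fps_nth (g ^ i) (Suc n - j))"
      by (rule sum.mono_neutral_cong) (use j in \<open>auto simp: gnth Suc_le_eq\<close>)
    also have "\<dots> = fps_nth (f oo g) (Suc n - j)" by (simp only: fps_compose_nth)
    finally show ?thesis unfolding f using j by auto
  qed
  have rowi: "(E * M) $$ (Suc i, j) = M $$ (Suc i, j)" if "Suc i < Suc n" "j < Suc n" for i j
  proof -
    have "(E * M) $$ (Suc i, j) = (\<Sum>l\<in>{0..<Suc n}. if l = Suc i then M $$ (Suc i, j) else 0)"
      unfolding ent[OF that] by (rule sum.cong) (use that in \<open>auto simp: E_def\<close>)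
    then show ?thesis using that by simp
  qed
  have "det (E * M) = (-1) ^ n * det (mat_delete (E * M) 0 n)"
    using det_unit_row[OF EM _ _ row0] by simp
  also have "mat_delete (E * M) 0 n = mat n n (\<lambda>(i, j). fps_nth (fps_X ^ j * \<psi> ^ (n - i)) (Suc i))"
  proof (rule eq_matI)
    fix i j assume "i < dim_row (mat n n (\<lambda>(i, j). fps_nth (fps_X ^ j * \<psi> ^ (n - i)) (Suc i)))"
      "j < dim_col (mat n n (\<lambda>(i, j). fps_nth (fps_X ^ j * \<psi> ^ (n - i)) (Suc i)))"
    then have ij: "i < n" "j < n" by auto
    then have "mat_delete (E * M) 0 n $$ (i, j) = (E * M) $$ (Suc i, j)"
      using E M by (simp add: mat_delete_def)
    also have "\<dots> = M $$ (Suc i, j)" using rowi ij by simp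
    also have "\<dots> = fps_nth (g ^ (n - i)) (Suc n - j)" using ij by (simp add: M_def)
    also have "\<dots> = fps_nth (fps_X ^ j * \<psi> ^ (n - i)) (Suc i)"
    proof -
      have "Suc n - j < n - i \<longleftrightarrow> Suc i < j" "Suc n - j - (n - i) = Suc i - j" using ij by auto
      then show ?thesis by (simp only: gnth fps_X_power_mult_nth)
    qed
    finally show "mat_delete (E * M) 0 n $$ (i, j)
        = mat n n (\<lambda>(i, j). fps_nth (fps_X ^ j * \<psi> ^ (n - i)) (Suc i)) $$ (i, j)" using ij by simp
  qed (use E M in \<open>auto simp: mat_delete_def\<close>)
  finally have "det (E * M) = (-1) ^ n * det (mat n n (\<lambda>(i, j). fps_nth (fps_X ^ j * \<psi> ^ (n - i)) (Suc i)))" .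
  moreover have "det (E * M) = c 0" using det_mult[OF E M] detM detE by simp
  ultimately have "fps_nth f (Suc n)
      = (-1) ^ n * det (mat n n (\<lambda>(i, j). fps_nth (fps_X ^ j * \<psi> ^ (n - i)) (Suc i)))"
    by (simp add: c_def)
  then have "real (Suc n) * det (mat n n (\<lambda>(i, j). fps_nth (fps_X ^ j * \<psi> ^ (n - i)) (Suc i)))
      = (-1) ^ n * (real (Suc n) * fps_nth f (Suc n))"
    by (simp flip: power_add mult_2)
  then show ?thesis unfolding lag .
qed

lemma nth_one_minus_X_power:
  "fps_nth ((1 - fps_const c * fps_X) ^ a) t = (- c) ^ t * real (a choose t)" for c :: real
proof (induction a arbitrary: t)
  case 0
  show ?case by (cases t) auto
next
  case (Suc a)
  have "(1 - fps_const c * fps_X) ^ Suc a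
      = (1 - fps_const c * fps_X) ^ a - fps_const c * (fps_X * (1 - fps_const c * fps_X) ^ a)"
    by (simp add: algebra_simps)
  then have "fps_nth ((1 - fps_const c * fps_X) ^ Suc a) t
      = fps_nth ((1 - fps_const c * fps_X) ^ a) t
        - c * fps_nth (fps_X * (1 - fps_const c * fps_X) ^ a) t"
    by (simp only: fps_sub_nth fps_mult_left_const_nth)
  then show ?case unfolding fps_X_mult_nth Suc by (cases t) (simp_all add: algebra_simps)
qed

lemma row_series_power:
  "row_series \<beta> (r * p) r = row_series \<beta> p 1 ^ r"
  by (simp add: row_series_def power_mult_distrib fps_inverse_mult fps_inverse_power
      mult.commute[of r] power_mult)

theorem one_fixed_point:
  assumes n: "n \<ge> 1" and p: "p \<ge> 1" and perm: "varpi n 1 p permutes {1..m}"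
  shows "(map_poly of_int (groth_at_ones m (varpi n 1 p)) :: rat poly) =
          (\<Sum>j = 1..n+1. monom (1 / of_nat (n+1) * of_nat ((n+1) choose j)
                                 * of_nat (((n+1) * p) choose (j-1))) (j-1))"
proof -
  define G where "G = groth_at_ones m (varpi n 1 p)"
  define a where "a t = ((n + 1) choose (t + 1)) * (((n + 1) * p) choose t)" for t
  define Q :: "real poly" where "Q = (\<Sum>t\<le>n. monom (real (a t)) t)"
  have "real (n + 1) * poly (map_poly real_of_int G) \<beta> = poly Q \<beta>" if \<beta>: "\<beta> > 0" for \<beta>
  proof -
    have perm': "flag_perm 1 (stair n p) permutes {1..m}" using perm varpi_eq[OF p] by simp
    define \<psi> where "\<psi> = row_series \<beta> p 1"
    have \<theta>: "inverse \<psi> = (1 - fps_const \<beta> * fps_X) ^ p * (1 - fps_const 1 * fps_X)"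
      unfolding \<psi>_def row_series_def by (subst fps_inverse_idempotent) (simp_all add: fps_power_zeroth)
    have \<psi>0: "fps_nth \<psi> 0 = 1" unfolding \<psi>_def row_series_def by (simp add: fps_power_zeroth)
    have "poly (map_poly real_of_int G) \<beta> = Gr (\<beta> - 1) m (\<lambda>i. 1) (flag_perm 1 (stair n p))"
      using poly_groth_at_ones[OF perm, of \<beta>] unfolding G_def varpi_eq[OF p] .
    also have "\<dots> = det (mat n n (\<lambda>(i, j). row_entry \<beta> 1 (stair n p) i j))"
      using Gr_ones_flag_perm[OF sorted_stair[OF p] flag_size_le[OF p n perm'] \<beta>] by simp
    also have "mat n n (\<lambda>(i, j). row_entry \<beta> 1 (stair n p) i j)
        = mat n n (\<lambda>(i, j). fps_nth (fps_X ^ j * \<psi> ^ (n - i)) (Suc i))"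
      by (rule eq_matI) (auto simp: row_entry_def nth_stair row_series_power \<psi>_def)
    finally have "real (n + 1) * poly (map_poly real_of_int G) \<beta>
        = (-1) ^ n * fps_nth (inverse \<psi> ^ Suc n) n"
      using hessenberg_det[OF \<psi>0, of n] by simp
    also have "inverse \<psi> ^ Suc n
        = (1 - fps_const \<beta> * fps_X) ^ ((n + 1) * p) * (1 - fps_const 1 * fps_X) ^ (n + 1)"
      unfolding \<theta> power_mult_distrib power_mult[symmetric] by (simp add: mult.commute)
    also have "fps_nth \<dots> n = (\<Sum>t\<le>n. ((- \<beta>) ^ t * real (((n + 1) * p) choose t))
        * ((- 1) ^ (n - t) * real ((n + 1) choose (n - t))))"
      unfolding fps_mult_nth nth_one_minus_X_power by (simp only: atLeast0AtMost)
    also have "\<dots> = (\<Sum>t\<le>n. (- 1) ^ n * (real (a t) * \<beta> ^ t))"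
    proof (rule sum.cong[OF refl])
      fix t assume "t \<in> {..n}"
      then have t: "t \<le> n" by simp
      have "(n + 1) choose (n - t) = (n + 1) choose (t + 1)"
        using binomial_symmetric[of "t + 1" "n + 1"] t by simp
      moreover have "(- \<beta>) ^ t * (- 1) ^ (n - t) = (- 1) ^ n * \<beta> ^ t"
        using t by (simp add: power_minus[of \<beta>] flip: power_add)
      moreover have "((- \<beta>) ^ t * real (((n + 1) * p) choose t))
          * ((- 1) ^ (n - t) * real ((n + 1) choose (n - t)))
        = ((- \<beta>) ^ t * (- 1) ^ (n - t)) * (real (((n + 1) * p) choose t) * real ((n + 1) choose (n - t)))"
        by (simp only: mult_ac)
      ultimately show "((- \<beta>) ^ t * real (((n + 1) * p) choose t))
        * ((- 1) ^ (n - t) * real ((n + 1) choose (n - t))) = (- 1) ^ n * (real (a t) * \<beta> ^ t)"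
        by (simp only: a_def of_nat_mult mult_ac)
    qed
    also have "(-1) ^ n * \<dots> = poly Q \<beta>"
    proof -
      have "(-1) ^ n * (\<Sum>t\<le>n. (- 1) ^ n * (real (a t) * \<beta> ^ t))
          = ((-1) ^ n * (-1) ^ n) * (\<Sum>t\<le>n. real (a t) * \<beta> ^ t)"
        by (simp only: sum_distrib_left mult.assoc)
      also have "(-1) ^ n * (-1) ^ n = (1::real)" by (simp flip: power_add mult_2)
      finally show ?thesis by (simp add: Q_def poly_sum poly_monom)
    qed
    finally show ?thesis .
  qed
  then have sm: "smult (real (n + 1)) (map_poly real_of_int G) = Q"
    by (intro poly_eq_from_positive) simp
  have "coeff Q t = (if t \<le> n then real (a t) else 0)" for t
    by (simp add: Q_def coeff_sum)
  then have "real (n + 1) * real_of_int (coeff G t) = (if t \<le> n then real (a t) else 0)" for t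
    using arg_cong[OF sm, of "\<lambda>q. coeff q t"] by (simp add: coeff_map_poly)
  then have "real_of_int (int (n + 1) * coeff G t) = real_of_int (if t \<le> n then int (a t) else 0)" for t
    by (simp split: if_splits)
  then have int: "int (n + 1) * coeff G t = (if t \<le> n then int (a t) else 0)" for t
    by (simp only: of_int_eq_iff)
  have co: "coeff (map_poly of_int G :: rat poly) t = (if t \<le> n then 1 / of_nat (n + 1) * of_nat (a t) else 0)" for t
  proof -
    have h: "of_nat (n + 1) * (of_int (coeff G t) :: rat) = (if t \<le> n then of_nat (a t) else 0)"
      using arg_cong[OF int[of t], of "of_int :: int \<Rightarrow> rat"] by (simp split: if_splits)
    have "(of_nat (n + 1) :: rat) \<noteq> 0" unfolding of_nat_eq_0_iff by simp
    then have "of_int (coeff G t) = (if t \<le> n then of_nat (a t) else 0) / (of_nat (n + 1) :: rat)"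
      by (rule eq_divide_imp) (use h in \<open>simp only: mult.commute\<close>)
    then show ?thesis by (simp add: coeff_map_poly)
  qed
  have "(\<Sum>j = 1..n+1. monom (1 / of_nat (n+1) * of_nat ((n+1) choose j)
      * of_nat (((n+1) * p) choose (j-1))) (j-1)) = (\<Sum>t\<le>n. monom (1 / of_nat (n + 1) * of_nat (a t) :: rat) t)"
    by (rule sum.reindex_bij_witness[of _ Suc "\<lambda>j. j - 1"]) (auto simp: a_def)
  moreover have "(map_poly of_int G :: rat poly) = (\<Sum>t\<le>n. monom (1 / of_nat (n + 1) * of_nat (a t)) t)"
    by (rule poly_eqI) (auto simp: co coeff_sum)
  ultimately show ?thesis by (simp add: G_def)
qed


section \<open>Positivity of the leading determinant\<close>

text \<open>The coefficient of \<open>X\<^sup>t\<close> in \<open>(1 - X)\<close> to the power \<open>-a\<close>, the number of multisets of size \<open>t\<close> in \<open>a\<close> letters.\<close>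

definition mchoose :: "nat \<Rightarrow> nat \<Rightarrow> real" where
  "mchoose a t = fps_nth (inverse ((1 - fps_X) ^ a)) t"

lemma mchoose_0 [simp]: "mchoose a 0 = 1"
  by (simp add: mchoose_def fps_power_zeroth)

lemma mchoose_zero_left: "mchoose 0 t = (if t = 0 then 1 else 0)"
  by (simp add: mchoose_def)

lemma mchoose_Suc: "mchoose (Suc a) (Suc t) = mchoose a (Suc t) + mchoose (Suc a) t"
proof -
  define I :: "real fps" where "I = inverse ((1 - fps_X) ^ Suc a)"
  have "(1 - fps_X) * I = inverse ((1 - fps_X) ^ a)"
    unfolding I_def power_Suc fps_inverse_mult mult.assoc[symmetric] by (simp add: inverse_mult_eq_1')
  then have "inverse ((1 - fps_X) ^ a) = I - fps_X * I" by (simp add: algebra_simps)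
  then show ?thesis unfolding mchoose_def I_def[symmetric] by simp
qed

text \<open>The coefficient of \<open>X\<^bsup>m-1-j\<^esup>\<close> in \<open>(1 - X)\<close> to the power \<open>-a\<close>, which is \<open>0\<close> for \<open>j \<ge> m\<close>. It counts lattice
  paths between points given by \<open>j\<close> and by \<open>(a, m)\<close>. Shifting the exponent by one allows for the value \<open>m = 0\<close>, for which
  the row vanishes.\<close>

definition path_entry :: "nat \<Rightarrow> nat \<Rightarrow> nat \<Rightarrow> real" where
  "path_entry a m j = (if j < m then mchoose a (m - 1 - j) else 0)"

text \<open>The determinant whose row \<open>i\<close> belongs to the end point \<open>(a i, m i)\<close>.\<close>

definition path_det :: "nat \<Rightarrow> (nat \<Rightarrow> nat) \<Rightarrow> (nat \<Rightarrow> nat) \<Rightarrow> real" where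
  "path_det n a m = det (mat n n (\<lambda>(i, j). path_entry (a i) (m i) j))"

lemma path_entry_Suc:
  "path_entry (Suc a) (Suc m) j = path_entry a (Suc m) j + path_entry (Suc a) m j"
proof -
  consider "j < m" | "j = m" | "m < j" by linarith
  then show ?thesis
  proof cases
    case 1
    then have "m - j = Suc (m - 1 - j)" by simp
    then show ?thesis using 1 by (simp add: path_entry_def mchoose_Suc)
  qed (auto simp: path_entry_def)
qed

lemma path_entry_zero_left: "path_entry 0 m j = (if m = Suc j then 1 else 0)"
  by (auto simp: path_entry_def mchoose_zero_left)

lemma det_row_split:
  fixes f g h :: "nat \<Rightarrow> nat \<Rightarrow> 'a::comm_ring_1"
  assumes i: "i < n" and fi: "\<And>j. j < n \<Longrightarrow> f i j = g i j + h i j"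
    and rest: "\<And>r j. r \<noteq> i \<Longrightarrow> f r j = g r j \<and> f r j = h r j"
  shows "det (mat n n (\<lambda>(r, j). f r j)) = det (mat n n (\<lambda>(r, j). g r j)) + det (mat n n (\<lambda>(r, j). h r j))"
proof -
  have del: "cofactor (mat n n (\<lambda>(r, j). q r j)) i j = cofactor (mat n n (\<lambda>(r, j). f r j)) i j"
    if "\<And>r j. r \<noteq> i \<Longrightarrow> f r j = q r j" for q j
  proof -
    have "mat_delete (mat n n (\<lambda>(r, j). q r j)) i j = mat_delete (mat n n (\<lambda>(r, j). f r j)) i j"
      unfolding mat_delete_def using i that by (intro eq_matI) auto
    then show ?thesis by (simp only: cofactor_def)
  qed
  have e: "det (mat n n (\<lambda>(r, j). q r j)) = (\<Sum>j<n. q i j * cofactor (mat n n (\<lambda>(r, j). f r j)) i j)"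
    if "\<And>r j. r \<noteq> i \<Longrightarrow> f r j = q r j" for q
  proof -
    have "det (mat n n (\<lambda>(r, j). q r j))
        = (\<Sum>j<n. mat n n (\<lambda>(r, j). q r j) $$ (i, j) * cofactor (mat n n (\<lambda>(r, j). q r j)) i j)"
      by (rule laplace_expansion_row[OF _ i]) simp
    also have "\<dots> = (\<Sum>j<n. q i j * cofactor (mat n n (\<lambda>(r, j). f r j)) i j)"
    proof (rule sum.cong[OF refl])
      fix j assume "j \<in> {..<n}"
      then have "mat n n (\<lambda>(r, j). q r j) $$ (i, j) = q i j" using i by simp
      moreover have "cofactor (mat n n (\<lambda>(r, j). q r j)) i j = cofactor (mat n n (\<lambda>(r, j). f r j)) i j"
        by (rule del) (rule that)
      ultimately show "mat n n (\<lambda>(r, j). q r j) $$ (i, j) * cofactor (mat n n (\<lambda>(r, j). q r j)) i j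
          = q i j * cofactor (mat n n (\<lambda>(r, j). f r j)) i j" by (simp only:)
    qed
    finally show ?thesis .
  qed
  have "det (mat n n (\<lambda>(r, j). f r j)) = (\<Sum>j<n. f i j * cofactor (mat n n (\<lambda>(r, j). f r j)) i j)"
    by (rule e) simp
  also have "\<dots> = (\<Sum>j<n. g i j * cofactor (mat n n (\<lambda>(r, j). f r j)) i j)
      + (\<Sum>j<n. h i j * cofactor (mat n n (\<lambda>(r, j). f r j)) i j)"
    unfolding sum.distrib[symmetric] by (rule sum.cong) (simp_all add: fi algebra_simps)
  also have "\<dots> = det (mat n n (\<lambda>(r, j). g r j)) + det (mat n n (\<lambda>(r, j). h r j))"
  proof -
    have "det (mat n n (\<lambda>(r, j). g r j)) = (\<Sum>j<n. g i j * cofactor (mat n n (\<lambda>(r, j). f r j)) i j)"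
      by (rule e) (use rest in blast)
    moreover have "det (mat n n (\<lambda>(r, j). h r j)) = (\<Sum>j<n. h i j * cofactor (mat n n (\<lambda>(r, j). f r j)) i j)"
      by (rule e) (use rest in blast)
    ultimately show ?thesis by (simp only:)
  qed
  finally show ?thesis .
qed

lemma path_det_split:
  assumes "i < n" "a i = Suc a'" "m i = Suc m'"
  shows "path_det n a m = path_det n (a(i := a')) m + path_det n a (m(i := m'))"
  unfolding path_det_def
  by (rule det_row_split[OF assms(1)]) (use assms path_entry_Suc in auto)

lemma path_det_row_zero:
  assumes "i < n" "\<And>j. j < n \<Longrightarrow> path_entry (a i) (m i) j = 0"
  shows "path_det n a m = 0"
  unfolding path_det_def by (subst laplace_expansion_row[OF mat_carrier assms(1)]) (use assms in auto)

lemma path_det_last_unit: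
  assumes "\<And>j. j < Suc n \<Longrightarrow> path_entry (a n) (m n) j = (if j = n then 1 else 0)"
  shows "path_det (Suc n) a m = path_det n a m"
  unfolding path_det_def by (subst det_unit_row[of _ "Suc n" n n])
    (use assms in \<open>auto simp: mat_delete_mat simp flip: mult_2 intro!: arg_cong[of _ _ det] mat_cong\<close>)

lemma path_det_first_unit:
  assumes "\<And>j. j < Suc n \<Longrightarrow> path_entry (a 0) (m 0) j = (if j = 0 then 1 else 0)"
    and "\<And>i. i < n \<Longrightarrow> m (Suc i) = Suc (m' i)"
  shows "path_det (Suc n) a m = path_det n (\<lambda>i. a (Suc i)) m'"
  unfolding path_det_def by (subst det_unit_row[of _ "Suc n" 0 0])
    (use assms in \<open>auto simp: mat_delete_mat path_entry_def intro!: arg_cong[of _ _ det] mat_cong\<close>)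

text \<open>The first coordinates of the end points decrease weakly and the second ones increase weakly. If
  neighbouring end points differ, there is a row in which both coordinates can be lowered by one without
  violating this, and \<open>path_det_split\<close> applies.\<close>

lemma path_det_nonneg:
  assumes "\<And>r. Suc r < n \<Longrightarrow> a (Suc r) \<le> a r \<and> m r \<le> m (Suc r)"
  shows "0 \<le> path_det n a m"
  using assms
proof (induction "\<Sum>r<n. a r + m r + 1" arbitrary: n a m rule: less_induct)
  case less
  note mono = less.prems
  show ?case
  proof (cases n)
    case 0
    then show ?thesis by (simp add: path_det_def)
  next
    case (Suc n')
    have mle: "m r \<le> m n'" if "r \<le> n'" for r
      using that
    proof (induction r rule: inc_induct)
      case (step r)
      then have "m r \<le> m (Suc r)" using mono[of r] Suc by simp
      then show ?case using step.IH by simp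
    qed simp
    show ?thesis
    proof (cases "\<exists>r. Suc r < n \<and> a r = a (Suc r) \<and> m r = m (Suc r)")
      case True
      then obtain r where r: "Suc r < n" "a r = a (Suc r)" "m r = m (Suc r)" by blast
      have "path_det n a m = 0"
        unfolding path_det_def
        by (rule det_identical_rows[of _ n r "Suc r"]) (use r in \<open>auto intro!: eq_vecI\<close>)
      then show ?thesis by simp
    next
      case distinct: False
      show ?thesis
      proof (cases "m 0 = 0")
        case True
        then show ?thesis
          using path_det_row_zero[of 0 n a m] Suc by (simp add: path_entry_def)
      next
        case m0: False
        show ?thesis
        proof (cases "a n' = 0")
          case an: True
          consider "m n' = Suc n'" | "m n' > Suc n'" | "m n' < Suc n'" by linarith
          then show ?thesis
          proof cases
            case 1
            then have "path_det n a m = path_det n' a m"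
              unfolding Suc by (intro path_det_last_unit) (auto simp: an path_entry_zero_left)
            also have "0 \<le> \<dots>" by (rule less.hyps) (use mono Suc in auto)
            finally show ?thesis .
          next
            case 2
            have "path_det n a m = 0"
              by (rule path_det_row_zero[of n']) (use 2 Suc in \<open>auto simp: an path_entry_zero_left\<close>)
            then show ?thesis by simp
          next
            case 3
            have z: "path_entry (a r) (m r) n' = 0" if "r < n" for r
            proof -
              have "m r \<le> n'" using mle[of r] 3 that Suc by linarith
              then show ?thesis by (simp add: path_entry_def)
            qed
            have n': "n' < n" using Suc by simp
            have "path_det n a m = 0"
              unfolding path_det_def
              by (subst laplace_expansion_column[OF mat_carrier n']) (use z n' in auto)
            then show ?thesis by simp
          qed
        next
          case an: False
          \<comment> \<open>In the first row \<open>i\<close> where the first coordinate may drop, the second one may drop too: all rows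
            before have the first coordinate of row \<open>i\<close>, so they differ from it in the second.\<close>
          define P where "P i \<longleftrightarrow> i = n' \<or> a (Suc i) < a i" for i
          define i where "i = (LEAST i. P i)"
          have Pi: "P i" unfolding i_def by (rule LeastI[of P n']) (simp add: P_def)
          have le: "i \<le> n'" unfolding i_def by (rule Least_le) (simp add: P_def)
          then have i: "i < n" using Suc by simp
          have ai: "a i > 0" using Pi an by (auto simp: P_def)
          have prev: "m r < m i" if "Suc r = i" for r
          proof -
            have "\<not> P r" unfolding i_def by (rule not_less_Least) (use that in \<open>simp add: i_def\<close>)
            then have "a r = a i" using mono[of r] i that by (auto simp: P_def)
            then have "m r \<noteq> m i" using distinct i that by auto
            then show ?thesis using mono[of r] i that by (simp add: order_less_le)
          qed
          have mi: "m i > 0"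
          proof (cases i)
            case 0
            then show ?thesis using m0 by simp
          next
            case (Suc r)
            then show ?thesis using prev[of r] by simp
          qed
          obtain a' m' where am: "a i = Suc a'" "m i = Suc m'"
            using ai mi by (metis gr0_conv_Suc)
          have split: "path_det n a m = path_det n (a(i := a')) m + path_det n a (m(i := m'))"
            by (rule path_det_split[of i n a a' m m', OF i am])
          have sum: "(\<Sum>r<n. f r) < (\<Sum>r<n. g r)"
            if "f i < g i" "\<And>r. f r \<le> g r" for f g :: "nat \<Rightarrow> nat"
            by (rule sum_strict_mono_ex1) (use that i in auto)
          have "0 \<le> path_det n (a(i := a')) m"
          proof (rule less.hyps)
            show "(\<Sum>r<n. (a(i := a')) r + m r + 1) < (\<Sum>r<n. a r + m r + 1)"
              by (rule sum) (auto simp: am)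
            fix r assume r: "Suc r < n"
            have "a (Suc i) \<le> a'" if "i \<noteq> n'" using Pi that am by (simp add: P_def)
            then show "(a(i := a')) (Suc r) \<le> (a(i := a')) r \<and> m r \<le> m (Suc r)"
              using mono[OF r] am Suc r by auto
          qed
          moreover have "0 \<le> path_det n a (m(i := m'))"
          proof (rule less.hyps)
            show "(\<Sum>r<n. a r + (m(i := m')) r + 1) < (\<Sum>r<n. a r + m r + 1)"
              by (rule sum) (auto simp: am)
            fix r assume r: "Suc r < n"
            have "m r \<le> m'" if "Suc r = i" using prev[OF that] am by simp
            then show "a (Suc r) \<le> a r \<and> (m(i := m')) r \<le> (m(i := m')) (Suc r)"
              using mono[OF r] am by auto
          qed
          ultimately show ?thesis unfolding split by simp
        qed
      qed
    qed
  qed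
qed

text \<open>Lowering the second coordinate of the first end point step by step to \<open>1\<close> does not increase the determinant, by
  \<open>path_det_nonneg\<close> for the other term. Then the first row is a unit vector.\<close>

lemma path_det_pos:
  assumes "\<And>r. Suc r < n \<Longrightarrow> a (Suc r) < a r" "\<And>r. r < n \<Longrightarrow> 1 \<le> a r"
  shows "1 \<le> path_det n a (\<lambda>r. Suc (q + r))"
  using assms
proof (induction n arbitrary: a)
  case 0
  then show ?case by (simp add: path_det_def)
next
  case (Suc n)
  define m where "m t = (\<lambda>r. Suc (q + r))(0 := t)" for t
  have "1 \<le> path_det (Suc n) a (m t)" if "1 \<le> t" "t \<le> Suc q" for t
    using that
  proof (induction t rule: dec_induct)
    case base
    have "path_det (Suc n) a (m 1) = path_det n (\<lambda>i. a (Suc i)) (\<lambda>r. Suc (q + r))"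
      by (rule path_det_first_unit) (auto simp: m_def path_entry_def)
    also have "1 \<le> \<dots>" by (rule Suc.IH) (use Suc.prems in auto)
    finally show ?case .
  next
    case (step t)
    obtain a' where a': "a 0 = Suc a'" using Suc.prems(2)[of 0] by (cases "a 0") auto
    have "path_det (Suc n) a (m (Suc t))
        = path_det (Suc n) (a(0 := a')) (m (Suc t)) + path_det (Suc n) a ((m (Suc t))(0 := t))"
      by (rule path_det_split) (auto simp: m_def a')
    also have "(m (Suc t))(0 := t) = m t" by (simp add: m_def)
    finally have s: "path_det (Suc n) a (m (Suc t))
        = path_det (Suc n) (a(0 := a')) (m (Suc t)) + path_det (Suc n) a (m t)" .
    have "0 \<le> path_det (Suc n) (a(0 := a')) (m (Suc t))"
    proof (rule path_det_nonneg)
      fix r assume r: "Suc r < Suc n"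
      have "a (Suc r) \<le> (a(0 := a')) r" using Suc.prems(1)[OF r] a' by (cases r) auto
      moreover have "m (Suc t) r \<le> m (Suc t) (Suc r)" using step.prems by (auto simp: m_def)
      ultimately show "(a(0 := a')) (Suc r) \<le> (a(0 := a')) r \<and> m (Suc t) r \<le> m (Suc t) (Suc r)"
        by simp
    qed
    moreover have "1 \<le> path_det (Suc n) a (m t)" using step by simp
    ultimately show ?case unfolding s by simp
  qed
  from this[of "Suc q"] have "1 \<le> path_det (Suc n) a (m (Suc q))" by simp
  moreover have "m (Suc q) = (\<lambda>r. Suc (q + r))" by (auto simp: m_def)
  ultimately show ?case by simp
qed


section \<open>The leading coefficient\<close>

lemma coeff_mult_top:
  fixes p q :: "'a::comm_ring_1 poly"
  assumes "degree p \<le> a" "degree q \<le> b"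
  shows "coeff (p * q) (a + b) = coeff p a * coeff q b"
proof -
  have "coeff (p * q) (a + b) = (\<Sum>i\<le>a + b. if i = a then coeff p a * coeff q b else 0)"
    unfolding coeff_mult
  proof (rule sum.cong[OF refl])
    fix i assume "i \<in> {..a + b}"
    then consider "i = a" | "a < i" | "i < a" "b < a + b - i" by force
    then show "coeff p i * coeff q (a + b - i) = (if i = a then coeff p a * coeff q b else 0)"
      by cases (use assms in \<open>simp_all add: coeff_eq_0\<close>)
  qed
  then show ?thesis by simp
qed

lemma coeff_prod_top:
  fixes f :: "'b \<Rightarrow> 'a::comm_ring_1 poly"
  assumes "finite I" "\<And>i. i \<in> I \<Longrightarrow> degree (f i) \<le> d i"
  shows "degree (prod f I) \<le> sum d I \<and> coeff (prod f I) (sum d I) = (\<Prod>i\<in>I. coeff (f i) (d i))"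
  using assms
proof (induction I rule: finite_induct)
  case (insert x I)
  have "degree (f x * prod f I) \<le> d x + sum d I"
    using degree_mult_le[of "f x" "prod f I"] insert by (meson add_mono insertCI order_trans)
  moreover have "coeff (f x * prod f I) (d x + sum d I) = coeff (f x) (d x) * coeff (prod f I) (sum d I)"
    by (rule coeff_mult_top) (use insert in auto)
  ultimately show ?case using insert by simp
qed simp

text \<open>If the entry \<open>(i, j)\<close> has degree at most \<open>k + i - j\<close>, then every term of the Leibniz expansion has
  degree at most \<open>n k\<close>.\<close>

lemma det_graded:
  fixes M :: "nat \<Rightarrow> nat \<Rightarrow> 'a::comm_ring_1 poly"
  assumes deg: "\<And>i j. i < n \<Longrightarrow> j \<le> k + i \<Longrightarrow> degree (M i j) \<le> k + i - j"
    and zero: "\<And>i j. i < n \<Longrightarrow> k + i < j \<Longrightarrow> M i j = 0"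
    and N: "\<And>i j. i < n \<Longrightarrow> N i j = (if j \<le> k + i then coeff (M i j) (k + i - j) else 0)"
  shows "degree (det (mat n n (\<lambda>(i, j). M i j))) \<le> n * k"
    and "coeff (det (mat n n (\<lambda>(i, j). M i j))) (n * k) = det (mat n n (\<lambda>(i, j). N i j))"
proof -
  have tm: "degree (\<Prod>i = 0..<n. M i (p i)) \<le> n * k
      \<and> coeff (\<Prod>i = 0..<n. M i (p i)) (n * k) = (\<Prod>i = 0..<n. N i (p i))"
    if p: "p permutes {0..<n}" for p
  proof (cases "\<forall>i\<in>{0..<n}. p i \<le> k + i")
    case True
    have "(\<Sum>i = 0..<n. k + i - p i) + (\<Sum>i = 0..<n. p i) = (\<Sum>i = 0..<n. k + i)"
      unfolding sum.distrib[symmetric] by (rule sum.cong) (use True in auto)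
    also have "\<dots> = n * k + (\<Sum>i = 0..<n. i)" by (simp add: sum.distrib)
    also have "(\<Sum>i = 0..<n. i) = (\<Sum>i = 0..<n. p i)"
      using sum.permute[OF p, of "\<lambda>i. i"] by (simp add: o_def)
    finally have s: "(\<Sum>i = 0..<n. k + i - p i) = n * k" by simp
    have "degree (\<Prod>i = 0..<n. M i (p i)) \<le> (\<Sum>i = 0..<n. k + i - p i)
      \<and> coeff (\<Prod>i = 0..<n. M i (p i)) (\<Sum>i = 0..<n. k + i - p i)
        = (\<Prod>i = 0..<n. coeff (M i (p i)) (k + i - p i))"
      by (rule coeff_prod_top) (use True deg in auto)
    moreover have "(\<Prod>i = 0..<n. coeff (M i (p i)) (k + i - p i)) = (\<Prod>i = 0..<n. N i (p i))"
      by (rule prod.cong) (use True N in auto)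
    ultimately show ?thesis unfolding s by simp
  next
    case False
    then obtain i where i: "i \<in> {0..<n}" "k + i < p i" by (auto simp: not_le)
    have "(\<Prod>i = 0..<n. M i (p i)) = 0"
      by (rule prod_zero) (use i zero in \<open>auto intro!: bexI[of _ i]\<close>)
    moreover have "(\<Prod>i = 0..<n. N i (p i)) = 0"
      by (rule prod_zero) (use i N in \<open>auto intro!: bexI[of _ i]\<close>)
    ultimately show ?thesis by simp
  qed
  have sgn: "signof p = ([:signof p:] :: 'a poly)" for p :: "nat \<Rightarrow> nat"
    by (simp add: sign_def one_pCons)
  show "degree (det (mat n n (\<lambda>(i, j). M i j))) \<le> n * k"
    unfolding det_mat_leibniz
  proof (rule degree_sum_le)
    show "finite {p. p permutes {0..<n}}" by (rule finite_permutations) simp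
    fix p assume "p \<in> {p. p permutes {0..<n}}"
    then show "degree (signof p * (\<Prod>i = 0..<n. M i (p i))) \<le> n * k"
      unfolding sgn using tm[of p] by (simp add: order_trans[OF degree_smult_le])
  qed
  show "coeff (det (mat n n (\<lambda>(i, j). M i j))) (n * k) = det (mat n n (\<lambda>(i, j). N i j))"
    unfolding det_mat_leibniz coeff_sum
    by (rule sum.cong[OF refl]) (unfold sgn, use tm in simp)
qed

lemma inverse_one_minus_power:
  "fps_nth (inverse ((1 - fps_const \<beta> * fps_X) ^ a)) t = mchoose a t * \<beta> ^ t" for \<beta> :: real
proof (cases "a = 0")
  case True
  then show ?thesis by (simp add: mchoose_def)
next
  case False
  then have "fps_nth (inverse ((1 - fps_const c * fps_X) ^ a)) t = real ((a + t - 1) choose t) * c ^ t" for c :: real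
    using one_minus_const_fps_X_neg_power'[of a c] by simp
  from this[of \<beta>] this[of 1] show ?thesis by (simp add: mchoose_def)
qed

text \<open>The coefficient of \<open>s\<^sup>N\<close> in \<open>row_series \<beta> a e\<close>, as a polynomial in \<open>\<beta>\<close>.\<close>

definition row_poly :: "nat \<Rightarrow> nat \<Rightarrow> nat \<Rightarrow> real poly" where
  "row_poly a e N = (\<Sum>t\<le>N. monom (mchoose a t * mchoose e (N - t)) t)"

lemma row_series_nth: "fps_nth (row_series \<beta> a e) N = poly (row_poly a e N) \<beta>"
proof -
  have "row_series \<beta> a e = inverse ((1 - fps_const \<beta> * fps_X) ^ a) * inverse ((1 - fps_X) ^ e)"
    by (simp add: row_series_def fps_inverse_mult)
  then have "fps_nth (row_series \<beta> a e) N = (\<Sum>t\<le>N. mchoose a t * \<beta> ^ t * mchoose e (N - t))"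
    by (simp only: fps_mult_nth inverse_one_minus_power mchoose_def[symmetric] atLeast0AtMost)
  then show ?thesis by (simp add: row_poly_def poly_sum poly_monom mult_ac)
qed

lemma degree_row_poly: "degree (row_poly a e N) \<le> N"
  unfolding row_poly_def by (rule degree_sum_le) (auto intro: order_trans[OF degree_monom_le])

lemma lead_row_poly: "coeff (row_poly a e N) N = mchoose a N"
  by (simp add: row_poly_def coeff_sum)

theorem groth_degree:
  assumes n: "n \<ge> 1" and p: "p \<ge> 1" and perm: "varpi n k p permutes {1..m}"
  defines "L \<equiv> path_det n (\<lambda>i. (n - i) * p) (\<lambda>i. Suc (k + i))"
  shows "degree (groth_at_ones m (varpi n k p)) = n * k"
    and "real_of_int (coeff (groth_at_ones m (varpi n k p)) (n * k)) = L"
proof -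
  define G where "G = groth_at_ones m (varpi n k p)"
  define M where "M i j = (if j \<le> k + i then row_poly ((n - i) * p) (n - i) (k + i - j) else 0)" for i j
  have perm': "flag_perm k (stair n p) permutes {1..m}" using perm varpi_eq[OF p] by simp
  have "poly (map_poly real_of_int G) \<beta> = poly (det (mat n n (\<lambda>(i, j). M i j))) \<beta>" if \<beta>: "\<beta> > 0" for \<beta>
  proof -
    have "poly (map_poly real_of_int G) \<beta> = Gr (\<beta> - 1) m (\<lambda>i. 1) (flag_perm k (stair n p))"
      using poly_groth_at_ones[OF perm, of \<beta>] unfolding G_def varpi_eq[OF p] .
    also have "\<dots> = det (mat n n (\<lambda>(i, j). row_entry \<beta> k (stair n p) i j))"
      using Gr_ones_flag_perm[OF sorted_stair[OF p] flag_size_le[OF p n perm'] \<beta>] by simp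
    also have "mat n n (\<lambda>(i, j). row_entry \<beta> k (stair n p) i j) = mat n n (\<lambda>(i, j). poly (M i j) \<beta>)"
      by (rule eq_matI) (auto simp: row_entry_def nth_stair M_def fps_X_power_mult_nth row_series_nth)
    also have "det \<dots> = poly (det (mat n n (\<lambda>(i, j). M i j))) \<beta>"
      unfolding det_mat_leibniz by (simp add: poly_sum poly_prod)
    finally show ?thesis .
  qed
  then have eq: "map_poly real_of_int G = det (mat n n (\<lambda>(i, j). M i j))"
    by (rule poly_eq_from_positive)
  have deg: "degree (M i j) \<le> k + i - j" if "j \<le> k + i" for i j
    using that by (simp add: M_def degree_row_poly)
  have N: "path_entry ((n - i) * p) (Suc (k + i)) j
      = (if j \<le> k + i then coeff (M i j) (k + i - j) else 0)" for i j
    by (simp add: path_entry_def M_def lead_row_poly less_Suc_eq_le)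
  have 1: "degree (map_poly real_of_int G) \<le> n * k"
    unfolding eq by (rule det_graded(1)) (use deg N in \<open>auto simp: M_def\<close>)
  have 2: "coeff (map_poly real_of_int G) (n * k) = L"
    unfolding eq L_def path_det_def by (rule det_graded(2)) (use deg N in \<open>auto simp: M_def\<close>)
  show "real_of_int (coeff (groth_at_ones m (varpi n k p)) (n * k)) = L"
    using 2 by (simp add: G_def coeff_map_poly)
  have "1 \<le> L" unfolding L_def
    by (rule path_det_pos) (use p in auto)
  then have "coeff G (n * k) \<noteq> 0" using 2 by (auto simp: coeff_map_poly)
  moreover have "degree G \<le> n * k"
  proof (rule degree_le, intro allI impI)
    fix i assume "n * k < i"
    then have "coeff (map_poly real_of_int G) i = 0" using 1 by (simp add: coeff_eq_0)
    then show "coeff G i = 0" by (simp add: coeff_map_poly)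
  qed
  ultimately show "degree (groth_at_ones m (varpi n k p)) = n * k"
    unfolding G_def by (simp add: le_degree order_antisym)
qed


section \<open>Two bases of polynomials\<close>

text \<open>The rows are linear functionals on power series, the columns are the power series \<open>f j\<close> that they
  are applied to.\<close>

lemma det_change_basis:
  fixes f g :: "nat \<Rightarrow> real fps"
  assumes "\<And>j. j < n \<Longrightarrow> f j = (\<Sum>l<n. fps_const (U l j) * g l)"
  shows "det (mat n n (\<lambda>(r, j). fps_nth (f j * \<phi> r) (N r)))
    = det (mat n n (\<lambda>(r, j). fps_nth (g j * \<phi> r) (N r))) * det (mat n n (\<lambda>(l, j). U l j))"
proof -
  have "mat n n (\<lambda>(r, j). fps_nth (f j * \<phi> r) (N r))
      = mat n n (\<lambda>(r, j). fps_nth (g j * \<phi> r) (N r)) * mat n n (\<lambda>(l, j). U l j)"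
  proof (rule eq_matI)
    fix r j assume "r < dim_row (mat n n (\<lambda>(r, j). fps_nth (g j * \<phi> r) (N r)) * mat n n (\<lambda>(l, j). U l j))"
      "j < dim_col (mat n n (\<lambda>(r, j). fps_nth (g j * \<phi> r) (N r)) * mat n n (\<lambda>(l, j). U l j))"
    then have rj: "r < n" "j < n" by auto
    have "fps_nth (f j * \<phi> r) (N r) = (\<Sum>l<n. U l j * fps_nth (g l * \<phi> r) (N r))"
      unfolding assms[OF rj(2)] sum_distrib_right fps_sum_nth mult.assoc fps_mult_left_const_nth ..
    then show "mat n n (\<lambda>(r, j). fps_nth (f j * \<phi> r) (N r)) $$ (r, j)
        = (mat n n (\<lambda>(r, j). fps_nth (g j * \<phi> r) (N r)) * mat n n (\<lambda>(l, j). U l j)) $$ (r, j)"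
      using rj by (simp add: scalar_prod_def atLeast0LessThan mult.commute)
  qed auto
  then show ?thesis by (simp add: det_mult[of _ n])
qed

lemma coeff_shifted_choose:
  assumes a: "a \<ge> 1" and c: "c < N + a"
  shows "fps_nth ((1 - fps_X) ^ c * inverse ((1 - fps_X) ^ a)) N = real ((N + a - 1 - c) choose N)"
proof -
  define x :: "real fps" where "x = 1 - fps_X"
  have x: "x * inverse x = 1" unfolding x_def by (rule inverse_mult_eq_1') simp
  have pw: "x ^ d * inverse (x ^ d) = 1" for d
    using x by (simp add: fps_inverse_power flip: power_mult_distrib)
  show ?thesis
  proof (cases "c < a")
    case True
    then have "x ^ a = x ^ c * x ^ (a - c)" by (simp flip: power_add)
    then have "x ^ c * inverse (x ^ a) = inverse (x ^ (a - c))"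
      by (simp add: fps_inverse_mult pw flip: mult.assoc)
    moreover have "fps_nth (inverse (x ^ (a - c))) N = real ((a - c + N - 1) choose N)"
      using one_minus_const_fps_X_neg_power'[of "a - c" "1::real"] True by (simp add: x_def)
    ultimately show ?thesis using True by (simp add: x_def add.commute)
  next
    case False
    then have "x ^ c = x ^ (c - a) * x ^ a" by (simp flip: power_add)
    then have "x ^ c * inverse (x ^ a) = x ^ (c - a)" by (simp add: mult.assoc pw)
    moreover have "fps_nth (x ^ (c - a)) N = 0"
      using nth_one_minus_X_power[of 1 "c - a" N] False c by (simp add: x_def)
    ultimately show ?thesis using False a c by (simp add: x_def)
  qed
qed

text \<open>The left-hand side belongs to the basis \<open>X\<^sup>j\<close> of the polynomials of degree less than \<open>n\<close>, the right-hand side to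
  the basis \<open>(1 - X)\<^bsup>n-1-j\<^esup>\<close>. The matrices of the base changes through \<open>X\<^sup>j (1 - X)\<^bsup>n-1-j\<^esup>\<close> are
  unitriangular.\<close>

lemma path_det_eq_choose:
  assumes p: "p \<ge> 1"
  shows "path_det n (\<lambda>i. (n - i) * p) (\<lambda>i. Suc (k + i))
    = det (mat n n (\<lambda>(r, s). real (((n - r) * (p - 1) + s + k) choose (k + r))))"
proof -
  define x :: "real fps" where "x = 1 - fps_X"
  define \<phi> where "\<phi> r = inverse (x ^ ((n - r) * p))" for r
  define N where "N r = k + r" for r
  define A where "A j = (fps_X :: real fps) ^ j" for j
  define B where "B j = (fps_X :: real fps) ^ j * x ^ (n - 1 - j)" for j
  define C where "C j = x ^ (n - 1 - j)" for j
  define U where "U l j = fps_nth (B j) l" for l j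
  define V where "V l j = real (j choose l)" for l j
  have Bnth: "U l j = (if l < j then 0 else (- 1) ^ (l - j) * real ((n - 1 - j) choose (l - j)))" for l j
    using nth_one_minus_X_power[of 1 "n - 1 - j" "l - j"]
    by (simp add: U_def B_def x_def fps_X_power_mult_nth)
  have BA: "B j = (\<Sum>l<n. fps_const (U l j) * A l)" if j: "j < n" for j
  proof (rule fps_ext)
    fix t
    have "fps_nth (\<Sum>l<n. fps_const (U l j) * A l) t = (\<Sum>l<n. if l = t then U t j else 0)"
      by (simp add: fps_sum_nth A_def fps_X_power_nth if_distrib cong: if_cong)
    also have "\<dots> = (if t < n then U t j else 0)" by simp
    also have "\<dots> = U t j" using j by (auto simp: Bnth)
    finally show "fps_nth (B j) t = fps_nth (\<Sum>l<n. fps_const (U l j) * A l) t"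
      by (simp add: U_def)
  qed
  have CB: "C j = (\<Sum>l<n. fps_const (V l j) * B l)" if j: "j < n" for j
  proof -
    \<comment> \<open>Here \<open>fps_X + x = 1\<close>.\<close>
    have "C j = C j * (fps_X + x) ^ j" by (simp add: x_def)
    also have "\<dots> = (\<Sum>l\<le>j. fps_const (V l j) * B l)"
      unfolding binomial_ring sum_distrib_left
    proof (rule sum.cong[OF refl])
      fix l assume "l \<in> {..j}"
      then have "n - 1 - l = (n - 1 - j) + (j - l)" using j by simp
      then have "x ^ (n - 1 - l) = x ^ (n - 1 - j) * x ^ (j - l)" by (simp only: power_add)
      then show "C j * (of_nat (j choose l) * fps_X ^ l * x ^ (j - l)) = fps_const (V l j) * B l"
        by (simp only: C_def B_def V_def fps_of_nat[symmetric] mult_ac)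
    qed
    also have "\<dots> = (\<Sum>l<n. fps_const (V l j) * B l)"
      by (rule sum.mono_neutral_left) (use j in \<open>auto simp: V_def\<close>)
    finally show ?thesis .
  qed
  have detU: "det (mat n n (\<lambda>(l, j). U l j)) = 1"
    by (rule det_unitriangular[of _ n]) (auto simp: Bnth)
  have detV: "det (mat n n (\<lambda>(l, j). V l j)) = 1"
    by (rule det_unitriangular[of _ n]) (auto simp: V_def)
  have "mat n n (\<lambda>(i, j). path_entry ((n - i) * p) (Suc (k + i)) j)
      = mat n n (\<lambda>(r, j). fps_nth (A j * \<phi> r) (N r))"
    by (rule eq_matI)
      (auto simp: path_entry_def mchoose_def A_def \<phi>_def N_def x_def fps_X_power_mult_nth)
  then have "path_det n (\<lambda>i. (n - i) * p) (\<lambda>i. Suc (k + i)) = det (mat n n (\<lambda>(r, j). fps_nth (A j * \<phi> r) (N r)))"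
    by (simp add: path_det_def)
  also have "\<dots> = det (mat n n (\<lambda>(r, j). fps_nth (C j * \<phi> r) (N r)))"
    using det_change_basis[OF BA, where \<phi> = \<phi> and N = N]
      det_change_basis[OF CB, where \<phi> = \<phi> and N = N] detU detV by simp
  also have "mat n n (\<lambda>(r, j). fps_nth (C j * \<phi> r) (N r))
      = mat n n (\<lambda>(r, s). real (((n - r) * (p - 1) + s + k) choose (k + r)))"
  proof (rule mat_cong)
    fix r s assume rs: "r < n" "s < n"
    obtain p' where p': "p = Suc p'" using p by (cases p) auto
    have e: "(n - r) * p = (n - r) * (p - 1) + (n - r)" by (simp add: p')
    have "fps_nth (C s * \<phi> r) (N r) = real ((N r + (n - r) * p - 1 - (n - 1 - s)) choose N r)"
      unfolding C_def \<phi>_def x_def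
      by (rule coeff_shifted_choose) (use rs p in \<open>auto simp: N_def e\<close>)
    also have "N r + (n - r) * p - 1 - (n - 1 - s) = (n - r) * (p - 1) + s + k"
      unfolding e N_def using rs by simp
    finally show "fps_nth (C s * \<phi> r) (N r) = real (((n - r) * (p - 1) + s + k) choose (k + r))"
      by (simp add: N_def)
  qed
  finally show ?thesis .
qed

text \<open>The last row of the matrix of size \<open>n + 1\<close> is a unit vector.\<close>

lemma choose_det_extend:
  "det (mat (n+1) (n+1) (\<lambda>(r, s). let i = r + 1; j = s + 1 in
      int (((n + 1 - i) * (p - 1) + j + k - 1) choose (k + i - 1))))
    = det (mat n n (\<lambda>(r, s). int (((n - r) * (p - 1) + s + k) choose (k + r))))"
proof -
  define f where "f r s = int (((n - r) * (p - 1) + s + k) choose (k + r))" for r s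
  have eq: "(\<lambda>(r, s). let i = r + 1; j = s + 1 in
      int (((n + 1 - i) * (p - 1) + j + k - 1) choose (k + i - 1))) = (\<lambda>(r, s). f r s)"
    by (auto simp: f_def Let_def)
  have "det (mat (Suc n) (Suc n) (\<lambda>(r, s). f r s))
      = (-1) ^ (n + n) * det (mat_delete (mat (Suc n) (Suc n) (\<lambda>(r, s). f r s)) n n)"
    by (rule det_unit_row) (auto simp: f_def less_Suc_eq_le add.commute)
  also have "\<dots> = det (mat n n (\<lambda>(r, s). f r s))"
    unfolding mat_delete_mat by (auto simp flip: mult_2 intro!: arg_cong[of _ _ det] mat_cong)
  finally show ?thesis unfolding eq f_def by simp
qed

theorem leading_coefficient:
  assumes n: "n \<ge> 1" and p: "p \<ge> 1" and perm: "varpi n k p permutes {1..m}"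
  shows "coeff (groth_at_ones m (varpi n k p)) (n * k) =
          det (mat (n+1) (n+1) (\<lambda>(r, s). let i = r + 1; j = s + 1 in
            int (((n + 1 - i) * (p - 1) + j + k - 1) choose (k + i - 1))))"
proof -
  let ?D = "mat n n (\<lambda>(r, s). int (((n - r) * (p - 1) + s + k) choose (k + r)))"
  have "real_of_int (coeff (groth_at_ones m (varpi n k p)) (n * k))
      = det (mat n n (\<lambda>(r, s). real (((n - r) * (p - 1) + s + k) choose (k + r))))"
    unfolding groth_degree(2)[OF n p perm] by (rule path_det_eq_choose[OF p])
  also have "mat n n (\<lambda>(r, s). real (((n - r) * (p - 1) + s + k) choose (k + r))) = map_mat real_of_int ?D"
    by (rule eq_matI) auto
  also have "det \<dots> = real_of_int (det ?D)" by (rule of_int_hom.hom_det)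
  finally show ?thesis unfolding choose_det_extend by (simp only: of_int_eq_iff)
qed


section \<open>The values at one\<close>

theorem theorem5p10:
  fixes n k p :: nat
  assumes "n \<ge> 1" and "k \<ge> 1" and "p \<ge> 1"
  shows
    "(\<forall>m. varpi n 1 p permutes {1..m} \<longrightarrow>
        (map_poly of_int (groth_at_ones m (varpi n 1 p)) :: rat poly) =
          (\<Sum>j = 1..n+1. monom (1 / of_nat (n+1) * of_nat ((n+1) choose j)
                                 * of_nat (((n+1) * p) choose (j-1))) (j-1)))
     \<and> (k \<ge> 2 \<longrightarrow> (\<forall>m. varpi n k p permutes {1..m} \<longrightarrow>
        degree (groth_at_ones m (varpi n k p)) = n * k
        \<and> coeff (groth_at_ones m (varpi n k p)) (n * k) =
          det (mat (n+1) (n+1) (\<lambda>(r, s). let i = r + 1; j = s + 1 in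
            int (((n + 1 - i) * (p - 1) + j + k - 1) choose (k + i - 1))))))"
  using one_fixed_point[OF assms(1,3)] groth_degree(1)[OF assms(1,3)] leading_coefficient[OF assms(1,3)]
  by blast

end
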